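(* Let $\mathbb{B}_\rho^2(z)\subset\mathbb{R}^2$ be the open ball with radius $\rho>0$ and center $z\in\mathbb{R}^2$, let $f\in C_c^\infty(\mathbb{B}_\rho^2(z))$, and let $u\colon\mathbb{R}^2\times[0,\infty)\to\mathbb{R}$ be the solution of the wave equation $$(\partial_t^2-\Delta)u=0 \ \text{ on } \mathbb{R}^2\times(0,\infty),\qquad u(\cdot,0)=f,\qquad (\partial_t u)(\cdot,0)=0 \ \text{ on } \mathbb{R}^2 .$$ Let $a\ge0$ and $b>0$. Then, for every $x\in\mathbb{B}_\rho^2(z)$, $$f(x)=\frac{1}{b\pi}\int_{\partial\mathbb{B}_\rho^2(z)}\int_{\|x-y\|}^\infty \frac{a\,u(y,t)+b\,\partial_\nu u(y,t)}{\sqrt{t^2-\|x-y\|^2}}\,dt\,d\sigma(y).$$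
   Context: $C_c^\infty(\mathbb{B}_\rho^2(z))$ is the set of smooth real-valued functions with compact support in $\mathbb{B}_\rho^2(z)$, extended by zero to $\mathbb{R}^2$. $\|\cdot\|$ is the Euclidean norm, $\Delta$ is the Laplacian in the spatial variable, and $\sigma$ is the standard surface (arc length) measure on the circle $\partial\mathbb{B}_\rho^2(z)$. For $y\in\partial\mathbb{B}_\rho^2(z)$, $\nu(y)$ is the outward unit normal vector, and $\partial_\nu u(y,t)=\langle\nabla u(y,t),\nu(y)\rangle$ with $\nabla$ the gradient in the spatial variable. *)

theory Defs
  imports "HOL-Analysis.Analysis"
begin

text \<open>
  Partial derivative in the direction of a basis vector, relative to a set \<open>S\<close>. It is meant for sets
  on which derivatives are unique: open sets, where it is the usual partial derivative, and the
  closed half-space below, where it is one-sided at boundary points.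
\<close>
definition partial_within :: "'a::euclidean_space set \<Rightarrow> 'a \<Rightarrow> ('a \<Rightarrow> real) \<Rightarrow> 'a \<Rightarrow> real" where
  "partial_within S b g x = frechet_derivative g (at x within S) b"

abbreviation partial :: "'a::euclidean_space \<Rightarrow> ('a \<Rightarrow> real) \<Rightarrow> 'a \<Rightarrow> real" where
  "partial \<equiv> partial_within UNIV"

primrec Ck_on :: "nat \<Rightarrow> 'a::euclidean_space set \<Rightarrow> ('a \<Rightarrow> real) \<Rightarrow> bool" where
  "Ck_on 0 S g \<longleftrightarrow> continuous_on S g"
| "Ck_on (Suc k) S g \<longleftrightarrow>
     g differentiable_on S \<and> (\<forall>b\<in>Basis. Ck_on k S (partial_within S b g))"

definition smooth_on :: "'a::euclidean_space set \<Rightarrow> ('a \<Rightarrow> real) \<Rightarrow> bool" where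
  "smooth_on S g \<longleftrightarrow> (\<forall>k. Ck_on k S g)"

text \<open>
  The elements are total functions; the inclusion of the support in \<open>S\<close> makes them vanish
  outside \<open>S\<close>, i.e. they are already extended by zero.
\<close>
definition smooth_compact_support :: "'a::euclidean_space set \<Rightarrow> ('a \<Rightarrow> real) set" where
  "smooth_compact_support S =
     {f. smooth_on S f \<and> compact (closure {x. f x \<noteq> 0}) \<and> closure {x. f x \<noteq> 0} \<subseteq> S}"

definition grad :: "('a::euclidean_space \<Rightarrow> real) \<Rightarrow> 'a \<Rightarrow> 'a" where
  "grad g x = (\<Sum>b\<in>Basis. partial b g x *\<^sub>R b)"

definition laplacian :: "('a::euclidean_space \<Rightarrow> real) \<Rightarrow> 'a \<Rightarrow> real" where
  "laplacian g x = (\<Sum>b\<in>Basis. partial b (partial b g) x)"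

text \<open>
  Classical solution, of class \<open>C\<^sup>2\<close> up to the initial time, of the initial value problem with
  initial position \<open>f\<close> and initial velocity \<open>0\<close>. Only the values \<open>u x t\<close> with \<open>t \<ge> 0\<close> matter; in
  particular the time derivative at \<open>t = 0\<close> is one-sided.
\<close>
definition wave_solution :: "('a::euclidean_space \<Rightarrow> real) \<Rightarrow> ('a \<Rightarrow> real \<Rightarrow> real) \<Rightarrow> bool" where
  "wave_solution f u \<longleftrightarrow>
     Ck_on 2 (UNIV \<times> {0..}) (\<lambda>(x, t). u x t) \<and>
     (\<forall>x. \<forall>t>0. deriv (deriv (u x)) t - laplacian (\<lambda>y. u y t) x = 0) \<and>
     (\<forall>x. u x 0 = f x) \<and>
     (\<forall>x. (u x has_real_derivative 0) (at 0 within {0..}))"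

text \<open>
  Arc length measure on the circle with center \<open>z\<close> and radius \<open>\<rho>\<close>, as a Borel measure on the plane:
  the image of Lebesgue measure under the unit speed parametrization.
\<close>
definition circle_measure :: "real^2 \<Rightarrow> real \<Rightarrow> (real^2) measure" where
  "circle_measure z \<rho> =
     distr (restrict_space lborel {0..<2 * pi * \<rho>}) borel
       (\<lambda>s. z + \<rho> *\<^sub>R vector [cos (s / \<rho>), sin (s / \<rho>)])"

definition outward_normal :: "'a::euclidean_space \<Rightarrow> real \<Rightarrow> 'a \<Rightarrow> 'a" where
  "outward_normal z \<rho> y = (1 / \<rho>) *\<^sub>R (y - z)"

definition normal_deriv ::
    "'a::euclidean_space \<Rightarrow> real \<Rightarrow> ('a \<Rightarrow> real \<Rightarrow> real) \<Rightarrow> 'a \<Rightarrow> real \<Rightarrow> real" where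
  "normal_deriv z \<rho> u y t = grad (\<lambda>x. u x t) y \<bullet> outward_normal z \<rho> y"

end

theory Submission
  imports Defs
begin

text \<open>
  Write \<open>w = sin \<phi> (cos \<theta>, sin \<theta>)\<close>, so that \<open>(\<phi>, \<theta>)\<close> parametrises the upper unit hemisphere over the
  unit disc. For a solution \<open>u\<close> of the wave equation, the hemispherical average of
  \<open>u + \<tau> (w \<bullet> \<nabla>u + u\<^sub>t)\<close> at the point \<open>(y + \<tau> w, T - \<tau>)\<close> does not depend on \<open>\<tau>\<close>: its derivative is the
  average of the surface divergence of a tangential field. Comparing \<open>\<tau> = 0\<close> with \<open>\<tau> = T\<close> gives Poisson's
  formula for \<open>u\<close>, and by differentiation for \<open>\<nabla>u\<close>.

  Let \<open>g\<close> be \<open>f\<close> or a partial derivative of \<open>f\<close>, and let \<open>u\<close> now be the solution with initial position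
  \<open>g\<close>. The Abel integral of \<open>u(y, t) / sqrt (t\<^sup>2 - p)\<close> over \<open>t > sqrt p\<close> is, by Poisson's formula, the
  derivative in \<open>p\<close> of the planar logarithmic potential \<open>-(1/2\<pi>) \<integral> g(w) ln |p - |w - y|\<^sup>2| dw\<close>. At
  \<open>p = |x - y|\<^sup>2\<close> the argument of the logarithm is an affine function of \<open>y\<close> whose zero line passes through
  the midpoint of \<open>x\<close> and \<open>w\<close> and therefore meets the circle. Averaging over \<open>y\<close> first leads to
  \<open>\<integral> \<psi>(\<theta>) ln |cos (\<theta> - \<beta>) - c| d\<theta>\<close>, which for \<open>|c| \<le> 1\<close> is constant in \<open>c\<close> if \<open>\<psi> = 1\<close>, and equal to
  \<open>-2\<pi> c cos \<beta>\<close> and \<open>-2\<pi> c sin \<beta>\<close> for \<open>\<psi> = cos\<close> and \<open>\<psi> = sin\<close>. Differentiation in \<open>p\<close> moves \<open>c\<close>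
  linearly. Hence the part with \<open>u\<close> vanishes, and the part with the normal derivative becomes the integral
  of the radial derivative of \<open>f\<close> over all rays from \<open>x\<close>, that is, a multiple of \<open>f(x)\<close>.
\<close>

section \<open>Preliminaries in the plane\<close>

text \<open>The derivative in \<open>p\<close> of the logarithm is a principal value kernel, so it
  is never taken under the integral over the plane. The potential is averaged over the circle first,
  which makes it affine in the level of the cosine, and only then are difference quotients in a
  shift \<open>h\<close> of \<open>p\<close> formed. The substitution t = sqrt (p + v^2) turns dt /
  sqrt (t^2 - p) into dv / t, which has no endpoint singularity, and makes u / t twice the
  derivative of the potential in \<open>p\<close>. The potential need not be integrable in v up to
  infinity, so v is cut off at \<open>V\<close>; in the difference this costs O(h / V). Since x lies
  strictly inside the circle, the unshifted levels stay a fixed distance below 1 in modulus, which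
  leaves room for the shift. But \<open>h\<close> moves the level by a multiple of h / |w - x|. For
  w close to x only a bound linear in this quantity survives, and the Jacobian of polar coordinates
  about x absorbs its singularity. As u is only of class C^2, its gradient need not be regular
  enough for the argument that gives Poisson's formula for u; this is why the formula itself is
  differentiated.\<close>

definition dir :: "real \<Rightarrow> real^2" where
  "dir \<theta> = vector [cos \<theta>, sin \<theta>]"

lemma dir_nth [simp]: "dir \<theta> $ 1 = cos \<theta>" "dir \<theta> $ 2 = sin \<theta>"
  by (simp_all add: dir_def)

lemma norm_vec2: "norm (w :: real^2) = sqrt ((w $ 1)\<^sup>2 + (w $ 2)\<^sup>2)"
  by (simp add: norm_vec_def L2_set_def sum_2)

lemma inner_vec2: "(v :: real^2) \<bullet> w = v $ 1 * w $ 1 + v $ 2 * w $ 2"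
  by (simp add: inner_vec_def sum_2)

lemma norm_dir [simp]: "norm (dir \<theta>) = 1"
  by (simp add: norm_vec2)

lemma dir_has_vector_derivative:
  "(dir has_vector_derivative vector [- sin \<theta>, cos \<theta>]) (at \<theta> within S)"
proof -
  have "((\<lambda>\<theta>. \<chi> i. dir \<theta> $ i) has_vector_derivative (\<chi> i. vector [- sin \<theta>, cos \<theta>] $ i)) (at \<theta> within S)"
    unfolding has_vector_derivative_def
    apply (subst has_derivative_componentwise_within)
    apply (auto simp: Basis_vec_def inner_axis forall_2 intro!: derivative_eq_intros)
    done
  then show ?thesis by simp
qed

lemma continuous_on_dir [continuous_intros]:
  "continuous_on S h \<Longrightarrow> continuous_on S (\<lambda>x. dir (h x))"
proof (rule continuous_on_compose2[of UNIV dir])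
  show "continuous_on UNIV dir"
    by (meson continuous_at_imp_continuous_on dir_has_vector_derivative has_vector_derivative_continuous)
qed auto

lemma borel_measurable_dir [measurable]: "dir \<in> borel_measurable borel"
  by (intro borel_measurable_continuous_onI continuous_intros)

lemma borel_measurable_vec_nth2 [measurable]:
  "(\<lambda>x :: real^2. x $ i) \<in> borel_measurable borel"
  by (intro borel_measurable_continuous_onI continuous_intros)

text \<open>
  The subscripts 1, 2 and 3 stand for the two space directions and time; in a double subscript the first
  digit is the derivative taken last.
\<close>
definition half_deriv :: "(real^2 \<Rightarrow> real \<Rightarrow> real) \<Rightarrow> (real^2 \<Rightarrow> real \<Rightarrow> real)
    \<Rightarrow> (real^2 \<Rightarrow> real \<Rightarrow> real) \<Rightarrow> (real^2 \<Rightarrow> real \<Rightarrow> real) \<Rightarrow> bool" where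
  "half_deriv v v1 v2 v3 \<longleftrightarrow> (\<forall>x. \<forall>t\<ge>0. ((\<lambda>(x, t). v x t) has_derivative
     (\<lambda>(d, \<tau>). d $ 1 * v1 x t + d $ 2 * v2 x t + \<tau> * v3 x t)) (at (x, t) within UNIV \<times> {0..}))"

text \<open>Chain rule along a curve in the closed half-space. At time 0 the derivative of
  \<open>v\<close> is one-sided, so the curve must keep \<open>0 \<le> t r\<close> on all of
  \<open>I\<close>.\<close>

lemma half_deriv_path:
  assumes v: "half_deriv v v1 v2 v3"
    and x: "(x has_vector_derivative x') (at s within I)"
    and t: "(t has_real_derivative t') (at s within I)"
    and I: "\<And>r. r \<in> I \<Longrightarrow> 0 \<le> t r" "s \<in> I"
  shows "((\<lambda>s. v (x s) (t s)) has_real_derivative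
     x' $ 1 * v1 (x s) (t s) + x' $ 2 * v2 (x s) (t s) + t' * v3 (x s) (t s)) (at s within I)"
proof -
  have 1: "((\<lambda>s. (x s, t s)) has_derivative (\<lambda>h. (h *\<^sub>R x', t' * h))) (at s within I)"
    using x t unfolding has_vector_derivative_def has_field_derivative_def
    by (intro has_derivative_Pair)
  have 2: "((\<lambda>(x, t). v x t) has_derivative
     (\<lambda>(d, \<tau>). d $ 1 * v1 (x s) (t s) + d $ 2 * v2 (x s) (t s) + \<tau> * v3 (x s) (t s)))
     (at (x s, t s) within (\<lambda>s. (x s, t s)) ` I)"
    using v I unfolding half_deriv_def by (blast intro: has_derivative_subset)
  from has_derivative_in_compose[OF 1 2]
  have "((\<lambda>s. v (x s) (t s)) has_derivative (\<lambda>h. (h *\<^sub>R x') $ 1 * v1 (x s) (t s)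
      + (h *\<^sub>R x') $ 2 * v2 (x s) (t s) + (t' * h) * v3 (x s) (t s))) (at s within I)"
    by simp
  then show ?thesis
    unfolding has_field_derivative_def
    by (rule has_derivative_eq_rhs) (auto simp: fun_eq_iff algebra_simps)
qed

lemma half_deriv_continuous:
  assumes "half_deriv v v1 v2 v3"
  shows "continuous_on (UNIV \<times> {0..}) (\<lambda>(x, t). v x t)"
  unfolding continuous_on_eq_continuous_within
proof
  fix p :: "(real^2) \<times> real" assume p: "p \<in> UNIV \<times> {0..}"
  then show "continuous (at p within UNIV \<times> {0..}) (\<lambda>(x, t). v x t)"
    using assms unfolding half_deriv_def by (cases p) (auto intro: has_derivative_continuous)
qed

lemma continuous_on_half_compose:
  assumes "continuous_on (UNIV \<times> {0..}) (\<lambda>(x, t). v x t)"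
    and "continuous_on A X" "continuous_on A T" "\<And>a. a \<in> A \<Longrightarrow> 0 \<le> (T a :: real)"
  shows "continuous_on A (\<lambda>a. v (X a) (T a) :: real)"
  using continuous_on_compose2[OF assms(1), of A "\<lambda>a. (X a, T a)"] assms(2-4)
  by (force intro: continuous_intros)

text \<open>The second difference of \<open>f\<close> over the square with corner (a, b) and side h
  is h^2 times a value of \<open>fxy\<close> and also h^2 times a value of \<open>fyx\<close>, by
  the mean value theorem in the two orders. Continuity at the one point (a, b) then suffices to let
  h tend to 0.\<close>

lemma clairaut:
  fixes f fx fy fxy fyx :: "real \<Rightarrow> real \<Rightarrow> real"
  assumes d: "d > 0"
    and fx: "\<And>x y. \<bar>x - a\<bar> < d \<Longrightarrow> \<bar>y - b\<bar> < d \<Longrightarrow> ((\<lambda>x. f x y) has_real_derivative fx x y) (at x)"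
    and fy: "\<And>x y. \<bar>x - a\<bar> < d \<Longrightarrow> \<bar>y - b\<bar> < d \<Longrightarrow> ((\<lambda>y. f x y) has_real_derivative fy x y) (at y)"
    and fxy: "\<And>x y. \<bar>x - a\<bar> < d \<Longrightarrow> \<bar>y - b\<bar> < d \<Longrightarrow> ((\<lambda>y. fx x y) has_real_derivative fxy x y) (at y)"
    and fyx: "\<And>x y. \<bar>x - a\<bar> < d \<Longrightarrow> \<bar>y - b\<bar> < d \<Longrightarrow> ((\<lambda>x. fy x y) has_real_derivative fyx x y) (at x)"
    and cont: "isCont (\<lambda>(x, y). fxy x y) (a, b)" "isCont (\<lambda>(x, y). fyx x y) (a, b)"
  shows "fxy a b = fyx a b"
proof -
  have key: "\<exists>\<xi> \<eta> \<xi>' \<eta>'. a < \<xi> \<and> \<xi> < a + h \<and> b < \<eta> \<and> \<eta> < b + h \<and> a < \<xi>' \<and> \<xi>' < a + h \<and> b < \<eta>' \<and> \<eta>' < b + h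
      \<and> fxy \<xi> \<eta> = fyx \<xi>' \<eta>'" if h: "0 < h" "h < d" for h
  proof -
    define \<Delta> where "\<Delta> = f (a + h) (b + h) - f (a + h) b - f a (b + h) + f a b"
    have "\<exists>\<xi>. a < \<xi> \<and> \<xi> < a + h \<and> (f (a + h) (b + h) - f (a + h) b) - (f a (b + h) - f a b)
        = (a + h - a) * (fx \<xi> (b + h) - fx \<xi> b)"
      by (rule MVT2) (use h in \<open>auto intro!: derivative_eq_intros fx\<close>)
    then obtain \<xi> where \<xi>: "a < \<xi>" "\<xi> < a + h" "\<Delta> = h * (fx \<xi> (b + h) - fx \<xi> b)"
      by (auto simp: \<Delta>_def algebra_simps)
    have "\<exists>\<eta>. b < \<eta> \<and> \<eta> < b + h \<and> fx \<xi> (b + h) - fx \<xi> b = (b + h - b) * fxy \<xi> \<eta>"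
      by (rule MVT2) (use h \<xi> in \<open>auto intro!: fxy\<close>)
    then obtain \<eta> where \<eta>: "b < \<eta>" "\<eta> < b + h" "\<Delta> = h * (h * fxy \<xi> \<eta>)"
      using \<xi> by auto
    have "\<exists>\<eta>'. b < \<eta>' \<and> \<eta>' < b + h \<and> (f (a + h) (b + h) - f a (b + h)) - (f (a + h) b - f a b)
        = (b + h - b) * (fy (a + h) \<eta>' - fy a \<eta>')"
      by (rule MVT2) (use h in \<open>auto intro!: derivative_eq_intros fy\<close>)
    then obtain \<eta>' where \<eta>': "b < \<eta>'" "\<eta>' < b + h" "\<Delta> = h * (fy (a + h) \<eta>' - fy a \<eta>')"
      by (auto simp: \<Delta>_def algebra_simps)
    have "\<exists>\<xi>'. a < \<xi>' \<and> \<xi>' < a + h \<and> fy (a + h) \<eta>' - fy a \<eta>' = (a + h - a) * fyx \<xi>' \<eta>'"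
      by (rule MVT2) (use h \<eta>' in \<open>auto intro!: fyx\<close>)
    then obtain \<xi>' where \<xi>': "a < \<xi>'" "\<xi>' < a + h" "\<Delta> = h * (h * fyx \<xi>' \<eta>')"
      using \<eta>' by auto
    have "fxy \<xi> \<eta> = fyx \<xi>' \<eta>'" using \<eta>(3) \<xi>'(3) h by simp
    with \<xi> \<eta> \<xi>' \<eta>' show ?thesis by blast
  qed
  show ?thesis
  proof (rule ccontr)
    assume ne: "fxy a b \<noteq> fyx a b"
    define e where "e = \<bar>fxy a b - fyx a b\<bar> / 2"
    have e: "e > 0" using ne by (simp add: e_def)
    obtain d1 where d1: "d1 > 0" "\<And>p. dist p (a, b) < d1 \<Longrightarrow> dist (case p of (x, y) \<Rightarrow> fxy x y) (fxy a b) < e"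
      using cont(1) e unfolding continuous_at_eps_delta by fastforce
    obtain d2 where d2: "d2 > 0" "\<And>p. dist p (a, b) < d2 \<Longrightarrow> dist (case p of (x, y) \<Rightarrow> fyx x y) (fyx a b) < e"
      using cont(2) e unfolding continuous_at_eps_delta by fastforce
    \<comment> \<open>The points supplied by \<open>key\<close> are within distance 2 h of (a, b),
      so 2 h has to be below \<open>d1\<close> and \<open>d2\<close>.\<close>
    define h where "h = min d (min d1 d2) / 4"
    have h: "0 < h" "h < d" "2 * h < d1" "2 * h < d2"
      using d d1(1) d2(1) by (auto simp: h_def)
    obtain \<xi> \<eta> \<xi>' \<eta>' where x: "a < \<xi>" "\<xi> < a + h" "b < \<eta>" "\<eta> < b + h" "a < \<xi>'" "\<xi>' < a + h" "b < \<eta>'" "\<eta>' < b + h"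
      and eq: "fxy \<xi> \<eta> = fyx \<xi>' \<eta>'" using key[OF h(1,2)] by blast
    have dd: "dist (p, q) (a, b) < 2 * h" if "a < p" "p < a + h" "b < q" "q < b + h" for p q
    proof -
      have "dist (p, q) (a, b) \<le> dist p a + dist q b"
        by (simp add: dist_Pair_Pair sqrt_sum_squares_le_sum)
      also have "\<dots> < 2 * h" using that by (auto simp: dist_real_def)
      finally show ?thesis .
    qed
    have "dist (fxy \<xi> \<eta>) (fxy a b) < e" using d1(2)[of "(\<xi>, \<eta>)"] dd[of \<xi> \<eta>] x h by auto
    moreover have "dist (fyx \<xi>' \<eta>') (fyx a b) < e" using d2(2)[of "(\<xi>', \<eta>')"] dd[of \<xi>' \<eta>'] x h by auto
    ultimately show False using eq ne unfolding e_def dist_real_def by (smt (verit) field_sum_of_halves)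
  qed
qed

text \<open>Poisson's formula with initial position \<open>g\<close>, whose gradient is \<open>(g1, g2)\<close>.\<close>
definition poisson_sol :: "(real^2 \<Rightarrow> real) \<Rightarrow> (real^2 \<Rightarrow> real) \<Rightarrow> (real^2 \<Rightarrow> real) \<Rightarrow> real^2 \<Rightarrow> real \<Rightarrow> real" where
  "poisson_sol g g1 g2 y t = 1 / (2 * pi) * integral (cbox (0, 0) (pi / 2, 2 * pi)) (\<lambda>(\<phi>, \<theta>).
     sin \<phi> * (g (y + (t * sin \<phi>) *\<^sub>R dir \<theta>) + t * (sin \<phi> *
       (cos \<theta> * g1 (y + (t * sin \<phi>) *\<^sub>R dir \<theta>) + sin \<theta> * g2 (y + (t * sin \<phi>) *\<^sub>R dir \<theta>)))))"

text \<open>The integrand is sin \<phi> times the divergence, on the unit hemisphere, of the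
  tangential part of the field (u1, u2, 0), evaluated at y + \<tau> w. Its components along the
  meridian and the parallel are cos \<phi> (cos \<theta> u1 + sin \<theta> u2) and - sin \<theta> u1
  + cos \<theta> u2; sin \<phi> times the first, differentiated in \<phi>, is \<open>P'\<close>, and
  the second, differentiated in \<theta>, is \<open>Q'\<close>.\<close>

lemma hemisphere_divergence:
  fixes y :: "real^2" and \<tau> s :: real
  assumes d1: "half_deriv u1 u11 u21 u31" and d2: "half_deriv u2 u12 u22 u32"
    and c[unfolded case_prod_unfold]: "continuous_on (UNIV \<times> {0..}) (\<lambda>(x, t). u11 x t)"
     "continuous_on (UNIV \<times> {0..}) (\<lambda>(x, t). u12 x t)"
     "continuous_on (UNIV \<times> {0..}) (\<lambda>(x, t). u21 x t)"
     "continuous_on (UNIV \<times> {0..}) (\<lambda>(x, t). u22 x t)"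
    and s: "s \<ge> 0"
  defines "q \<equiv> \<lambda>\<phi> \<theta>. y + (\<tau> * sin \<phi>) *\<^sub>R dir \<theta>"
  shows "integral (cbox (0, 0) (pi / 2, 2 * pi)) (\<lambda>(\<phi>, \<theta>). sin \<phi> * (\<tau> * (u11 (q \<phi> \<theta>) s + u22 (q \<phi> \<theta>) s
      - (sin \<phi>)\<^sup>2 * ((cos \<theta>)\<^sup>2 * u11 (q \<phi> \<theta>) s + cos \<theta> * sin \<theta> * (u12 (q \<phi> \<theta>) s + u21 (q \<phi> \<theta>) s)
         + (sin \<theta>)\<^sup>2 * u22 (q \<phi> \<theta>) s))
      - 2 * sin \<phi> * (cos \<theta> * u1 (q \<phi> \<theta>) s + sin \<theta> * u2 (q \<phi> \<theta>) s))) = 0"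
proof -
  define P' where "P' = (\<lambda>\<phi> \<theta>. ((cos \<phi>)\<^sup>2 - (sin \<phi>)\<^sup>2) * (cos \<theta> * u1 (q \<phi> \<theta>) s + sin \<theta> * u2 (q \<phi> \<theta>) s)
     + sin \<phi> * cos \<phi> * (\<tau> * cos \<phi>) * (cos \<theta> * (cos \<theta> * u11 (q \<phi> \<theta>) s + sin \<theta> * u21 (q \<phi> \<theta>) s)
        + sin \<theta> * (cos \<theta> * u12 (q \<phi> \<theta>) s + sin \<theta> * u22 (q \<phi> \<theta>) s)))"
  define Q' where "Q' = (\<lambda>\<phi> \<theta>. - cos \<theta> * u1 (q \<phi> \<theta>) s - sin \<theta> * u2 (q \<phi> \<theta>) s
     + \<tau> * sin \<phi> * (- sin \<theta> * (- sin \<theta> * u11 (q \<phi> \<theta>) s + cos \<theta> * u21 (q \<phi> \<theta>) s)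
        + cos \<theta> * (- sin \<theta> * u12 (q \<phi> \<theta>) s + cos \<theta> * u22 (q \<phi> \<theta>) s)))"
  note cc = continuous_on_half_compose[OF half_deriv_continuous[OF d1]]
    continuous_on_half_compose[OF half_deriv_continuous[OF d2]]
    c[THEN continuous_on_half_compose[unfolded case_prod_unfold]]
  note [continuous_intros] = cc
  \<comment> \<open>The primitive contains sin \<phi> cos \<phi>: it vanishes at the pole, and at
    the equator, where the projected field has no component across the boundary.\<close>
  have P: "integral (cbox 0 (pi/2)) (\<lambda>\<phi>. P' \<phi> \<theta>) = 0" for \<theta>
  proof -
    have "((\<lambda>\<phi>. P' \<phi> \<theta>) has_integral
       sin (pi/2) * cos (pi/2) * (cos \<theta> * u1 (q (pi/2) \<theta>) s + sin \<theta> * u2 (q (pi/2) \<theta>) s)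
       - sin 0 * cos 0 * (cos \<theta> * u1 (q 0 \<theta>) s + sin \<theta> * u2 (q 0 \<theta>) s)) {0..pi/2}"
      apply (rule fundamental_theorem_of_calculus, simp)
      unfolding has_real_derivative_iff_has_vector_derivative[symmetric]
      apply (rule derivative_eq_intros half_deriv_path[OF d1] half_deriv_path[OF d2] refl | simp add: s q_def)+
      apply (simp add: P'_def q_def power2_eq_square algebra_simps)
      done
    then show ?thesis by (simp add: integral_unique)
  qed
  have Q: "integral (cbox 0 (2*pi)) (\<lambda>\<theta>. Q' \<phi> \<theta>) = 0" for \<phi>
  proof -
    have vq: "((\<lambda>\<theta>. q \<phi> \<theta>) has_vector_derivative (\<tau> * sin \<phi>) *\<^sub>R vector [- sin \<theta>, cos \<theta>]) (at \<theta> within {0..2*pi})" for \<theta>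
      unfolding q_def by (auto intro!: derivative_eq_intros dir_has_vector_derivative)
    have "((\<lambda>\<theta>. Q' \<phi> \<theta>) has_integral
       (- sin (2*pi) * u1 (q \<phi> (2*pi)) s + cos (2*pi) * u2 (q \<phi> (2*pi)) s)
       - (- sin 0 * u1 (q \<phi> 0) s + cos 0 * u2 (q \<phi> 0) s)) {0..2*pi}"
      apply (rule fundamental_theorem_of_calculus, simp)
      unfolding has_real_derivative_iff_has_vector_derivative[symmetric]
      apply (rule derivative_eq_intros half_deriv_path[OF d1 vq] half_deriv_path[OF d2 vq] refl | simp add: s)+
      apply (simp add: Q'_def power2_eq_square algebra_simps)
      done
    moreover have "dir (2*pi) = dir 0" by (simp add: dir_def)
    ultimately show ?thesis by (simp add: integral_unique q_def)
  qed
  have cP: "continuous_on (cbox (0, 0) (pi/2, 2*pi)) (\<lambda>(\<phi>, \<theta>). P' \<phi> \<theta>)"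
    unfolding P'_def q_def case_prod_unfold using s by (intro continuous_intros) auto
  have cQ: "continuous_on (cbox (0, 0) (pi/2, 2*pi)) (\<lambda>(\<phi>, \<theta>). Q' \<phi> \<theta>)"
    unfolding Q'_def q_def case_prod_unfold using s by (intro continuous_intros) auto
  have "integral (cbox (0, 0) (pi/2, 2*pi)) (\<lambda>(\<phi>, \<theta>). P' \<phi> \<theta>) = 0"
    using integral_prod_continuous[OF cP] integral_swap_continuous[OF cP] P by simp
  moreover have "integral (cbox (0, 0) (pi/2, 2*pi)) (\<lambda>(\<phi>, \<theta>). Q' \<phi> \<theta>) = 0"
    using integral_prod_continuous[OF cQ] Q by simp
  ultimately have "integral (cbox (0, 0) (pi/2, 2*pi)) (\<lambda>x. (case x of (\<phi>, \<theta>) \<Rightarrow> P' \<phi> \<theta>) + (case x of (\<phi>, \<theta>) \<Rightarrow> Q' \<phi> \<theta>)) = 0"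
    by (subst integral_add) (auto intro!: integrable_continuous cP cQ)
  also have "(\<lambda>x. (case x of (\<phi>, \<theta>) \<Rightarrow> P' \<phi> \<theta>) + (case x of (\<phi>, \<theta>) \<Rightarrow> Q' \<phi> \<theta>)) = (\<lambda>(\<phi>, \<theta>). sin \<phi> * (\<tau> * (u11 (q \<phi> \<theta>) s + u22 (q \<phi> \<theta>) s
      - (sin \<phi>)\<^sup>2 * ((cos \<theta>)\<^sup>2 * u11 (q \<phi> \<theta>) s + cos \<theta> * sin \<theta> * (u12 (q \<phi> \<theta>) s + u21 (q \<phi> \<theta>) s)
         + (sin \<theta>)\<^sup>2 * u22 (q \<phi> \<theta>) s))
      - 2 * sin \<phi> * (cos \<theta> * u1 (q \<phi> \<theta>) s + sin \<theta> * u2 (q \<phi> \<theta>) s)))"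
  proof (clarsimp simp: fun_eq_iff)
    fix \<phi> \<theta> :: real
    have *: "(cos \<phi>)\<^sup>2 = 1 - (sin \<phi>)\<^sup>2" "(cos \<theta>)\<^sup>2 = 1 - (sin \<theta>)\<^sup>2"
      by (simp_all add: cos_squared_eq)
    show "P' \<phi> \<theta> + Q' \<phi> \<theta> = sin \<phi> * (\<tau> * (u11 (q \<phi> \<theta>) s + u22 (q \<phi> \<theta>) s
      - (sin \<phi>)\<^sup>2 * ((cos \<theta>)\<^sup>2 * u11 (q \<phi> \<theta>) s + cos \<theta> * sin \<theta> * (u12 (q \<phi> \<theta>) s + u21 (q \<phi> \<theta>) s)
         + (sin \<theta>)\<^sup>2 * u22 (q \<phi> \<theta>) s))
      - 2 * sin \<phi> * (cos \<theta> * u1 (q \<phi> \<theta>) s + sin \<theta> * u2 (q \<phi> \<theta>) s))"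
      using * unfolding P'_def Q'_def by algebra
  qed
  finally show ?thesis .
qed

section \<open>Poisson formula for a classical solution\<close>

lemma integral_sin_hemisphere:
  "integral (cbox (0, 0) (pi / 2, 2 * pi)) (\<lambda>(\<phi>, \<theta>). sin \<phi> * c) = 2 * pi * (c :: real)"
proof -
  have "continuous_on (cbox (0, 0) (pi / 2, 2 * pi)) (\<lambda>(\<phi>, \<theta> :: real). sin \<phi> * c)"
    unfolding case_prod_unfold by (intro continuous_intros)
  from integral_prod_continuous[OF this]
  have "integral (cbox (0, 0) (pi / 2, 2 * pi)) (\<lambda>(\<phi>, \<theta> :: real). sin \<phi> * c)
      = integral {0..pi/2} (\<lambda>\<phi>. 2 * pi * (sin \<phi> * c))"
    by simp
  also have "((\<lambda>\<phi>. 2 * pi * (sin \<phi> * c)) has_integral (- (2 * pi * c * cos (pi/2)) - - (2 * pi * c * cos 0))) {0..pi/2}"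
    by (rule fundamental_theorem_of_calculus)
      (auto simp flip: has_real_derivative_iff_has_vector_derivative intro!: derivative_eq_intros)
  then have "integral {0..pi/2} (\<lambda>\<phi>. 2 * pi * (sin \<phi> * c)) = 2 * pi * c"
    by (simp add: integral_unique)
  finally show ?thesis .
qed

text \<open>The left-hand side is the unsimplified derivative that the differentiation rules produce
  in \<open>poisson_formula\<close>. With the values of the derivatives of u replaced by variables
  it is a polynomial identity.\<close>

lemma characteristic_derivative_identity:
  "0 * (U + t * (S * (c * U1 + k * U2) + U3 :: real)) + (- S * c * U1 + - S * k * U2 + 1 * U3 +
       ((0 - 1) * (S * (c * U1 + k * U2) + U3) + ((0 * (c * U1 + k * U2) +
        (0 * U1 + (- S * c * U11 + - S * k * U21 + 1 * U13) * c + (0 * U2 + (- S * c * U12 + - S * k * U22 + 1 * U23) * k)) * S)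
        + (- S * c * U13 + - S * k * U23 + 1 * U33)) * t)) * S
      = S * (t * (U33 - S\<^sup>2 * (c\<^sup>2 * U11 + c * k * (U12 + U21) + k\<^sup>2 * U22)) - 2 * S * (c * U1 + k * U2))"
  by algebra

lemma poisson_formula:
  assumes d: "half_deriv u u1 u2 u3" and d1: "half_deriv u1 u11 u21 u31"
    and d2: "half_deriv u2 u12 u22 u32" and d3: "half_deriv u3 u13 u23 u33"
    and c: "continuous_on (UNIV \<times> {0..}) (\<lambda>(x, t). u11 x t)"
     "continuous_on (UNIV \<times> {0..}) (\<lambda>(x, t). u12 x t)"
     "continuous_on (UNIV \<times> {0..}) (\<lambda>(x, t). u21 x t)"
     "continuous_on (UNIV \<times> {0..}) (\<lambda>(x, t). u22 x t)"
     "continuous_on (UNIV \<times> {0..}) (\<lambda>(x, t). u33 x t)"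
     "continuous_on (UNIV \<times> {0..}) (\<lambda>(x, t). u13 x t)"
     "continuous_on (UNIV \<times> {0..}) (\<lambda>(x, t). u23 x t)"
    and sym: "\<And>x t. t > 0 \<Longrightarrow> u31 x t = u13 x t" "\<And>x t. t > 0 \<Longrightarrow> u32 x t = u23 x t"
    and wave: "\<And>x t. t > 0 \<Longrightarrow> u33 x t = u11 x t + u22 x t"
    and init: "\<And>x. u3 x 0 = 0" and T: "T > 0"
  shows "u y T = poisson_sol (\<lambda>x. u x 0) (\<lambda>x. u1 x 0) (\<lambda>x. u2 x 0) y T"
proof -
  \<comment> \<open>Here \<open>s\<close> is the time, so the distance called \<tau> in the overview
    is T - s, and s runs up the light cone to its vertex (y, T).\<close>
  define q where "q = (\<lambda>s \<phi> \<theta>. y + ((T - s) * sin \<phi>) *\<^sub>R dir \<theta>)"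
  define F where "F = (\<lambda>s (\<phi>, \<theta>). sin \<phi> * (u (q s \<phi> \<theta>) s + (T - s) *
    (sin \<phi> * (cos \<theta> * u1 (q s \<phi> \<theta>) s + sin \<theta> * u2 (q s \<phi> \<theta>) s) + u3 (q s \<phi> \<theta>) s)))"
  define F' where "F' = (\<lambda>s (\<phi>, \<theta>). sin \<phi> * ((T - s) * (u33 (q s \<phi> \<theta>) s
      - (sin \<phi>)\<^sup>2 * ((cos \<theta>)\<^sup>2 * u11 (q s \<phi> \<theta>) s + cos \<theta> * sin \<theta> * (u12 (q s \<phi> \<theta>) s + u21 (q s \<phi> \<theta>) s)
         + (sin \<theta>)\<^sup>2 * u22 (q s \<phi> \<theta>) s))
      - 2 * sin \<phi> * (cos \<theta> * u1 (q s \<phi> \<theta>) s + sin \<theta> * u2 (q s \<phi> \<theta>) s)))"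
  let ?Q = "cbox (0, 0) (pi / 2, 2 * pi) :: (real \<times> real) set"
  note [continuous_intros] = continuous_on_half_compose[OF half_deriv_continuous[OF d]]
    continuous_on_half_compose[OF half_deriv_continuous[OF d1]]
    continuous_on_half_compose[OF half_deriv_continuous[OF d2]]
    continuous_on_half_compose[OF half_deriv_continuous[OF d3]]
    c[THEN continuous_on_half_compose]
  have contF: "continuous_on ({0..T} \<times> ?Q) (\<lambda>(s, p). F s p)"
    unfolding F_def q_def case_prod_unfold by (intro continuous_intros) auto
  then have contk: "continuous_on {0..T} (\<lambda>s. integral ?Q (F s))"
    by (rule integral_continuous_on_param)
  \<comment> \<open>\<open>wave\<close> and \<open>sym\<close> hold for positive times only. The
    derivative is therefore computed in the open interval, and \<open>contk\<close> brings in the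
    initial time.\<close>
  have k': "((\<lambda>s. integral ?Q (F s)) has_real_derivative 0) (at s)" if s: "0 < s" "s < T" for s
  proof -
    have "((\<lambda>s. integral ?Q (F s)) has_real_derivative integral ?Q (F' s)) (at s within {0<..<T})"
    proof (rule leibniz_rule_field_derivative)
      fix s p assume s: "s \<in> {0<..<T}" and "p \<in> ?Q"
      then have s0: "s > 0" by simp
      obtain \<phi> \<theta> where p: "p = (\<phi>, \<theta>)" by (cases p)
      have vq: "((\<lambda>s. q s \<phi> \<theta>) has_vector_derivative (- sin \<phi>) *\<^sub>R dir \<theta>) (at s within {0<..<T})"
        unfolding q_def by (auto intro!: derivative_eq_intros)
      have vs: "((\<lambda>s. s) has_real_derivative 1) (at s within {0<..<T})" by (auto intro!: derivative_eq_intros)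
      show "((\<lambda>s. F s p) has_real_derivative F' s p) (at s within {0<..<T})"
        unfolding F_def p prod.case
        apply (rule derivative_eq_intros half_deriv_path[OF d vq vs] half_deriv_path[OF d1 vq vs]
            half_deriv_path[OF d2 vq vs] half_deriv_path[OF d3 vq vs] refl | use s in force)+
        apply (simp only: F'_def prod.case sym[OF s0] vector_scaleR_component real_scaleR_def dir_nth)
        apply (rule characteristic_derivative_identity)
        done
    next
      fix s assume "s \<in> {0<..<T}"
      then show "F s integrable_on ?Q"
        unfolding F_def q_def case_prod_unfold by (intro integrable_continuous continuous_intros) auto
    next
      show "continuous_on ({0<..<T} \<times> ?Q) (\<lambda>(s, p). F' s p)"
        unfolding F'_def q_def case_prod_unfold by (intro continuous_intros) auto
    qed (use s in auto)
    moreover have "integral ?Q (F' s) = 0"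
      unfolding F'_def q_def wave[OF s(1)]
      by (rule hemisphere_divergence[OF d1 d2 c(1-4)]) (use s in simp)
    ultimately show ?thesis using s by (metis at_within_open greaterThanLessThan_iff open_greaterThanLessThan)
  qed
  have "integral ?Q (F T) = integral ?Q (F 0)"
    by (rule DERIV_isconst_end[OF T contk]) (rule k')
  moreover have "F T = (\<lambda>(\<phi>, \<theta>). sin \<phi> * u y T)"
    by (auto simp: F_def q_def fun_eq_iff)
  moreover have "integral ?Q (F 0) = 2 * pi * poisson_sol (\<lambda>x. u x 0) (\<lambda>x. u1 x 0) (\<lambda>x. u2 x 0) y T"
    unfolding F_def poisson_sol_def q_def prod.case init by simp
  ultimately show ?thesis using integral_sin_hemisphere[of "u y T"] by simp
qed

section \<open>Partial derivatives on the half-space obtained from \<open>Ck_on\<close>\<close>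

lemma Ck_on_SucD:
  assumes "Ck_on (Suc k) S g" "p \<in> S"
  shows "(g has_derivative (\<lambda>d. \<Sum>b\<in>Basis. (d \<bullet> b) * partial_within S b g p)) (at p within S)"
proof -
  from assms have "g differentiable (at p within S)" by (auto simp: differentiable_on_def)
  then have D: "(g has_derivative frechet_derivative g (at p within S)) (at p within S)"
    by (simp add: frechet_derivative_works)
  interpret l: bounded_linear "frechet_derivative g (at p within S)"
    using D by (rule has_derivative_bounded_linear)
  have "frechet_derivative g (at p within S) d = (\<Sum>b\<in>Basis. (d \<bullet> b) * partial_within S b g p)" for d
  proof -
    have "frechet_derivative g (at p within S) (\<Sum>b\<in>Basis. (d \<bullet> b) *\<^sub>R b)
        = (\<Sum>b\<in>Basis. (d \<bullet> b) * partial_within S b g p)"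
      by (simp only: l.sum l.scaleR) (simp add: partial_within_def)
    then show ?thesis by (simp add: euclidean_representation)
  qed
  then have "frechet_derivative g (at p within S) = (\<lambda>d. \<Sum>b\<in>Basis. (d \<bullet> b) * partial_within S b g p)"
    by (rule ext)
  with D show ?thesis by simp
qed

lemma sum_Basis_vec2_real:
  "(\<Sum>b\<in>Basis. h b) = h (axis 1 1, 0) + h (axis 2 1, 0) + h ((0 :: real^2), 1 :: real)"
proof -
  have B: "(Basis :: ((real^2) \<times> real) set) = {(axis 1 1, 0), (axis 2 1, 0), (0, 1)}"
    by (auto simp: Basis_prod_def Basis_vec_def UNIV_2)
  show ?thesis unfolding B by (simp add: axis_eq_axis add.assoc)
qed

lemma Ck_on_half_deriv:
  assumes "Ck_on (Suc k) (UNIV \<times> {0..}) (\<lambda>(x, t). v x t)"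
  defines "D \<equiv> \<lambda>b x t. partial_within (UNIV \<times> {0..}) b (\<lambda>(x, t). v x t) (x, t)"
  shows "half_deriv v (D (axis 1 1, 0)) (D (axis 2 1, 0)) (D (0, 1))"
  unfolding half_deriv_def D_def
proof (intro allI impI)
  fix x :: "real^2" and t :: real assume "0 \<le> t"
  then have "(x, t) \<in> UNIV \<times> {0..}" by simp
  from Ck_on_SucD[OF assms(1) this]
  show "((\<lambda>(x, y). v x y) has_derivative
            (\<lambda>(d, \<tau>). d $ 1 * partial_within (UNIV \<times> {0..}) (axis 1 1, 0) (\<lambda>(x, y). v x y) (x, t) +
                d $ 2 * partial_within (UNIV \<times> {0..}) (axis 2 1, 0) (\<lambda>(x, y). v x y) (x, t) +
                \<tau> * partial_within (UNIV \<times> {0..}) (0, 1) (\<lambda>(x, y). v x y) (x, t)))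
            (at (x, t) within UNIV \<times> {0..})"
    by (rule has_derivative_eq_rhs) (auto simp: sum_Basis_vec2_real inner_axis fun_eq_iff)
qed

section \<open>Consequences for the gradient\<close>

definition grad2 :: "(real^2 \<Rightarrow> real) \<Rightarrow> (real^2 \<Rightarrow> real) \<Rightarrow> (real^2 \<Rightarrow> real) \<Rightarrow> bool" where
  "grad2 g g1 g2 \<longleftrightarrow> (\<forall>x. (g has_derivative (\<lambda>d. d $ 1 * g1 x + d $ 2 * g2 x)) (at x))"

lemma grad2_path:
  assumes g: "grad2 g g1 g2" and x: "(x has_vector_derivative x') (at s within I)"
  shows "((\<lambda>s. g (x s)) has_real_derivative x' $ 1 * g1 (x s) + x' $ 2 * g2 (x s)) (at s within I)"
proof -
  have "(g has_derivative (\<lambda>d. d $ 1 * g1 (x s) + d $ 2 * g2 (x s))) (at (x s))"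
    using g by (simp add: grad2_def)
  from has_derivative_compose[OF x[unfolded has_vector_derivative_def] this]
  show ?thesis unfolding has_field_derivative_def
    by (rule has_derivative_eq_rhs) (auto simp: fun_eq_iff algebra_simps)
qed

lemma grad2_continuous: "grad2 g g1 g2 \<Longrightarrow> continuous_on UNIV g"
  by (auto simp: grad2_def continuous_on_eq_continuous_at intro: has_derivative_continuous)

lemma grad2_partial:
  assumes "grad2 g g1 g2"
  shows "partial (axis 1 1) g = g1" "partial (axis 2 1) g = g2"
proof -
  have "frechet_derivative g (at x) = (\<lambda>d. d $ 1 * g1 x + d $ 2 * g2 x)" for x
    by (rule frechet_derivative_at[symmetric]) (use assms in \<open>simp add: grad2_def\<close>)
  then show "partial (axis 1 1) g = g1" "partial (axis 2 1) g = g2"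
    by (auto simp: partial_within_def fun_eq_iff axis_def)
qed

lemma sum_Basis_vec2: "(\<Sum>b\<in>Basis. h b) = h (axis 1 1) + h (axis 2 (1::real) :: real^2)"
proof -
  have B: "(Basis :: (real^2) set) = {axis 1 1, axis 2 1}"
    by (auto simp: Basis_vec_def UNIV_2)
  show ?thesis unfolding B by (simp add: axis_eq_axis)
qed

lemma half_deriv_grad2:
  assumes "half_deriv v v1 v2 v3" "t \<ge> 0"
  shows "grad2 (\<lambda>x. v x t) (\<lambda>x. v1 x t) (\<lambda>x. v2 x t)"
  unfolding grad2_def
proof
  fix x :: "real^2"
  have 1: "((\<lambda>x. (x, t)) has_derivative (\<lambda>d. (d, 0))) (at x)"
    by (auto intro!: derivative_eq_intros)
  have 2: "((\<lambda>(x, t). v x t) has_derivative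
     (\<lambda>(d, \<tau>). d $ 1 * v1 x t + d $ 2 * v2 x t + \<tau> * v3 x t)) (at (x, t) within range (\<lambda>x. (x, t)))"
    by (rule has_derivative_subset[of _ _ _ "UNIV \<times> {0..}"]) (use assms in \<open>auto simp: half_deriv_def\<close>)
  show "((\<lambda>x. v x t) has_derivative (\<lambda>d. d $ 1 * v1 x t + d $ 2 * v2 x t)) (at x)"
    using has_derivative_in_compose[OF 1 2] by simp
qed

lemma grad2_zero_outside:
  assumes g: "grad2 g g1 g2" and W: "open W" "\<And>x. x \<in> W \<Longrightarrow> g x = 0" and x: "x \<in> W"
  shows "g1 x = 0" "g2 x = 0"
proof -
  have "((\<lambda>_. 0) has_derivative (\<lambda>_. 0)) (at x)" by simp
  then have "(g has_derivative (\<lambda>_. 0)) (at x)"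
    by (rule has_derivative_transform_within_open[OF _ W(1) x]) (simp add: W)
  moreover have "(g has_derivative (\<lambda>d. d $ 1 * g1 x + d $ 2 * g2 x)) (at x)"
    using g by (simp add: grad2_def)
  ultimately have "(\<lambda>_. 0) = (\<lambda>d :: real^2. d $ 1 * g1 x + d $ 2 * g2 x)"
    by (rule has_derivative_unique)
  then have "0 = d $ 1 * g1 x + d $ 2 * g2 x" for d :: "real^2" by (rule fun_cong)
  from this[of "axis 1 1"] this[of "axis 2 1"] show "g1 x = 0" "g2 x = 0"
    by (auto simp: axis_def)
qed

text \<open>Time is a mere parameter here, so the symmetry holds at t = 0 too. It is needed there
  for the second derivatives of the initial position.\<close>

lemma half_deriv_space_commute:
  assumes d: "half_deriv u u1 u2 u3" and d1: "half_deriv u1 u11 u21 u31" and d2: "half_deriv u2 u12 u22 u32"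
    and c: "continuous_on (UNIV \<times> {0..}) (\<lambda>(x, t). u21 x t)" "continuous_on (UNIV \<times> {0..}) (\<lambda>(x, t). u12 x t)"
    and t: "t \<ge> 0"
  shows "u21 x t = u12 x t"
proof -
  define X where "X = (\<lambda>a b. x + a *\<^sub>R axis 1 1 + b *\<^sub>R (axis 2 1 :: real^2))"
  have Xa: "((\<lambda>a. X a b) has_vector_derivative axis 1 1) (at a)" for a b
    unfolding X_def by (auto intro!: derivative_eq_intros)
  have Xb: "((\<lambda>b. X a b) has_vector_derivative axis 2 1) (at b)" for a b
    unfolding X_def by (auto intro!: derivative_eq_intros)
  note g = half_deriv_grad2[OF d t] half_deriv_grad2[OF d1 t] half_deriv_grad2[OF d2 t]
  have ax: "axis 1 (1::real) $ (1::2) = 1" "axis 1 (1::real) $ (2::2) = 0"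
    "axis 2 (1::real) $ (1::2) = 0" "axis 2 (1::real) $ (2::2) = 1"
    by (auto simp: axis_def)
  have "u21 (X 0 0) t = u12 (X 0 0) t"
  proof (rule clairaut[where d = 1 and a = 0 and b = 0 and f = "\<lambda>a b. u (X a b) t"
        and fx = "\<lambda>a b. u1 (X a b) t" and fy = "\<lambda>a b. u2 (X a b) t"
        and fxy = "\<lambda>a b. u21 (X a b) t" and fyx = "\<lambda>a b. u12 (X a b) t"])
    show "((\<lambda>a. u (X a b) t) has_real_derivative u1 (X a b) t) (at a)" for a b
      using grad2_path[OF g(1) Xa] by (simp add: ax)
    show "((\<lambda>b. u (X a b) t) has_real_derivative u2 (X a b) t) (at b)" for a b
      using grad2_path[OF g(1) Xb] by (simp add: ax)
    show "((\<lambda>b. u1 (X a b) t) has_real_derivative u21 (X a b) t) (at b)" for a b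
      using grad2_path[OF g(2) Xb] by (simp add: ax)
    show "((\<lambda>a. u2 (X a b) t) has_real_derivative u12 (X a b) t) (at a)" for a b
      using grad2_path[OF g(3) Xa] by (simp add: ax)
    have "continuous_on UNIV (\<lambda>p. u21 (X (fst p) (snd p)) t)"
      unfolding X_def using t by (intro continuous_on_half_compose[OF c(1)] continuous_intros) auto
    then show "isCont (\<lambda>(a, b). u21 (X a b) t) (0, 0)"
      by (simp add: case_prod_unfold continuous_on_eq_continuous_at)
    have "continuous_on UNIV (\<lambda>p. u12 (X (fst p) (snd p)) t)"
      unfolding X_def using t by (intro continuous_on_half_compose[OF c(2)] continuous_intros) auto
    then show "isCont (\<lambda>(a, b). u12 (X a b) t) (0, 0)"
      by (simp add: case_prod_unfold continuous_on_eq_continuous_at)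
  qed simp
  then show ?thesis by (simp add: X_def)
qed

text \<open>The vector \<open>e\<close> is an axis in the applications, where \<open>dd\<close>
  reduces to one partial derivative, so that both space directions are treated at once. Time is
  positive because \<open>clairaut\<close> needs a two-sided neighbourhood in time.\<close>

lemma half_deriv_time_commute:
  fixes e :: "real^2"
  defines "dd \<equiv> \<lambda>v1 v2 x (t :: real). e $ 1 * v1 x t + e $ 2 * (v2 x t :: real)"
  assumes d: "half_deriv u u1 u2 u3" and de: "half_deriv (dd u1 u2) w1 w2 w3" and d3: "half_deriv u3 u13 u23 u33"
    and c: "continuous_on (UNIV \<times> {0..}) (\<lambda>(x, t). w3 x t)" "continuous_on (UNIV \<times> {0..}) (\<lambda>(x, t). u13 x t)"
      "continuous_on (UNIV \<times> {0..}) (\<lambda>(x, t). u23 x t)"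
    and t: "t > 0"
  shows "w3 x t = dd u13 u23 x t"
proof -
  have Xa: "((\<lambda>a. x + a *\<^sub>R e) has_vector_derivative e) (at a)" for a
    by (auto intro!: derivative_eq_intros)
  have path: "((\<lambda>b. v y (t + b)) has_real_derivative v3 y (t + b)) (at b)" if b: "\<bar>b - 0\<bar> < t" and v: "half_deriv v v1 v2 v3"
    for v v1 v2 v3 y b
  proof -
    have "((\<lambda>b. v y (t + b)) has_real_derivative (0 :: real^2) $ 1 * v1 y (t + b) + (0 :: real^2) $ 2 * v2 y (t + b) + 1 * v3 y (t + b)) (at b within {-t<..})"
    proof (rule half_deriv_path[OF v])
      show "((+) t has_real_derivative 1) (at b within {-t<..})"
        by (auto intro!: derivative_eq_intros)
    qed (use b in auto)
    moreover have "at b within {-t<..} = at b" using b by (intro at_within_open) auto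
    ultimately show ?thesis by simp
  qed
  have "w3 (x + 0 *\<^sub>R e) (t + 0) = dd u13 u23 (x + 0 *\<^sub>R e) (t + 0)"
  proof (rule clairaut[where d = t and a = 0 and b = 0 and f = "\<lambda>a b. u (x + a *\<^sub>R e) (t + b)"
        and fx = "\<lambda>a b. dd u1 u2 (x + a *\<^sub>R e) (t + b)" and fy = "\<lambda>a b. u3 (x + a *\<^sub>R e) (t + b)"
        and fxy = "\<lambda>a b. w3 (x + a *\<^sub>R e) (t + b)" and fyx = "\<lambda>a b. dd u13 u23 (x + a *\<^sub>R e) (t + b)"])
    show "((\<lambda>a. u (x + a *\<^sub>R e) (t + b)) has_real_derivative dd u1 u2 (x + a *\<^sub>R e) (t + b)) (at a)"
      if "\<bar>b - 0\<bar> < t" for a b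
      using grad2_path[OF half_deriv_grad2[OF d, of "t + b"] Xa, of a] that by (simp add: dd_def)
    show "((\<lambda>b. u (x + a *\<^sub>R e) (t + b)) has_real_derivative u3 (x + a *\<^sub>R e) (t + b)) (at b)"
      if "\<bar>b - 0\<bar> < t" for a b
      using path[OF that d] .
    show "((\<lambda>b. dd u1 u2 (x + a *\<^sub>R e) (t + b)) has_real_derivative w3 (x + a *\<^sub>R e) (t + b)) (at b)"
      if "\<bar>b - 0\<bar> < t" for a b
      using path[OF that de] .
    show "((\<lambda>a. u3 (x + a *\<^sub>R e) (t + b)) has_real_derivative dd u13 u23 (x + a *\<^sub>R e) (t + b)) (at a)"
      if "\<bar>b - 0\<bar> < t" for a b
      using grad2_path[OF half_deriv_grad2[OF d3, of "t + b"] Xa, of a] that by (simp add: dd_def)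
    have o: "open (UNIV \<times> {-t<..} :: (real \<times> real) set)" by (simp add: open_Times)
    have "continuous_on (UNIV \<times> {-t<..}) (\<lambda>p. w3 (x + fst p *\<^sub>R e) (t + snd p))"
      using t by (intro continuous_on_half_compose[OF c(1)] continuous_intros) auto
    then show "isCont (\<lambda>(a, b). w3 (x + a *\<^sub>R e) (t + b)) (0, 0)"
      using t o by (simp add: case_prod_unfold continuous_on_eq_continuous_at)
    have "continuous_on (UNIV \<times> {-t<..}) (\<lambda>p. dd u13 u23 (x + fst p *\<^sub>R e) (t + snd p))"
      unfolding dd_def
      using t by (intro continuous_on_half_compose[OF c(2)] continuous_on_half_compose[OF c(3)] continuous_intros) auto
    then show "isCont (\<lambda>(a, b). dd u13 u23 (x + a *\<^sub>R e) (t + b)) (0, 0)"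
      using t o by (simp add: case_prod_unfold continuous_on_eq_continuous_at)
  qed (use t in auto)
  then show ?thesis by simp
qed

text \<open>Poisson's formula commutes with translations in \<open>y\<close>, hence with
  differentiation in \<open>y\<close>. Thus the formula for u passes to the gradient with no third
  derivatives of u. The two gradient functions on the right are the derivatives of \<open>g1\<close>
  and \<open>g2\<close> in direction \<open>e\<close>, that is, with the order of differentiation as
  it comes out under the integral.\<close>

lemma poisson_sol_directional:
  assumes g: "grad2 g g1 g2" and g1: "grad2 g1 g11 g21" and g2: "grad2 g2 g12 g22"
    and c: "continuous_on UNIV g11" "continuous_on UNIV g12" "continuous_on UNIV g21" "continuous_on UNIV g22"
  shows "((\<lambda>a. poisson_sol g g1 g2 (y + a *\<^sub>R e) t) has_real_derivative
     poisson_sol (\<lambda>x. e $ 1 * g1 x + e $ 2 * g2 x) (\<lambda>x. e $ 1 * g11 x + e $ 2 * g21 x) (\<lambda>x. e $ 1 * g12 x + e $ 2 * g22 x) y t) (at 0)"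
proof -
  let ?Q = "cbox (0, 0) (pi / 2, 2 * pi) :: (real \<times> real) set"
  define q where "q = (\<lambda>a \<phi> \<theta>. y + a *\<^sub>R e + (t * sin \<phi>) *\<^sub>R dir \<theta>)"
  define F where "F = (\<lambda>a (\<phi>, \<theta>). sin \<phi> * (g (q a \<phi> \<theta>) + t * (sin \<phi> *
       (cos \<theta> * g1 (q a \<phi> \<theta>) + sin \<theta> * g2 (q a \<phi> \<theta>)))))"
  define F' where "F' = (\<lambda>a (\<phi>, \<theta>). sin \<phi> * ((e $ 1 * g1 (q a \<phi> \<theta>) + e $ 2 * g2 (q a \<phi> \<theta>)) + t * (sin \<phi> *
       (cos \<theta> * (e $ 1 * g11 (q a \<phi> \<theta>) + e $ 2 * g21 (q a \<phi> \<theta>))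
        + sin \<theta> * (e $ 1 * g12 (q a \<phi> \<theta>) + e $ 2 * g22 (q a \<phi> \<theta>))))))"
  note [continuous_intros] = continuous_on_compose2[OF grad2_continuous[OF g]]
    continuous_on_compose2[OF grad2_continuous[OF g1]] continuous_on_compose2[OF grad2_continuous[OF g2]]
    c[THEN continuous_on_compose2]
  have "((\<lambda>a. integral ?Q (F a)) has_real_derivative integral ?Q (F' 0)) (at 0 within UNIV)"
  proof (rule leibniz_rule_field_derivative)
    fix a p assume "p \<in> ?Q"
    obtain \<phi> \<theta> where p: "p = (\<phi>, \<theta>)" by (cases p)
    have vq: "((\<lambda>a. q a \<phi> \<theta>) has_vector_derivative e) (at a within UNIV)"
      unfolding q_def by (auto intro!: derivative_eq_intros)
    show "((\<lambda>a. F a p) has_real_derivative F' a p) (at a within UNIV)"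
      unfolding F_def p prod.case F'_def
      by (auto intro!: derivative_eq_intros grad2_path[OF g vq] grad2_path[OF g1 vq] grad2_path[OF g2 vq])
  next
    show "F a integrable_on ?Q" for a
      unfolding F_def q_def case_prod_unfold by (intro integrable_continuous continuous_intros) auto
    show "continuous_on (UNIV \<times> ?Q) (\<lambda>(a, p). F' a p)"
      unfolding F'_def q_def case_prod_unfold by (intro continuous_intros) auto
  qed auto
  then have "((\<lambda>a. 1 / (2 * pi) * integral ?Q (F a)) has_real_derivative 1 / (2 * pi) * integral ?Q (F' 0)) (at 0)"
    by (rule DERIV_cmult)
  then show ?thesis by (simp add: poisson_sol_def F_def F'_def q_def)
qed

lemma Ck_on_2_half_derivs:
  assumes "Ck_on 2 (UNIV \<times> {0..}) (\<lambda>(x, t). u x t)"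
  obtains u1 u2 u3 u11 u12 u13 u21 u22 u23 u31 u32 u33 where
    "half_deriv u u1 u2 u3" "half_deriv u1 u11 u21 u31" "half_deriv u2 u12 u22 u32" "half_deriv u3 u13 u23 u33"
    "\<And>w. w \<in> {u11, u12, u13, u21, u22, u23, u31, u32, u33} \<Longrightarrow> continuous_on (UNIV \<times> {0..}) (\<lambda>(x, t). w x t)"
proof -
  let ?S = "UNIV \<times> {0..} :: ((real^2) \<times> real) set"
  define v where "v = (\<lambda>(x, t). u x t)"
  define D where "D = (\<lambda>b x t. partial_within ?S b v (x, t))"
  define DD where "DD = (\<lambda>c b x t. partial_within ?S c (partial_within ?S b v) (x, t))"
  have C: "Ck_on (Suc (Suc 0)) ?S v" using assms by (simp add: v_def numeral_2_eq_2)
  have B: "(axis 1 1, 0) \<in> (Basis :: ((real^2) \<times> real) set)" "(axis 2 1, 0) \<in> (Basis :: ((real^2) \<times> real) set)"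
    "(0, 1) \<in> (Basis :: ((real^2) \<times> real) set)"
    by (auto simp: Basis_prod_def Basis_vec_def)
  have D: "(\<lambda>(x, t). D b x t) = partial_within ?S b v" for b
    by (simp add: D_def)
  have CD: "Ck_on (Suc 0) ?S (\<lambda>(x, t). D b x t)" if "b \<in> Basis" for b
    unfolding D using C that by simp
  have 0: "half_deriv u (D (axis 1 1, 0)) (D (axis 2 1, 0)) (D (0, 1))"
    using Ck_on_half_deriv[of _ u] C unfolding v_def D_def by blast
  have 1: "half_deriv (D b) (DD (axis 1 1, 0) b) (DD (axis 2 1, 0) b) (DD (0, 1) b)" if "b \<in> Basis" for b
    using Ck_on_half_deriv[OF CD[OF that]] unfolding D DD_def .
  have c: "continuous_on ?S (\<lambda>(x, t). DD c b x t)" if "b \<in> Basis" "c \<in> Basis" for b c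
    using CD[OF that(1)] that(2) unfolding D by (simp add: DD_def)
  show thesis
    by (rule that[OF 0 1[OF B(1)] 1[OF B(2)] 1[OF B(3)]]) (use c B in auto)
qed

lemma half_deriv_time:
  assumes "half_deriv v v1 v2 v3" "t \<ge> 0"
  shows "(v x has_real_derivative v3 x t) (at t within {0..})"
  using half_deriv_path[OF assms(1), of "\<lambda>_. x" 0 t "{0..}" "\<lambda>t. t" 1] assms(2)
  by (simp add: has_vector_derivative_const)

lemma half_deriv_time_interior:
  assumes "half_deriv v v1 v2 v3" "t > 0"
  shows "(v x has_real_derivative v3 x t) (at t)" "deriv (v x) t = v3 x t"
proof -
  have "at t within {0..} = at t" by (rule at_within_interior) (use assms in auto)
  then show "(v x has_real_derivative v3 x t) (at t)"
    using half_deriv_time[OF assms(1), of t x] assms(2) by simp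
  then show "deriv (v x) t = v3 x t" by (rule DERIV_imp_deriv)
qed

text \<open>This is all that the proof of the inversion formula uses about u. The derivatives of
  \<open>f\<close> are read off from those of u at time 0, which are continuous because u is of
  class C^2 up to the initial time.\<close>

lemma wave_solution_poisson:
  fixes z :: "real^2"
  assumes w: "wave_solution f u" and f: "closure {x. f x \<noteq> 0} \<subseteq> ball z \<rho>"
  obtains f1 f2 f11 f12 f22 where
    "grad2 f f1 f2" "grad2 f1 f11 f12" "grad2 f2 f12 f22"
    "continuous_on UNIV f11" "continuous_on UNIV f12" "continuous_on UNIV f22"
    "\<And>g x. g \<in> {f, f1, f2, f11, f12, f22} \<Longrightarrow> x \<notin> ball z \<rho> \<Longrightarrow> g x = 0"
    "\<And>y t. t > 0 \<Longrightarrow> u y t = poisson_sol f f1 f2 y t"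
    "\<And>y t. t > 0 \<Longrightarrow> grad (\<lambda>x. u x t) y $ 1 = poisson_sol f1 f11 f12 y t"
    "\<And>y t. t > 0 \<Longrightarrow> grad (\<lambda>x. u x t) y $ 2 = poisson_sol f2 f12 f22 y t"
proof -
  obtain u1 u2 u3 u11 u12 u13 u21 u22 u23 u31 u32 u33 where
    d: "half_deriv u u1 u2 u3" and d1: "half_deriv u1 u11 u21 u31" and d2: "half_deriv u2 u12 u22 u32"
    and d3: "half_deriv u3 u13 u23 u33"
    and c: "\<And>w. w \<in> {u11, u12, u13, u21, u22, u23, u31, u32, u33} \<Longrightarrow> continuous_on (UNIV \<times> {0..}) (\<lambda>(x, t). w x t)"
    using w Ck_on_2_half_derivs unfolding wave_solution_def by metis
  have f_eq: "f = (\<lambda>x. u x 0)" using w by (auto simp: wave_solution_def)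
  have comm: "u21 x t = u12 x t" if "t \<ge> 0" for x t
    by (rule half_deriv_space_commute[OF d d1 d2 c c that]) auto
  have sym1: "u31 x t = u13 x t" if "t > 0" for x t
    using half_deriv_time_commute[OF d _ d3 c c c that, of "axis 1 1" u11 u21 u31] d1
    by (simp add: axis_def)
  have sym2: "u32 x t = u23 x t" if "t > 0" for x t
    using half_deriv_time_commute[OF d _ d3 c c c that, of "axis 2 1" u12 u22 u32] d2
    by (simp add: axis_def)
  have lap: "laplacian (\<lambda>y. u y t) x = u11 x t + u22 x t" if "t > 0" for x t
    using grad2_partial[OF half_deriv_grad2[OF d, of t]] grad2_partial[OF half_deriv_grad2[OF d1, of t]]
      grad2_partial[OF half_deriv_grad2[OF d2, of t]] that
    by (simp add: laplacian_def sum_Basis_vec2)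
  have tt: "deriv (deriv (u x)) t = u33 x t" if "t > 0" for x t
  proof -
    have "eventually (\<lambda>s. s \<in> {0<..}) (nhds t)" using that by (intro eventually_nhds_in_open) auto
    then have "eventually (\<lambda>s. deriv (u x) s = u3 x s) (nhds t)"
      by eventually_elim (simp add: half_deriv_time_interior[OF d])
    then have "deriv (deriv (u x)) t = deriv (u3 x) t" by (rule deriv_cong_ev) simp
    then show ?thesis using half_deriv_time_interior[OF d3 that] by simp
  qed
  have wave: "u33 x t = u11 x t + u22 x t" if "t > 0" for x t
    using w that lap[OF that] tt[OF that] by (simp add: wave_solution_def)
  have init: "u3 x 0 = 0" for x
  proof -
    have "(u x has_real_derivative 0) (at 0 within {0..})" using w by (simp add: wave_solution_def)
    moreover have "(u x has_real_derivative u3 x 0) (at 0 within {0..})"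
      using half_deriv_time[OF d] by simp
    moreover have "at (0::real) within {0..} \<noteq> bot" by (simp add: at_within_Ici_at_right)
    ultimately show ?thesis by (blast intro: has_field_derivative_unique)
  qed
  define f1 f2 f11 f12 f22 where defs: "f1 = (\<lambda>x. u1 x 0)" "f2 = (\<lambda>x. u2 x 0)" "f11 = (\<lambda>x. u11 x 0)"
    "f12 = (\<lambda>x. u12 x 0)" "f22 = (\<lambda>x. u22 x 0)"
  have g: "grad2 f f1 f2" unfolding f_eq defs by (rule half_deriv_grad2[OF d]) simp
  have g1: "grad2 f1 f11 f12" using half_deriv_grad2[OF d1, of 0] comm unfolding defs by simp
  have g2: "grad2 f2 f12 f22" unfolding defs by (rule half_deriv_grad2[OF d2]) simp
  have cc: "continuous_on UNIV (\<lambda>x. w x 0)" if "continuous_on (UNIV \<times> {0..}) (\<lambda>(x, t). w x t)"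
    for w :: "real^2 \<Rightarrow> real \<Rightarrow> real"
    by (rule continuous_on_half_compose[OF that]) (auto intro: continuous_intros)
  have c0: "continuous_on UNIV f11" "continuous_on UNIV f12" "continuous_on UNIV f22"
    unfolding defs by (auto intro!: cc c)
  \<comment> \<open>An open set containing the complement of the open ball, in particular the circle
    itself, so that the derivatives of \<open>f\<close> vanish there as well.\<close>
  define W where "W = - closure {x. f x \<noteq> 0}"
  have W: "open W" "\<And>x. x \<in> W \<Longrightarrow> f x = 0" "\<And>x. x \<notin> ball z \<rho> \<Longrightarrow> x \<in> W"
    using f closure_subset[of "{x. f x \<noteq> 0}"] by (auto simp: W_def)
  have z0: "f1 x = 0" "f2 x = 0" if "x \<in> W" for x
    using grad2_zero_outside[OF g W(1,2)] that by auto
  have z1: "f11 x = 0" "f12 x = 0" "f22 x = 0" if "x \<in> W" for x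
    using grad2_zero_outside[OF g1 W(1)] grad2_zero_outside[OF g2 W(1)] z0 that by auto
  have zero: "h x = 0" if "h \<in> {f, f1, f2, f11, f12, f22}" "x \<notin> ball z \<rho>" for h x
    using that(1) W(2)[OF W(3)[OF that(2)]] z0[OF W(3)[OF that(2)]] z1[OF W(3)[OF that(2)]] by auto
  have U: "u y t = poisson_sol f f1 f2 y t" if "t > 0" for y t
    using poisson_formula[OF d d1 d2 d3 _ _ _ _ _ _ _ sym1 sym2 wave init that] c
    unfolding f_eq defs by blast
  have ax: "axis 1 (1::real) $ (1::2) = 1" "axis 1 (1::real) $ (2::2) = 0"
    "axis 2 (1::real) $ (1::2) = 0" "axis 2 (1::real) $ (2::2) = 1"
    by (auto simp: axis_def)
  have dirU: "((\<lambda>a. poisson_sol f f1 f2 (y + a *\<^sub>R e) t) has_real_derivative e $ 1 * u1 y t + e $ 2 * u2 y t) (at 0)"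
    if "t > 0" for y t e
  proof -
    have v: "((\<lambda>a. y + a *\<^sub>R e) has_vector_derivative e) (at 0)" by (auto intro!: derivative_eq_intros)
    from grad2_path[OF half_deriv_grad2[OF d, of t] v] that U[OF that] show ?thesis by simp
  qed
  note sd = poisson_sol_directional[OF g g1 g2 c0(1) c0(2) c0(2) c0(3)]
  have U1: "u1 y t = poisson_sol f1 f11 f12 y t" if "t > 0" for y t
    using DERIV_unique[OF dirU[OF that] sd, of "axis 1 1" y] by (simp add: ax)
  have U2: "u2 y t = poisson_sol f2 f12 f22 y t" if "t > 0" for y t
    using DERIV_unique[OF dirU[OF that] sd, of "axis 2 1" y] by (simp add: ax)
  have gr: "grad (\<lambda>x. u x t) y $ 1 = u1 y t" "grad (\<lambda>x. u x t) y $ 2 = u2 y t" if "t > 0" for y t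
    using grad2_partial[OF half_deriv_grad2[OF d, of t]] that by (simp_all add: grad_def sum_Basis_vec2 ax)
  show thesis
  proof (rule that[OF g g1 g2 c0])
    show "h x = 0" if "h \<in> {f, f1, f2, f11, f12, f22}" "x \<notin> ball z \<rho>" for h x
      using zero that .
    show "u y t = poisson_sol f f1 f2 y t" if "t > 0" for y t
      using U that .
  qed (simp_all add: gr U1 U2)
qed

section \<open>Polar coordinates\<close>

lemma borel_measurable_vector2 [measurable]:
  "(\<lambda>p. vector [fst p, snd p] :: real^2) \<in> borel_measurable borel"
proof -
  have "(\<lambda>p :: real \<times> real. vector [fst p, snd p] :: real^2) = (\<lambda>p. fst p *\<^sub>R axis 1 1 + snd p *\<^sub>R axis 2 1)"
    by (auto simp: fun_eq_iff vec_eq_iff forall_2 axis_def)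
  then show ?thesis by (auto intro!: borel_measurable_continuous_onI continuous_intros)
qed

lemma borel_measurable_vector [measurable (raw)]:
  assumes "h \<in> borel_measurable M" "k \<in> borel_measurable M"
  shows "(\<lambda>x. vector [h x, k x] :: real^2) \<in> borel_measurable M"
  using measurable_compose[OF borel_measurable_Pair[OF assms] borel_measurable_vector2] by simp

lemma lborel_vec2: "(lborel :: (real^2) measure) = distr lborel borel (\<lambda>p. vector [fst p, snd p])"
proof (rule lborel_eqI)
  fix l u :: "real^2" assume le: "\<And>b. b \<in> Basis \<Longrightarrow> l \<bullet> b \<le> u \<bullet> b"
  have B: "(Basis :: (real^2) set) = {axis 1 1, axis 2 1}"
    by (auto simp: Basis_vec_def UNIV_2)
  have lu: "l $ 1 \<le> u $ 1" "l $ 2 \<le> u $ 2"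
    using le[of "axis 1 1"] le[of "axis 2 1"] by (auto simp: B inner_axis)
  have "(\<lambda>p. vector [fst p, snd p] :: real^2) -` box l u = box (l $ 1, l $ 2) (u $ 1, u $ 2)"
    by (auto simp: box_def B inner_axis Basis_prod_def)
  then show "emeasure (distr lborel borel (\<lambda>p. vector [fst p, snd p])) (box l u) = (\<Prod>b\<in>Basis. (u - l) \<bullet> b)"
    using lu by (simp add: emeasure_distr emeasure_lborel_box_eq Basis_prod_def B inner_axis
        axis_eq_axis prod.union_disjoint inner_diff_left)
qed simp

lemma nn_integral_lborel_vec2:
  assumes [measurable]: "F \<in> borel_measurable borel"
  shows "(\<integral>\<^sup>+w. F w \<partial>(lborel :: (real^2) measure)) = (\<integral>\<^sup>+b. \<integral>\<^sup>+a. F (vector [a, b]) \<partial>lborel \<partial>lborel)"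
proof -
  have m: "(\<lambda>p :: real \<times> real. F (vector [fst p, snd p])) \<in> borel_measurable (lborel \<Otimes>\<^sub>M lborel)"
    unfolding lborel_prod by measurable
  have "(\<integral>\<^sup>+w. F w \<partial>(lborel :: (real^2) measure)) = (\<integral>\<^sup>+p. F (vector [fst p, snd p]) \<partial>(lborel \<Otimes>\<^sub>M lborel))"
    by (subst lborel_vec2) (simp add: nn_integral_distr lborel_prod)
  also have "\<dots> = (\<integral>\<^sup>+b. \<integral>\<^sup>+a. F (vector [a, b]) \<partial>lborel \<partial>lborel)"
    using lborel_pair.nn_integral_snd[OF m] by simp
  finally show ?thesis .
qed

text \<open>Used on each horizontal line of the upper half-plane, so that polar coordinates are
  reached by one-dimensional substitutions alone.\<close>

lemma lborel_tan:
  "lborel = distr (density lborel (\<lambda>\<tau>. indicator {-pi/2<..<pi/2} \<tau> * ennreal (1 / (cos \<tau>)\<^sup>2))) borel tan"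
  (is "_ = ?M")
proof (rule lborel_eqI)
  have [measurable]: "(tan :: real \<Rightarrow> real) \<in> borel_measurable borel"
    unfolding tan_def[abs_def] by measurable
  fix l u :: real assume "\<And>b. b \<in> Basis \<Longrightarrow> l \<bullet> b \<le> u \<bullet> b"
  then have lu: "l \<le> u" by simp
  have pos: "cos \<tau> > 0" if "arctan l \<le> \<tau>" "\<tau> \<le> arctan u" for \<tau>
    using that arctan_bounded[of l] arctan_bounded[of u] by (intro cos_gt_zero_pi) auto
  have S: "tan -` {l<..<u} \<in> sets borel"
    using measurable_sets_borel[of tan borel "{l<..<u}"] by simp
  have iff: "tan \<tau> \<in> box l u \<longleftrightarrow> \<tau> \<in> {arctan l<..<arctan u}" if "\<tau> \<in> {-pi/2<..<pi/2}" for \<tau>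
  proof -
    have "arctan (tan \<tau>) = \<tau>" using that by (intro arctan_tan) auto
    then show ?thesis using arctan_less_iff[of l "tan \<tau>"] arctan_less_iff[of "tan \<tau>" u] by auto
  qed
  have sub: "\<tau> \<in> {-pi/2<..<pi/2}" if "\<tau> \<in> {arctan l<..<arctan u}" for \<tau>
    using that arctan_bounded[of l] arctan_bounded[of u] by auto
  have "emeasure (?M) (box l u)
     = (\<integral>\<^sup>+\<tau>. indicator {-pi/2<..<pi/2} \<tau> * ennreal (1 / (cos \<tau>)\<^sup>2) * indicator (tan -` box l u) \<tau> \<partial>lborel)"
    using S by (simp add: emeasure_distr emeasure_density)
  also have "\<dots> = (\<integral>\<^sup>+\<tau>. ennreal (1 / (cos \<tau>)\<^sup>2) * indicator {arctan l..arctan u} \<tau> \<partial>lborel)"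
  proof (rule nn_integral_cong_AE)
    have "AE \<tau> in lborel. \<tau> \<noteq> arctan l" "AE \<tau> in lborel. \<tau> \<noteq> arctan u"
      by (rule AE_lborel_singleton)+
    then show "AE \<tau> in lborel. indicator {-pi/2<..<pi/2} \<tau> * ennreal (1 / (cos \<tau>)\<^sup>2) * indicator (tan -` box l u) \<tau>
       = ennreal (1 / (cos \<tau>)\<^sup>2) * indicator {arctan l..arctan u} \<tau>"
    proof eventually_elim
      case (elim \<tau>)
      then show ?case using iff[of \<tau>] sub[of \<tau>] by (auto simp: indicator_def)
    qed
  qed
  also have "\<dots> = ennreal (tan (arctan u) - tan (arctan l))"
  proof (rule nn_integral_FTC_Icc)
    show "DERIV tan \<tau> :> 1 / (cos \<tau>)\<^sup>2" if "\<tau> \<in> {arctan l..arctan u}" for \<tau>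
      using pos[of \<tau>] that by (auto intro!: derivative_eq_intros simp: divide_inverse)
    show "0 \<le> 1 / (cos \<tau>)\<^sup>2" for \<tau> :: real by simp
  qed (use lu in \<open>auto simp: arctan_le_iff\<close>)
  finally show "emeasure (?M) (box l u)
     = ennreal (\<Prod>b\<in>Basis. (u - l) \<bullet> b)"
    by (simp add: tan_arctan)
qed simp

text \<open>At height b substitute a = b tan \<tau>, exchange the integrals, and on each ray put b =
  r cos \<tau>. The factors b / (cos \<tau>)^2 and cos \<tau> multiply to r. As \<tau> is measured
  from the vertical axis, the polar angle is pi/2 - \<tau>.\<close>

lemma nn_integral_polar_upper:
  assumes F[measurable]: "F \<in> borel_measurable borel"
  shows "(\<integral>\<^sup>+b. \<integral>\<^sup>+a. F (vector [a, b] :: real^2) * indicator {0<..} b \<partial>lborel \<partial>lborel)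
    = (\<integral>\<^sup>+\<theta>. \<integral>\<^sup>+r. ennreal r * F (r *\<^sub>R dir \<theta>) * indicator {0<..<pi} \<theta> \<partial>lborel \<partial>lborel)"
proof -
  have [measurable]: "(tan :: real \<Rightarrow> real) \<in> borel_measurable borel"
    unfolding tan_def[abs_def] by measurable
  define J where "J = (\<lambda>\<tau>. indicator {-pi/2<..<pi/2} \<tau> * ennreal (1 / (cos \<tau>)\<^sup>2))"
  have [measurable]: "J \<in> borel_measurable borel" by (simp add: J_def)
  have "(\<integral>\<^sup>+b. \<integral>\<^sup>+a. F (vector [a, b]) * indicator {0<..} b \<partial>lborel \<partial>lborel)
    = (\<integral>\<^sup>+b. \<integral>\<^sup>+\<tau>. ennreal b * (J \<tau> * F (vector [b * tan \<tau>, b])) \<partial>lborel \<partial>lborel)"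
  proof (rule nn_integral_cong)
    fix b :: real
    show "(\<integral>\<^sup>+a. F (vector [a, b]) * indicator {0<..} b \<partial>lborel) = (\<integral>\<^sup>+\<tau>. ennreal b * (J \<tau> * F (vector [b * tan \<tau>, b])) \<partial>lborel)"
    proof (cases "b > 0")
      case True
      have "(\<integral>\<^sup>+a. F (vector [a, b]) * indicator {0<..} b \<partial>lborel) = ennreal b * (\<integral>\<^sup>+s. F (vector [b * s, b]) \<partial>lborel)"
        using True by (subst nn_integral_real_affine[where c = b and t = 0]) auto
      also have "(\<integral>\<^sup>+s. F (vector [b * s, b]) \<partial>lborel) = (\<integral>\<^sup>+\<tau>. J \<tau> * F (vector [b * tan \<tau>, b]) \<partial>lborel)"
        by (subst lborel_tan) (simp add: nn_integral_distr nn_integral_density J_def)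
      finally show ?thesis by (simp add: nn_integral_cmult)
    qed (simp add: ennreal_neg)
  qed
  also have "\<dots> = (\<integral>\<^sup>+\<tau>. \<integral>\<^sup>+b. ennreal b * (J \<tau> * F (vector [b * tan \<tau>, b])) \<partial>lborel \<partial>lborel)"
    by (rule lborel_pair.Fubini') (simp add: case_prod_unfold)
  also have "\<dots> = (\<integral>\<^sup>+\<tau>. \<integral>\<^sup>+r. ennreal r * F (r *\<^sub>R dir (pi/2 - \<tau>)) * indicator {0<..<pi} (pi/2 - \<tau>) \<partial>lborel \<partial>lborel)"
  proof (rule nn_integral_cong)
    fix \<tau> :: real
    show "(\<integral>\<^sup>+b. ennreal b * (J \<tau> * F (vector [b * tan \<tau>, b])) \<partial>lborel)
      = (\<integral>\<^sup>+r. ennreal r * F (r *\<^sub>R dir (pi/2 - \<tau>)) * indicator {0<..<pi} (pi/2 - \<tau>) \<partial>lborel)"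
    proof (cases "\<tau> \<in> {-pi/2<..<pi/2}")
      case True
      then have c: "cos \<tau> > 0" by (intro cos_gt_zero_pi) auto
      have "(\<integral>\<^sup>+b. ennreal b * (J \<tau> * F (vector [b * tan \<tau>, b])) \<partial>lborel)
        = ennreal (cos \<tau>) * (\<integral>\<^sup>+r. ennreal (cos \<tau> * r) * (J \<tau> * F (vector [cos \<tau> * r * tan \<tau>, cos \<tau> * r])) \<partial>lborel)"
        using c by (subst nn_integral_real_affine[where c = "cos \<tau>" and t = 0]) auto
      also have "\<dots> = (\<integral>\<^sup>+r. ennreal (cos \<tau>) * (ennreal (cos \<tau> * r) * (J \<tau> * F (vector [cos \<tau> * r * tan \<tau>, cos \<tau> * r]))) \<partial>lborel)"
        by (simp add: nn_integral_cmult)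
      also have "\<dots> = (\<integral>\<^sup>+r. ennreal r * F (r *\<^sub>R dir (pi/2 - \<tau>)) * indicator {0<..<pi} (pi/2 - \<tau>) \<partial>lborel)"
      proof (rule nn_integral_cong)
        fix r :: real
        have v: "vector [cos \<tau> * r * tan \<tau>, cos \<tau> * r] = r *\<^sub>R dir (pi/2 - \<tau>)"
          using c by (simp add: vec_eq_iff forall_2 cos_diff sin_diff tan_def)
        have "ennreal (cos \<tau>) * (ennreal (cos \<tau> * r) * (J \<tau> * G)) = ennreal r * G" for G
        proof (cases "r \<ge> 0")
          case r: True
          have "ennreal (cos \<tau>) * (ennreal (cos \<tau> * r) * ennreal (1 / (cos \<tau>)\<^sup>2)) = ennreal r"
            using c r by (simp add: ennreal_mult[symmetric] power2_eq_square)
          moreover have "J \<tau> = ennreal (1 / (cos \<tau>)\<^sup>2)" using True by (simp add: J_def)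
          ultimately show ?thesis by (metis mult.assoc)
        qed (use c in \<open>simp add: ennreal_neg mult_nonneg_nonpos\<close>)
        with v True show "ennreal (cos \<tau>) * (ennreal (cos \<tau> * r) * (J \<tau> * F (vector [cos \<tau> * r * tan \<tau>, cos \<tau> * r])))
          = ennreal r * F (r *\<^sub>R dir (pi/2 - \<tau>)) * indicator {0<..<pi} (pi/2 - \<tau>)"
          by (simp add: indicator_def)
      qed
      finally show ?thesis .
    next
      case False
      then have "J \<tau> = 0" "indicator {0<..<pi} (pi/2 - \<tau>) = (0 :: ennreal)"
        by (auto simp: J_def indicator_def)
      then show ?thesis by simp
    qed
  qed
  also have "\<dots> = (\<integral>\<^sup>+\<theta>. \<integral>\<^sup>+r. ennreal r * F (r *\<^sub>R dir \<theta>) * indicator {0<..<pi} \<theta> \<partial>lborel \<partial>lborel)"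
    by (subst (2) nn_integral_real_affine[where c = "-1" and t = "pi/2"]) auto
  finally show ?thesis .
qed

text \<open>Point reflection at the origin carries the lower half-plane to the upper one and adds pi
  to the angle. What is left over, the horizontal axis and the angles 0, pi and 2 pi, has measure
  zero.\<close>

theorem nn_integral_polar:
  assumes F[measurable]: "F \<in> borel_measurable borel"
  shows "(\<integral>\<^sup>+w. F w \<partial>(lborel :: (real^2) measure))
    = (\<integral>\<^sup>+\<theta>. \<integral>\<^sup>+r. ennreal r * F (r *\<^sub>R dir \<theta>) * indicator {0..2*pi} \<theta> \<partial>lborel \<partial>lborel)"
proof -
  let ?R = "\<lambda>A \<theta>. \<integral>\<^sup>+r. ennreal r * F (r *\<^sub>R dir \<theta>) * indicator A \<theta> \<partial>lborel"
  let ?P = "\<lambda>A. \<integral>\<^sup>+\<theta>. ?R A \<theta> \<partial>lborel"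
  have up: "(\<integral>\<^sup>+b. \<integral>\<^sup>+a. F (vector [a, b]) * indicator {0<..} b \<partial>lborel \<partial>lborel)
    = ?P {0<..<pi}"
    by (rule nn_integral_polar_upper[OF F])
  have "(\<integral>\<^sup>+b. \<integral>\<^sup>+a. F (vector [a, b]) * indicator {..<0} b \<partial>lborel \<partial>lborel)
    = (\<integral>\<^sup>+b. \<integral>\<^sup>+a. F (vector [- a, - b]) * indicator {..<0} (- b) \<partial>lborel \<partial>lborel)"
    apply (subst nn_integral_real_affine[where c = "-1" and t = 0], measurable)
    apply (subst nn_integral_real_affine[where c = "-1" and t = 0 and f = "\<lambda>a. F (vector [a, _]) * _"], measurable)
    done
  also have "\<dots> = (\<integral>\<^sup>+b. \<integral>\<^sup>+a. (\<lambda>w. F (- w)) (vector [a, b]) * indicator {0<..} b \<partial>lborel \<partial>lborel)"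
  proof -
    have "vector [- a, - b] = - (vector [a, b] :: real^2)" for a b by (simp add: vec_eq_iff forall_2)
    then show ?thesis by (simp add: indicator_def)
  qed
  also have "\<dots> = (\<integral>\<^sup>+\<theta>. \<integral>\<^sup>+r. ennreal r * F (- (r *\<^sub>R dir \<theta>)) * indicator {0<..<pi} \<theta> \<partial>lborel \<partial>lborel)"
    by (rule nn_integral_polar_upper) simp
  also have "\<dots> = (\<integral>\<^sup>+\<theta>. \<integral>\<^sup>+r. ennreal r * F (r *\<^sub>R dir (pi + \<theta>)) * indicator {pi<..<2*pi} (pi + \<theta>) \<partial>lborel \<partial>lborel)"
  proof -
    have "r *\<^sub>R dir (pi + \<theta>) = - (r *\<^sub>R dir \<theta>)" for r \<theta> by (simp add: vec_eq_iff forall_2)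
    then show ?thesis by (simp add: indicator_def)
  qed
  also have "\<dots> = ?P {pi<..<2*pi}"
    by (subst (2) nn_integral_real_affine[where c = "1" and t = "pi"]) auto
  finally have down: "(\<integral>\<^sup>+b. \<integral>\<^sup>+a. F (vector [a, b]) * indicator {..<0} b \<partial>lborel \<partial>lborel) = \<dots>" .
  have "(\<integral>\<^sup>+w. F w \<partial>(lborel :: (real^2) measure)) = (\<integral>\<^sup>+b. (\<integral>\<^sup>+a. F (vector [a, b]) \<partial>lborel) \<partial>lborel)"
    by (rule nn_integral_lborel_vec2[OF F])
  also have "\<dots> = (\<integral>\<^sup>+b. (\<integral>\<^sup>+a. F (vector [a, b]) * indicator {0<..} b \<partial>lborel) + (\<integral>\<^sup>+a. F (vector [a, b]) * indicator {..<0} b \<partial>lborel) \<partial>lborel)"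
  proof (rule nn_integral_cong_AE)
    have "AE b in lborel. b \<noteq> (0 :: real)" by (rule AE_lborel_singleton)
    then show "AE b in lborel. (\<integral>\<^sup>+a. F (vector [a, b]) \<partial>lborel)
      = (\<integral>\<^sup>+a. F (vector [a, b]) * indicator {0<..} b \<partial>lborel) + (\<integral>\<^sup>+a. F (vector [a, b]) * indicator {..<0} b \<partial>lborel)"
      by eventually_elim (auto simp: indicator_def)
  qed
  also have "\<dots> = ?P {0<..<pi}
    + ?P {pi<..<2*pi}"
    by (subst nn_integral_add) (simp_all add: up down)
  also have "\<dots> = (\<integral>\<^sup>+\<theta>. ?R {0<..<pi} \<theta>
    + ?R {pi<..<2*pi} \<theta> \<partial>lborel)"
    by (subst nn_integral_add) simp_all
  also have "\<dots> = ?P {0..2*pi}"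
  proof (rule nn_integral_cong_AE)
    have "AE b in lborel. b \<noteq> (0 :: real)" "AE b in lborel. b \<noteq> pi" "AE b in lborel. b \<noteq> 2*pi"
      by (rule AE_lborel_singleton)+
    then show "AE \<theta> in lborel. ?R {0<..<pi} \<theta>
      + ?R {pi<..<2*pi} \<theta>
      = ?R {0..2*pi} \<theta>"
      by eventually_elim (auto simp: indicator_def)
  qed
  finally show ?thesis .
qed

section \<open>The Abel kernel\<close>

text \<open>Restriction to an interval as a finite measure whose space is the whole line: product
  measures and Fubini then apply directly, without set integrals.\<close>

definition icc :: "real \<Rightarrow> real \<Rightarrow> real measure" where
  "icc a b = density lborel (indicator {a..b})"

lemma sets_icc [simp, measurable_cong]: "sets (icc a b) = sets borel"
  by (simp add: icc_def)

lemma space_icc [simp]: "space (icc a b) = UNIV"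
  by (simp add: icc_def)

lemma nn_integral_icc:
  "F \<in> borel_measurable borel \<Longrightarrow> (\<integral>\<^sup>+x. F x \<partial>icc a b) = (\<integral>\<^sup>+x. F x * indicator {a..b} x \<partial>lborel)"
  by (simp add: icc_def nn_integral_density mult.commute)

lemma finite_measure_icc: "finite_measure (icc a b)"
proof
  have "emeasure (icc a b) (space (icc a b)) = (\<integral>\<^sup>+x. indicator {a..b} x \<partial>lborel)"
    by (simp add: icc_def emeasure_density)
  also have "\<dots> < \<infinity>" by (auto simp: emeasure_lborel_Icc_eq)
  finally show "emeasure (icc a b) (space (icc a b)) \<noteq> \<infinity>" by simp
qed

interpretation icc: finite_measure "icc a b"
  by (rule finite_measure_icc)

lemma AE_icc: "(AE x in icc a b. P x) \<longleftrightarrow> (AE x in lborel. x \<in> {a..b} \<longrightarrow> P x)"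
proof -
  have "(0 < (indicator {a..b} x :: ennreal)) = (x \<in> {a..b})" for x by (simp add: indicator_def)
  then show ?thesis unfolding icc_def by (subst AE_density) auto
qed

lemma integral_icc:
  fixes F :: "real \<Rightarrow> real"
  assumes "F \<in> borel_measurable borel"
  shows "(\<integral>x. F x \<partial>icc a b) = (LINT x:{a..b}|lborel. F x)"
    and "integrable (icc a b) F \<longleftrightarrow> set_integrable lborel {a..b} F"
proof -
  have i: "icc a b = density lborel (\<lambda>x. ennreal (indicator {a..b} x))"
    by (simp add: icc_def ennreal_indicator)
  show "(\<integral>x. F x \<partial>icc a b) = (LINT x:{a..b}|lborel. F x)"
    unfolding i set_lebesgue_integral_def using assms by (subst integral_density) auto
  show "integrable (icc a b) F \<longleftrightarrow> set_integrable lborel {a..b} F"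
    unfolding i set_integrable_def using assms by (subst integrable_density) auto
qed

lemma integral_icc_eq_integral:
  fixes F :: "real \<Rightarrow> real"
  assumes "F \<in> borel_measurable borel" "set_integrable lborel {a..b} F"
  shows "(\<integral>x. F x \<partial>icc a b) = integral {a..b} F"
  using integral_icc(1)[OF assms(1)] set_borel_integral_eq_integral(2)[OF assms(2)] by simp

lemma integrable_icc_continuous:
  fixes F :: "real \<Rightarrow> real"
  assumes "continuous_on UNIV F"
  shows "integrable (icc a b) F"
  using assms by (subst integral_icc)
    (auto intro: borel_measurable_continuous_onI borel_integrable_atLeastAtMost' continuous_on_subset)

text \<open>The value 0 at nonpositive arguments extends the kernel by zero outside the disc |w - y|
  < t and below the threshold in v, so all integrals run over fixed domains.\<close>

definition abel_kernel :: "real \<Rightarrow> real" where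
  "abel_kernel c = (if c > 0 then 1 / sqrt c else 0)"

lemma abel_kernel_nonneg [simp]: "abel_kernel c \<ge> 0"
  by (simp add: abel_kernel_def)

lemma borel_measurable_abel_kernel [measurable]: "abel_kernel \<in> borel_measurable borel"
  unfolding abel_kernel_def[abs_def] by measurable

text \<open>The substitution r = t sin \<phi> turns r dr / sqrt (t^2 - r^2) into t sin \<phi>
  d\<phi>. The set \<open>A\<close> will be the section along a ray of an arbitrary Borel set of the
  plane.\<close>

lemma nn_integral_abel:
  assumes t: "t > 0" and A[measurable]: "A \<in> sets borel"
  shows "(\<integral>\<^sup>+r. ennreal r * (ennreal (abel_kernel (t\<^sup>2 - r\<^sup>2)) * indicator A r) \<partial>lborel)
       = (\<integral>\<^sup>+\<phi>. ennreal (t * sin \<phi>) * indicator A (t * sin \<phi>) \<partial>icc 0 (pi/2))"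
proof -
  define f where "f = (\<lambda>r. r * abel_kernel (t\<^sup>2 - r\<^sup>2) * indicator A r)"
  have [measurable]: "f \<in> borel_measurable borel" by (simp add: f_def)
  have "(\<integral>\<^sup>+r. ennreal r * (ennreal (abel_kernel (t\<^sup>2 - r\<^sup>2)) * indicator A r) \<partial>lborel)
    = (\<integral>\<^sup>+r. ennreal (f r * indicator {t * sin 0..t * sin (pi/2)} r) \<partial>lborel)"
  proof (rule nn_integral_cong)
    fix r :: real
    have "abel_kernel (t\<^sup>2 - r\<^sup>2) = 0" if "r > t"
      using that t by (simp add: abel_kernel_def power2_eq_square) (meson less_eq_real_def mult_strict_mono not_less order_less_trans)
    then show "ennreal r * (ennreal (abel_kernel (t\<^sup>2 - r\<^sup>2)) * indicator A r)
      = ennreal (f r * indicator {t * sin 0..t * sin (pi/2)} r)"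
      by (cases "r < 0") (auto simp: f_def indicator_def ennreal_mult ennreal_neg)
  qed
  also have "\<dots> = (\<integral>\<^sup>+\<phi>. f (t * sin \<phi>) * (t * cos \<phi>) * indicator {0..pi/2} \<phi> \<partial>lborel)"
  proof (rule nn_integral_substitution[where g = "\<lambda>\<phi>. t * sin \<phi>" and g' = "\<lambda>\<phi>. t * cos \<phi>"])
    show "set_borel_measurable borel {t * sin 0..t * sin (pi/2)} f" by (simp add: set_borel_measurable_def)
    show "((\<lambda>\<phi>. t * sin \<phi>) has_real_derivative t * cos \<phi>) (at \<phi>)" for \<phi>
      by (auto intro!: derivative_eq_intros)
    show "0 \<le> t * cos \<phi>" if "\<phi> \<in> {0..pi/2}" for \<phi>
      using that t by (intro mult_nonneg_nonneg cos_ge_zero) auto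
  qed (auto intro!: continuous_intros)
  also have "\<dots> = (\<integral>\<^sup>+\<phi>. ennreal (t * sin \<phi>) * indicator A (t * sin \<phi>) * indicator {0..pi/2} \<phi> \<partial>lborel)"
  proof (rule nn_integral_cong_AE)
    \<comment> \<open>At pi/2 the argument of the kernel is 0 and the default value would break the
      equality.\<close>
    have "AE \<phi> in lborel. \<phi> \<noteq> pi/2" by (rule AE_lborel_singleton)
    then show "AE \<phi> in lborel. ennreal (f (t * sin \<phi>) * (t * cos \<phi>) * indicator {0..pi/2} \<phi>)
      = ennreal (t * sin \<phi>) * indicator A (t * sin \<phi>) * indicator {0..pi/2} \<phi>"
    proof eventually_elim
      case (elim \<phi>)
      show ?case
      proof (cases "\<phi> \<in> {0..pi/2}")
        case True
        then have c: "cos \<phi> > 0" using elim by (intro cos_gt_zero_pi) auto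
        have "t\<^sup>2 - (t * sin \<phi>)\<^sup>2 = (t * cos \<phi>)\<^sup>2"
          by (simp add: power_mult_distrib cos_squared_eq algebra_simps)
        then have "abel_kernel (t\<^sup>2 - (t * sin \<phi>)\<^sup>2) = 1 / (t * cos \<phi>)"
          using c t by (simp add: abel_kernel_def)
        then show ?thesis using c t True by (auto simp: f_def indicator_def mult.commute)
      qed simp
    qed
  qed
  also have "\<dots> = (\<integral>\<^sup>+\<phi>. ennreal (t * sin \<phi>) * indicator A (t * sin \<phi>) \<partial>icc 0 (pi/2))"
    by (subst nn_integral_icc) auto
  finally show ?thesis .
qed

section \<open>Projection of the hemisphere to the disc, and the planar form of the
  potential\<close>

abbreviation hemi :: "(real \<times> real) measure" where
  "hemi \<equiv> icc 0 (pi/2) \<Otimes>\<^sub>M icc 0 (2*pi)"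

interpretation icc_pair: pair_sigma_finite "icc a b" "icc c d" ..

text \<open>Vertical projection of the hemisphere of radius t onto its disc: the area element of the
  hemisphere is t / sqrt (t^2 - r^2) times that of the disc, and \<open>hemi\<close> with density t
  sin \<phi> is the surface measure divided by t.\<close>

lemma distr_hemi:
  fixes y :: "real^2"
  assumes t: "t > 0"
  shows "distr (density hemi (\<lambda>p. ennreal (t * sin (fst p)))) borel (\<lambda>p. y + (t * sin (fst p)) *\<^sub>R dir (snd p))
    = density lborel (\<lambda>w. ennreal (abel_kernel (t\<^sup>2 - (norm (w - y))\<^sup>2)))"
    (is "?D = _")
proof (rule measure_eqI)
  fix A :: "(real^2) set" assume "A \<in> sets (?D)"
  then have [measurable]: "A \<in> sets borel" by simp
  let ?k = "\<lambda>w. ennreal (abel_kernel (t\<^sup>2 - (norm (w - y))\<^sup>2))"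
  have "emeasure (density lborel ?k) A = (\<integral>\<^sup>+w. ?k w * indicator A w \<partial>lborel)"
    by (simp add: emeasure_density)
  also have "\<dots> = (\<integral>\<^sup>+w. ?k (y + w) * indicator A (y + w) \<partial>lborel)"
    by (subst lborel_distr_plus[of y, symmetric]) (simp add: nn_integral_distr)
  also have "\<dots> = (\<integral>\<^sup>+\<theta>. \<integral>\<^sup>+r. ennreal r * (ennreal (abel_kernel (t\<^sup>2 - r\<^sup>2)) * indicator A (y + r *\<^sub>R dir \<theta>)) * indicator {0..2*pi} \<theta> \<partial>lborel \<partial>lborel)"
    by (subst nn_integral_polar) auto
  also have "\<dots> = (\<integral>\<^sup>+\<theta>. (\<integral>\<^sup>+\<phi>. ennreal (t * sin \<phi>) * indicator A (y + (t * sin \<phi>) *\<^sub>R dir \<theta>) \<partial>icc 0 (pi/2)) * indicator {0..2*pi} \<theta> \<partial>lborel)"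
  proof (rule nn_integral_cong)
    fix \<theta> :: real
    have [measurable]: "{r. y + r *\<^sub>R dir \<theta> \<in> A} \<in> sets borel"
      using measurable_sets_borel[of "\<lambda>r. y + r *\<^sub>R dir \<theta>" borel A] by (simp add: vimage_def)
    have "(\<integral>\<^sup>+r. ennreal r * (ennreal (abel_kernel (t\<^sup>2 - r\<^sup>2)) * indicator A (y + r *\<^sub>R dir \<theta>)) * indicator {0..2*pi} \<theta> \<partial>lborel)
      = (\<integral>\<^sup>+r. ennreal r * (ennreal (abel_kernel (t\<^sup>2 - r\<^sup>2)) * indicator {r. y + r *\<^sub>R dir \<theta> \<in> A} r) \<partial>lborel) * indicator {0..2*pi} \<theta>"
      by (subst nn_integral_multc) (auto simp: indicator_def)
    also have "\<dots> = (\<integral>\<^sup>+\<phi>. ennreal (t * sin \<phi>) * indicator A (y + (t * sin \<phi>) *\<^sub>R dir \<theta>) \<partial>icc 0 (pi/2)) * indicator {0..2*pi} \<theta>"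
      by (subst nn_integral_abel[OF t]) (auto simp: indicator_def)
    finally show "(\<integral>\<^sup>+r. ennreal r * (ennreal (abel_kernel (t\<^sup>2 - r\<^sup>2)) * indicator A (y + r *\<^sub>R dir \<theta>)) * indicator {0..2*pi} \<theta> \<partial>lborel) = \<dots>" .
  qed
  also have "\<dots> = (\<integral>\<^sup>+\<theta>. \<integral>\<^sup>+\<phi>. ennreal (t * sin \<phi>) * indicator A (y + (t * sin \<phi>) *\<^sub>R dir \<theta>) \<partial>icc 0 (pi/2) \<partial>icc 0 (2*pi))"
    by (subst nn_integral_icc[of _ 0 "2*pi"]) auto
  also have "\<dots> = (\<integral>\<^sup>+p. ennreal (t * sin (fst p)) * indicator A (y + (t * sin (fst p)) *\<^sub>R dir (snd p)) \<partial>hemi)"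
    by (subst icc_pair.nn_integral_snd[symmetric]) auto
  also have "\<dots> = emeasure (?D) A"
  proof -
    have "(\<lambda>p. y + (t * sin (fst p)) *\<^sub>R dir (snd p)) -` A \<inter> space hemi \<in> sets hemi"
      by (rule measurable_sets[of _ hemi borel]) auto
    then show ?thesis
      by (subst emeasure_distr)
        (auto simp: emeasure_density space_pair_measure indicator_def intro!: nn_integral_cong)
  qed
  finally show "emeasure (?D) A
    = emeasure (density lborel ?k) A" by simp
qed simp

lemma icc_pair_density:
  "icc a b \<Otimes>\<^sub>M icc c d = density lborel (\<lambda>p. ennreal (indicator (cbox (a, c) (b, d)) p))"
proof -
  have "icc a b \<Otimes>\<^sub>M icc c d = density (lborel \<Otimes>\<^sub>M lborel) (\<lambda>(x, y). indicator {a..b} x * indicator {c..d} y)"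
    unfolding icc_def
    by (rule pair_measure_density) (auto simp flip: icc_def intro: sigma_finite_lborel icc.sigma_finite_measure_axioms)
  also have "\<dots> = density lborel (\<lambda>p. ennreal (indicator (cbox (a, c) (b, d)) p))"
  proof -
    have "(\<lambda>p. indicator {a..b} (fst p) * indicator {c..d} (snd p) :: ennreal) \<in> borel_measurable (borel \<Otimes>\<^sub>M borel)"
      by measurable
    then have m: "(\<lambda>(x, y). indicator {a..b} x * indicator {c..d} y :: ennreal) \<in> borel_measurable lborel"
      by (simp add: borel_prod case_prod_unfold)
    have m': "(\<lambda>p. ennreal (indicator (cbox (a, c) (b, d)) p)) \<in> borel_measurable lborel"
      by (intro measurable_compose[OF _ measurable_ennreal] borel_measurable_indicator)
        (metis borel_closed closed_cbox sets_lborel)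
    show ?thesis
      unfolding lborel_prod by (rule density_cong[OF m m']) (auto simp: indicator_def cbox_Pair_eq)
  qed
  finally show ?thesis .
qed

lemma AE_icc_pair: "AE p in icc a b \<Otimes>\<^sub>M icc c d. p \<in> cbox (a, c) (b, d)"
  unfolding icc_pair_density by (subst AE_density) (auto simp: indicator_def)

lemma integral_icc_pair_continuous:
  fixes F :: "real \<times> real \<Rightarrow> real"
  assumes F: "continuous_on UNIV F"
  shows "integrable (icc a b \<Otimes>\<^sub>M icc c d) F"
    and "(\<integral>p. F p \<partial>(icc a b \<Otimes>\<^sub>M icc c d)) = integral (cbox (a, c) (b, d)) F"
proof -
  have [measurable]: "F \<in> borel_measurable borel" using F by (rule borel_measurable_continuous_onI)
  have i: "set_integrable lborel (cbox (a, c) (b, d)) F"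
    unfolding set_integrable_def
    by (rule borel_integrable_compact) (auto intro: continuous_on_subset[OF F])
  then show "integrable (icc a b \<Otimes>\<^sub>M icc c d) F"
    unfolding icc_pair_density set_integrable_def by (subst integrable_density) auto
  show "(\<integral>p. F p \<partial>(icc a b \<Otimes>\<^sub>M icc c d)) = integral (cbox (a, c) (b, d)) F"
    unfolding icc_pair_density set_borel_integral_eq_integral(2)[OF i, symmetric] set_lebesgue_integral_def
    by (subst integral_density) auto
qed

text \<open>The primitive in time of Poisson's formula.\<close>
definition poisson_pot :: "(real^2 \<Rightarrow> real) \<Rightarrow> real^2 \<Rightarrow> real \<Rightarrow> real" where
  "poisson_pot g y t = 1 / (2 * pi) * integral (cbox (0, 0) (pi / 2, 2 * pi))
     (\<lambda>(\<phi>, \<theta>). t * sin \<phi> * g (y + (t * sin \<phi>) *\<^sub>R dir \<theta>))"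

text \<open>Both forms of the potential are needed. In angular form the domain is fixed and the
  integrand can be differentiated in \<open>t\<close>; in planar form \<open>y\<close> and
  \<open>t\<close> enter through the kernel only, so the integration over them can be moved inside
  the integral over \<open>w\<close>.\<close>

lemma poisson_pot_eq_lborel:
  assumes g: "continuous_on UNIV g" and t: "t > 0"
  shows "integrable lborel (\<lambda>w. g w * abel_kernel (t\<^sup>2 - (norm (w - y))\<^sup>2))"
    and "poisson_pot g y t = 1 / (2 * pi) * (\<integral>w. g w * abel_kernel (t\<^sup>2 - (norm (w - y))\<^sup>2) \<partial>lborel)"
proof -
  have [measurable]: "g \<in> borel_measurable borel" using g by (rule borel_measurable_continuous_onI)
  let ?T = "\<lambda>p. y + (t * sin (fst p)) *\<^sub>R dir (snd p)"
  have nn: "AE p in hemi. 0 \<le> t * sin (fst p)"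
    using AE_icc_pair[where a = 0 and b = "pi/2" and c = 0 and d = "2*pi"]
    by eventually_elim (use t in \<open>auto intro!: mult_nonneg_nonneg sin_ge_zero\<close>)
  have c: "continuous_on UNIV (\<lambda>p. t * sin (fst p) * g (?T p))"
    by (intro continuous_intros continuous_on_compose2[OF g]) auto
  note ic = integral_icc_pair_continuous[OF c, where a = 0 and b = "pi/2" and c = 0 and d = "2*pi"]
  have "integrable (density lborel (\<lambda>w. ennreal (abel_kernel (t\<^sup>2 - (norm (w - y))\<^sup>2)))) g"
    unfolding distr_hemi[OF t, symmetric] using ic(1) nn
    by (subst integrable_distr_eq, simp, simp, subst integrable_density) auto
  then show "integrable lborel (\<lambda>w. g w * abel_kernel (t\<^sup>2 - (norm (w - y))\<^sup>2))"
    by (subst (asm) integrable_density) (auto simp: mult.commute)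
  have "(\<integral>w. g w * abel_kernel (t\<^sup>2 - (norm (w - y))\<^sup>2) \<partial>lborel) = (\<integral>w. g w \<partial>density lborel (\<lambda>w. ennreal (abel_kernel (t\<^sup>2 - (norm (w - y))\<^sup>2))))"
    by (subst integral_density) (auto simp: mult.commute)
  also have "\<dots> = (\<integral>p. t * sin (fst p) * g (?T p) \<partial>hemi)"
    unfolding distr_hemi[OF t, symmetric] using nn
    by (subst integral_distr, simp, simp, subst integral_density) auto
  also have "\<dots> = 2 * pi * poisson_pot g y t"
    using ic(2) by (simp add: poisson_pot_def case_prod_unfold)
  finally show "poisson_pot g y t = 1 / (2 * pi) * (\<integral>w. g w * abel_kernel (t\<^sup>2 - (norm (w - y))\<^sup>2) \<partial>lborel)"
    by simp
qed

lemma poisson_pot_has_derivative: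
  assumes g: "grad2 g g1 g2" and c: "continuous_on UNIV g1" "continuous_on UNIV g2"
  shows "(poisson_pot g y has_real_derivative poisson_sol g g1 g2 y t) (at t)"
proof -
  let ?Q = "cbox (0, 0) (pi / 2, 2 * pi) :: (real \<times> real) set"
  define F where "F = (\<lambda>t (\<phi>, \<theta>). t * sin \<phi> * g (y + (t * sin \<phi>) *\<^sub>R dir \<theta>))"
  define F' where "F' = (\<lambda>t (\<phi>, \<theta>). sin \<phi> * (g (y + (t * sin \<phi>) *\<^sub>R dir \<theta>) + t * (sin \<phi> *
       (cos \<theta> * g1 (y + (t * sin \<phi>) *\<^sub>R dir \<theta>) + sin \<theta> * g2 (y + (t * sin \<phi>) *\<^sub>R dir \<theta>)))))"
  note [continuous_intros] = continuous_on_compose2[OF grad2_continuous[OF g]] c[THEN continuous_on_compose2]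
  have "((\<lambda>t. integral ?Q (F t)) has_real_derivative integral ?Q (F' t)) (at t within UNIV)"
  proof (rule leibniz_rule_field_derivative)
    fix t p assume "p \<in> ?Q"
    obtain \<phi> \<theta> where p: "p = (\<phi>, \<theta>)" by (cases p)
    have vq: "((\<lambda>t. y + (t * sin \<phi>) *\<^sub>R dir \<theta>) has_vector_derivative sin \<phi> *\<^sub>R dir \<theta>) (at t within UNIV)"
      by (auto intro!: derivative_eq_intros)
    have D: "((\<lambda>t. g (y + (t * sin \<phi>) *\<^sub>R dir \<theta>)) has_real_derivative sin \<phi> * (cos \<theta> * g1 (y + (t * sin \<phi>) *\<^sub>R dir \<theta>)
       + sin \<theta> * g2 (y + (t * sin \<phi>) *\<^sub>R dir \<theta>))) (at t within UNIV)"
      using grad2_path[OF g vq] by (simp add: algebra_simps)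
    show "((\<lambda>t. F t p) has_real_derivative F' t p) (at t within UNIV)"
      unfolding F_def p prod.case F'_def
      by (rule derivative_eq_intros D refl)+ (simp add: algebra_simps)
  next
    show "F t integrable_on ?Q" for t
      unfolding F_def case_prod_unfold by (intro integrable_continuous continuous_intros) auto
    show "continuous_on (UNIV \<times> ?Q) (\<lambda>(a, p). F' a p)"
      unfolding F'_def case_prod_unfold by (intro continuous_intros) auto
  qed auto
  then have "((\<lambda>t. 1 / (2 * pi) * integral ?Q (F t)) has_real_derivative 1 / (2 * pi) * integral ?Q (F' t)) (at t)"
    by (rule DERIV_cmult)
  then show ?thesis unfolding poisson_sol_def F'_def F_def poisson_pot_def[abs_def] .
qed

lemma continuous_on_poisson_sol:
  assumes c: "continuous_on UNIV g" "continuous_on UNIV g1" "continuous_on UNIV g2"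
  shows "continuous_on UNIV (\<lambda>p. poisson_sol g g1 g2 (fst p) (snd p))"
proof -
  note [continuous_intros] = c[THEN continuous_on_compose2]
  show ?thesis unfolding poisson_sol_def case_prod_unfold
    by (intro continuous_intros integral_continuous_on_param[where f = "\<lambda>x p. _ x p", unfolded case_prod_unfold]) auto
qed

lemma continuous_on_poisson_pot:
  assumes c: "continuous_on UNIV g"
  shows "continuous_on UNIV (\<lambda>p. poisson_pot g (fst p) (snd p))"
proof -
  note [continuous_intros] = c[THEN continuous_on_compose2]
  show ?thesis unfolding poisson_pot_def case_prod_unfold
    by (intro continuous_intros integral_continuous_on_param[where f = "\<lambda>x p. _ x p", unfolded case_prod_unfold]) auto
qed

lemma vanishing_bounded:
  fixes g :: "real^2 \<Rightarrow> real"
  assumes "continuous_on UNIV g" "\<And>x. x \<notin> ball z \<rho> \<Longrightarrow> g x = 0"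
  obtains M where "M > 0" "\<And>x. \<bar>g x\<bar> \<le> M"
proof -
  have "compact (g ` cball z \<rho>)"
    by (intro compact_continuous_image continuous_on_subset[OF assms(1)]) auto
  then obtain M where M: "M > 0" "\<And>x. x \<in> cball z \<rho> \<Longrightarrow> \<bar>g x\<bar> \<le> M"
    using bounded_pos by (metis compact_imp_bounded image_eqI real_norm_def)
  have "\<bar>g x\<bar> \<le> M" for x
    using M assms(2)[of x] by (cases "x \<in> ball z \<rho>") (auto simp: less_imp_le)
  with M(1) that show ?thesis by blast
qed

text \<open>The integrand vanishes unless y + t sin \<phi> dir \<theta> lies in the ball, and this
  forces t sin \<phi> to be at most the diameter. The factor t sin \<phi> in front of the gradient
  is then bounded, while the outer factor sin \<phi> is at most the diameter over t and supplies the
  decay.\<close>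

lemma poisson_sol_bound:
  assumes c: "continuous_on UNIV g" "continuous_on UNIV g1" "continuous_on UNIV g2"
    and z: "\<And>x. x \<notin> ball z \<rho> \<Longrightarrow> g x = 0" "\<And>x. x \<notin> ball z \<rho> \<Longrightarrow> g1 x = 0" "\<And>x. x \<notin> ball z \<rho> \<Longrightarrow> g2 x = 0"
  obtains C where "C > 0" "\<And>y t. norm (y - z) \<le> \<rho> \<Longrightarrow> t > 0 \<Longrightarrow> \<bar>poisson_sol g g1 g2 y t\<bar> \<le> C / t"
proof -
  obtain M0 where M0: "M0 > 0" "\<And>x. \<bar>g x\<bar> \<le> M0" using vanishing_bounded[OF c(1) z(1)] by blast
  obtain M1 where M1: "M1 > 0" "\<And>x. \<bar>g1 x\<bar> \<le> M1" using vanishing_bounded[OF c(2) z(2)] by blast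
  obtain M2 where M2: "M2 > 0" "\<And>x. \<bar>g2 x\<bar> \<le> M2" using vanishing_bounded[OF c(3) z(3)] by blast
  define B where "B = (M0 + 2 * \<bar>\<rho>\<bar> * (M1 + M2)) * (2 * \<bar>\<rho>\<bar>)"
  have B: "B \<ge> 0" using M0 M1 M2 by (simp add: B_def)
  have pt: "\<bar>sin \<phi> * (g q + t * (sin \<phi> * (cos \<theta> * g1 q + sin \<theta> * g2 q)))\<bar> \<le> B / t"
    if y: "norm (y - z) \<le> \<rho>" and t: "t > 0" and \<phi>: "\<phi> \<in> {0..pi/2}" and q: "q = y + (t * sin \<phi>) *\<^sub>R dir \<theta>"
    for y t \<phi> \<theta> q
  proof (cases "q \<in> ball z \<rho>")
    case True
    have s: "sin \<phi> \<ge> 0" using \<phi> by (intro sin_ge_zero) auto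
    have "norm (q - y) = t * sin \<phi>" using s t by (simp add: q)
    moreover have "norm (q - y) \<le> norm (q - z) + norm (y - z)"
      by (metis norm_minus_commute norm_triangle_ineq diff_add_cancel add_diff_eq diff_add_eq)
    moreover have "norm (q - z) < \<rho>" using True by (simp add: dist_norm norm_minus_commute)
    ultimately have ts: "t * sin \<phi> \<le> 2 * \<bar>\<rho>\<bar>" using y by simp
    have "\<bar>cos \<theta> * g1 q + sin \<theta> * g2 q\<bar> \<le> \<bar>cos \<theta>\<bar> * \<bar>g1 q\<bar> + \<bar>sin \<theta>\<bar> * \<bar>g2 q\<bar>"
      by (metis abs_mult abs_triangle_ineq)
    also have "\<dots> \<le> 1 * M1 + 1 * M2" using M1 M2 by (intro add_mono mult_mono) auto
    finally have 1: "\<bar>cos \<theta> * g1 q + sin \<theta> * g2 q\<bar> \<le> M1 + M2" by simp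
    have "\<bar>t * (sin \<phi> * (cos \<theta> * g1 q + sin \<theta> * g2 q))\<bar> = (t * sin \<phi>) * \<bar>cos \<theta> * g1 q + sin \<theta> * g2 q\<bar>"
      using s t by (simp add: abs_mult)
    also have "\<dots> \<le> 2 * \<bar>\<rho>\<bar> * (M1 + M2)" by (rule mult_mono) (use ts 1 s t in auto)
    finally have "\<bar>g q + t * (sin \<phi> * (cos \<theta> * g1 q + sin \<theta> * g2 q))\<bar> \<le> M0 + 2 * \<bar>\<rho>\<bar> * (M1 + M2)"
      using M0(2)[of q] by linarith
    note 2 = this
    have "(t * sin \<phi>) * \<bar>g q + t * (sin \<phi> * (cos \<theta> * g1 q + sin \<theta> * g2 q))\<bar> \<le> (2 * \<bar>\<rho>\<bar>) * (M0 + 2 * \<bar>\<rho>\<bar> * (M1 + M2))"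
      by (rule mult_mono) (use 2 ts s t in auto)
    also have "(2 * \<bar>\<rho>\<bar>) * (M0 + 2 * \<bar>\<rho>\<bar> * (M1 + M2)) = B"
      by (simp add: B_def)
    finally have "\<bar>sin \<phi> * (g q + t * (sin \<phi> * (cos \<theta> * g1 q + sin \<theta> * g2 q)))\<bar> * t \<le> B"
      unfolding abs_mult[of "sin \<phi>"] abs_of_nonneg[OF s] by (simp only: mult_ac)
    then show ?thesis by (simp only: pos_le_divide_eq[OF t])
  next
    case False
    then show ?thesis using z B t by simp
  qed
  \<comment> \<open>The parameter domain has area pi^2, and the prefactor 1 / (2 pi) leaves B pi /
    2. The summand 1 makes the constant positive even if \<open>B\<close> is 0.\<close>
  have main: "\<bar>poisson_sol g g1 g2 y t\<bar> \<le> (B * pi + 1) / t" if y: "norm (y - z) \<le> \<rho>" and t: "t > 0" for y t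
  proof -
    let ?F = "\<lambda>(\<phi>, \<theta>). sin \<phi> * (g (y + (t * sin \<phi>) *\<^sub>R dir \<theta>) + t * (sin \<phi> *
       (cos \<theta> * g1 (y + (t * sin \<phi>) *\<^sub>R dir \<theta>) + sin \<theta> * g2 (y + (t * sin \<phi>) *\<^sub>R dir \<theta>))))"
    note [continuous_intros] = c[THEN continuous_on_compose2]
    have "norm (integral (cbox (0, 0) (pi / 2, 2 * pi)) ?F) \<le> B / t * measure lborel (cbox (0, 0) (pi / 2, 2 * pi) :: (real \<times> real) set)"
    proof (rule has_integral_bound[OF _ integrable_integral[OF integrable_continuous]])
      show "continuous_on (cbox (0, 0) (pi / 2, 2 * pi)) ?F"
        unfolding case_prod_unfold by (intro continuous_intros) auto
      show "0 \<le> B / t" using B t by simp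
      show "norm (?F p) \<le> B / t" if "p \<in> cbox (0, 0) (pi / 2, 2 * pi)" for p
        using pt[OF y t _ refl, of "fst p" "snd p"] that by (cases p) auto
    qed
    also have "measure lborel (cbox (0, 0) (pi / 2, 2 * pi) :: (real \<times> real) set) = pi * pi"
      by (simp add: content_Pair)
    finally have "\<bar>poisson_sol g g1 g2 y t\<bar> \<le> 1 / (2 * pi) * (B / t * (pi * pi))"
      unfolding poisson_sol_def abs_mult by (intro mult_mono) auto
    also have "\<dots> = B * pi / (2 * t)" by simp
    also have "\<dots> \<le> (B * pi + 1) / t" using B t by (simp add: field_simps)
    finally show ?thesis .
  qed
  show ?thesis by (rule that[of "B * pi + 1"]) (use main B in \<open>auto intro: add_nonneg_pos\<close>)
qed

section \<open>Logarithmic integrals over the circle\<close>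

abbreviation ang :: "real measure" where
  "ang \<equiv> icc 0 (2 * pi)"

lemma periodic_mult:
  assumes "\<And>x. F (x + 2 * pi) = F x"
  shows "F (x + 2 * pi * real_of_int n) = F x"
proof (induction n rule: int_induct[where k = 0])
  case (step1 i)
  then show ?case using assms[of "x + 2 * pi * real_of_int i"] by (simp add: algebra_simps)
next
  case (step2 i)
  then show ?case using assms[of "x + 2 * pi * real_of_int (i - 1)"] by (simp add: algebra_simps)
qed simp

lemma nn_integral_ang_shift:
  fixes F :: "real \<Rightarrow> ennreal"
  assumes F[measurable]: "F \<in> borel_measurable borel" and per: "\<And>x. F (x + 2 * pi) = F x"
  shows "(\<integral>\<^sup>+x. F (x - \<gamma>) \<partial>ang) = (\<integral>\<^sup>+x. F x \<partial>ang)"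
proof -
  \<comment> \<open>Reduces the shift modulo 2 pi: - \<gamma> = r + 2 pi n with 0 \<le> r < 2 pi.
    The window [r, 2 pi + r] is then cut at 2 pi and its upper piece moved back by
    periodicity.\<close>
  define n where "n = \<lfloor>- \<gamma> / (2 * pi)\<rfloor>"
  define r where "r = - \<gamma> - 2 * pi * real_of_int n"
  have "real_of_int n \<le> - \<gamma> / (2 * pi)" "- \<gamma> / (2 * pi) < real_of_int n + 1"
    unfolding n_def by linarith+
  then have r: "0 \<le> r" "r < 2 * pi"
    by (simp_all add: r_def field_simps)
  have "F (x - \<gamma>) = F (r + x)" for x
    using periodic_mult[of F, OF per, of "r + x" n] by (simp add: r_def algebra_simps)
  then have "(\<integral>\<^sup>+x. F (x - \<gamma>) \<partial>ang) = (\<integral>\<^sup>+x. F (r + x) * indicator {0..2*pi} x \<partial>lborel)"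
    by (subst nn_integral_icc) auto
  also have "\<dots> = (\<integral>\<^sup>+x. F x * indicator {r..2*pi + r} x \<partial>lborel)"
    by (subst (2) nn_integral_real_affine[where c = 1 and t = r]) (auto simp: indicator_def intro!: nn_integral_cong)
  also have "\<dots> = (\<integral>\<^sup>+x. F x * indicator {r..2*pi} x + F x * indicator {2*pi<..2*pi + r} x \<partial>lborel)"
    using r by (intro nn_integral_cong) (auto simp: indicator_def)
  also have "\<dots> = (\<integral>\<^sup>+x. F x * indicator {r..2*pi} x \<partial>lborel) + (\<integral>\<^sup>+x. F x * indicator {2*pi<..2*pi + r} x \<partial>lborel)"
    by (rule nn_integral_add) auto
  also have "(\<integral>\<^sup>+x. F x * indicator {2*pi<..2*pi + r} x \<partial>lborel) = (\<integral>\<^sup>+x. F x * indicator {0<..r} x \<partial>lborel)"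
    by (subst nn_integral_real_affine[where c = 1 and t = "2*pi"])
      (auto simp: indicator_def per add.commute[of "2*pi"] intro!: nn_integral_cong)
  also have "(\<integral>\<^sup>+x. F x * indicator {r..2*pi} x \<partial>lborel) + (\<integral>\<^sup>+x. F x * indicator {0<..r} x \<partial>lborel)
     = (\<integral>\<^sup>+x. F x * indicator {r..2*pi} x + F x * indicator {0<..r} x \<partial>lborel)"
    by (rule nn_integral_add[symmetric]) auto
  also have "\<dots> = (\<integral>\<^sup>+x. F x * indicator {0..2*pi} x \<partial>lborel)"
  proof (rule nn_integral_cong_AE)
    have "AE x in lborel. x \<noteq> (0 :: real)" "AE x in lborel. x \<noteq> r"
      by (rule AE_lborel_singleton)+
    then show "AE x in lborel. F x * indicator {r..2*pi} x + F x * indicator {0<..r} x = F x * indicator {0..2*pi} x"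
      by eventually_elim (use r in \<open>auto simp: indicator_def\<close>)
  qed
  also have "\<dots> = (\<integral>\<^sup>+x. F x \<partial>ang)"
    by (subst nn_integral_icc) auto
  finally show ?thesis .
qed

lemma integral_ang_shift:
  fixes F :: "real \<Rightarrow> real"
  assumes F[measurable]: "F \<in> borel_measurable borel" and per: "\<And>x. F (x + 2 * pi) = F x"
    and int: "integrable ang F"
  shows "integrable ang (\<lambda>x. F (x - \<gamma>))" "(\<integral>x. F (x - \<gamma>) \<partial>ang) = (\<integral>x. F x \<partial>ang)"
proof -
  have "(\<integral>\<^sup>+x. ennreal (norm (F (x - \<gamma>))) \<partial>ang) = (\<integral>\<^sup>+x. ennreal (norm (F x)) \<partial>ang)"
    by (rule nn_integral_ang_shift) (auto simp: per)
  then show i: "integrable ang (\<lambda>x. F (x - \<gamma>))"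
    using int by (simp add: integrable_iff_bounded)
  have 1: "(\<integral>\<^sup>+x. ennreal (F (x - \<gamma>)) \<partial>ang) = (\<integral>\<^sup>+x. ennreal (F x) \<partial>ang)"
    by (rule nn_integral_ang_shift) (auto simp: per)
  have 2: "(\<integral>\<^sup>+x. ennreal (- F (x - \<gamma>)) \<partial>ang) = (\<integral>\<^sup>+x. ennreal (- F x) \<partial>ang)"
    by (rule nn_integral_ang_shift) (auto simp: per)
  show "(\<integral>x. F (x - \<gamma>) \<partial>ang) = (\<integral>x. F x \<partial>ang)"
    unfolding real_lebesgue_integral_def[OF i] real_lebesgue_integral_def[OF int] 1 2 ..
qed

text \<open>This is ln |1 - e^(i\<theta>)|, whose Fourier series is - \<Sum> cos (k \<theta>) / k
  over k \<ge> 1. The first Fourier coefficients are what yields the affine dependence on c.\<close>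

definition logsin :: "real \<Rightarrow> real" where
  "logsin \<theta> = ln \<bar>2 * sin (\<theta> / 2)\<bar>"

lemma borel_measurable_logsin [measurable]: "logsin \<in> borel_measurable borel"
  unfolding logsin_def[abs_def] by measurable

lemma logsin_periodic: "logsin (\<theta> + 2 * pi) = logsin \<theta>"
  by (simp add: logsin_def add_divide_distrib sin_add)

lemma logsin_reflect: "logsin (2 * pi - \<theta>) = logsin \<theta>"
  by (simp add: logsin_def diff_divide_distrib sin_diff)

lemma sin_ge_linear:
  assumes "0 \<le> x" "x \<le> pi / 2"
  shows "x / 2 \<le> sin x"
proof -
  have "concave_on {0..pi/2} sin"
    by (rule f''_le0_imp_concave[where f' = cos and f'' = "\<lambda>x. - sin x"])
      (auto intro!: derivative_eq_intros sin_ge_zero)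
  from concave_onD_Icc'[OF this, of x] have "2 / pi * x \<le> sin x"
    using assms by simp
  moreover have "x / 2 \<le> 2 / pi * x"
    using assms pi_less_4 mult_right_mono[of pi 4 x] by (simp add: field_simps)
  ultimately show ?thesis by linarith
qed

text \<open>Trades the logarithmic singularity for an inverse square root, which has the elementary
  primitive 2 sqrt s. For s < 1 it is ln q \<le> q - 1 at q = 1 / sqrt s.\<close>

lemma abs_ln_le:
  assumes "0 < s" "s \<le> 2"
  shows "\<bar>ln s\<bar> \<le> 1 + 2 / sqrt s"
proof (cases "s \<ge> 1")
  case True
  then have "0 \<le> ln s" "ln s \<le> s - 1" using ln_le_minus_one[of s] by auto
  then have "\<bar>ln s\<bar> \<le> 1" using assms by linarith
  also have "\<dots> \<le> 1 + 2 / sqrt s" using assms by simp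
  finally show ?thesis .
next
  case False
  have "ln (1 / sqrt s) \<le> 1 / sqrt s - 1" using assms by (intro ln_le_minus_one) simp
  then show ?thesis using assms False by (simp add: ln_div ln_sqrt)
qed

lemma logsin_bound_left:
  assumes "0 < \<theta>" "\<theta> \<le> pi"
  shows "\<bar>logsin \<theta>\<bar> \<le> 1 + 4 / sqrt \<theta>"
proof -
  have s: "\<theta> / 2 / 2 \<le> sin (\<theta> / 2)" using assms by (intro sin_ge_linear) auto
  define S where "S = 2 * sin (\<theta> / 2)"
  have S: "\<theta> / 4 \<le> S" "0 < S" "S \<le> 2" using s assms by (auto simp: S_def)
  have "\<bar>logsin \<theta>\<bar> = \<bar>ln S\<bar>" using S by (simp add: logsin_def S_def)
  also have "\<dots> \<le> 1 + 2 / sqrt S" using S by (intro abs_ln_le)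
  also have "2 / sqrt S \<le> 2 / sqrt (\<theta> / 4)" using S assms by (intro divide_left_mono) (auto intro!: mult_pos_pos)
  also have "2 / sqrt (\<theta> / 4) = 4 / sqrt \<theta>" by (simp add: real_sqrt_divide)
  finally show ?thesis by simp
qed

lemma integrable_ang_inverse_sqrt: "integrable ang (\<lambda>x. 1 / sqrt x)"
proof -
  have "set_integrable lborel (einterval (ereal 0) (ereal (2*pi))) (\<lambda>x. 1 / sqrt x)"
  proof (rule interval_integral_FTC_nonneg(1)[where F = "\<lambda>x. 2 * sqrt x"])
    show "((\<lambda>x. 2 * sqrt x) has_real_derivative 1 / sqrt x) (at x)" if "ereal 0 < ereal x" for x
      using that by (auto intro!: derivative_eq_intros simp: field_simps)
    show "isCont (\<lambda>x. 1 / sqrt x) x" if "ereal 0 < ereal x" for x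
      using that by (auto intro!: continuous_intros)
    show "(((\<lambda>x. 2 * sqrt x) \<circ> real_of_ereal) \<longlongrightarrow> 2 * sqrt 0) (at_right (ereal 0))"
      unfolding ereal_tendsto_simps by (intro tendsto_intros)
    show "(((\<lambda>x. 2 * sqrt x) \<circ> real_of_ereal) \<longlongrightarrow> 2 * sqrt (2*pi)) (at_left (ereal (2*pi)))"
      unfolding ereal_tendsto_simps by (intro tendsto_intros)
  qed auto
  moreover have "set_integrable lborel (einterval (ereal 0) (ereal (2*pi))) (\<lambda>x. 1 / sqrt x)
     \<longleftrightarrow> set_integrable lborel {0..2*pi} (\<lambda>x. 1 / sqrt x)"
    unfolding set_integrable_def
  proof (rule integrable_cong_AE)
    have "AE x in lborel. x \<noteq> (0 :: real)" "AE x in lborel. x \<noteq> 2 * pi"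
      by (rule AE_lborel_singleton)+
    then show "AE x in lborel. indicator (einterval (ereal 0) (ereal (2*pi))) x *\<^sub>R (1 / sqrt x) = indicator {0..2*pi} x *\<^sub>R (1 / sqrt x)"
      by eventually_elim (auto simp: indicator_def einterval_def)
  qed (auto simp: einterval_eq)
  ultimately show ?thesis by (subst integral_icc) auto
qed

lemma integral_ang_reflect:
  fixes F :: "real \<Rightarrow> real"
  assumes [measurable]: "F \<in> borel_measurable borel"
  shows "integrable ang (\<lambda>x. F (2 * pi - x)) \<longleftrightarrow> integrable ang F"
    "(\<integral>x. F (2 * pi - x) \<partial>ang) = (\<integral>x. F x \<partial>ang)"
proof -
  have eq: "(\<lambda>x. indicator {0..2*pi} (2 * pi + - 1 * x) *\<^sub>R F (2 * pi + - 1 * x)) = (\<lambda>x. indicator {0..2*pi} x *\<^sub>R F (2 * pi - x))"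
    by (auto simp: indicator_def fun_eq_iff)
  show "integrable ang (\<lambda>x. F (2 * pi - x)) \<longleftrightarrow> integrable ang F"
    using lborel_integrable_real_affine_iff[of "-1" "\<lambda>x. indicator {0..2*pi} x *\<^sub>R F x" "2*pi"] eq
    by (simp add: integral_icc set_integrable_def)
  show "(\<integral>x. F (2 * pi - x) \<partial>ang) = (\<integral>x. F x \<partial>ang)"
    using lborel_integral_real_affine[of "-1" "\<lambda>x. indicator {0..2*pi} x *\<^sub>R F x" "2*pi"] eq
    by (simp add: integral_icc set_lebesgue_integral_def)
qed

lemma AE_ang_interior: "AE \<theta> in ang. 0 < \<theta> \<and> \<theta> < 2 * pi"
proof -
  have "AE x in lborel. x \<noteq> (0 :: real)" "AE x in lborel. x \<noteq> 2 * pi"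
    by (rule AE_lborel_singleton)+
  then show ?thesis unfolding AE_icc by eventually_elim auto
qed

text \<open>There is a singularity at each end of the period. The bound on the left half, reflected
  to the right half, leads to the two inverse square roots.\<close>

lemma integrable_logsin: "integrable ang logsin"
proof (rule Bochner_Integration.integrable_bound[of _ "\<lambda>x. 1 + (4 * (1 / sqrt x) + 4 * (1 / sqrt (2 * pi - x)))"])
  have "integrable ang (\<lambda>x. 1 / sqrt (2 * pi - x))"
    using integral_ang_reflect(1)[of "\<lambda>x. 1 / sqrt x"] integrable_ang_inverse_sqrt by simp
  then show "integrable ang (\<lambda>x. 1 + (4 * (1 / sqrt x) + 4 * (1 / sqrt (2 * pi - x))))"
    using integrable_ang_inverse_sqrt by (intro Bochner_Integration.integrable_add integrable_mult_right) auto
  show "AE x in ang. norm (logsin x) \<le> norm (1 + (4 * (1 / sqrt x) + 4 * (1 / sqrt (2 * pi - x))))"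
    using AE_ang_interior
  proof eventually_elim
    case (elim x)
    have nn: "0 \<le> 4 / sqrt x" "0 \<le> 4 / sqrt (2 * pi - x)" using elim by auto
    have "\<bar>logsin x\<bar> \<le> 1 + (4 / sqrt x + 4 / sqrt (2 * pi - x))"
    proof (cases "x \<le> pi")
      case True
      then show ?thesis using logsin_bound_left[of x] elim nn by linarith
    next
      case False
      then show ?thesis using logsin_bound_left[of "2 * pi - x"] elim nn unfolding logsin_reflect by linarith
    qed
    then show ?case using nn by simp
  qed
qed simp

lemma integrable_mult_bounded_trig:
  fixes F \<psi> :: "real \<Rightarrow> real"
  assumes "integrable M F" "\<psi> \<in> borel_measurable M" "\<And>x. \<bar>\<psi> x\<bar> \<le> 1"
  shows "integrable M (\<lambda>x. \<psi> x * F x)"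
proof (rule Bochner_Integration.integrable_bound[OF assms(1)])
  show "(\<lambda>x. \<psi> x * F x) \<in> borel_measurable M" using assms by measurable
  show "AE x in M. norm (\<psi> x * F x) \<le> norm (F x)"
    using assms(3) by (auto simp: abs_mult intro!: mult_left_le_one_le AE_I2)
qed

lemma integral_sin_logsin: "(\<integral>\<theta>. sin \<theta> * logsin \<theta> \<partial>ang) = 0"
proof -
  have "(\<integral>\<theta>. sin \<theta> * logsin \<theta> \<partial>ang) = (\<integral>\<theta>. sin (2 * pi - \<theta>) * logsin (2 * pi - \<theta>) \<partial>ang)"
    by (subst integral_ang_reflect(2)[symmetric]) auto
  also have "\<dots> = - (\<integral>\<theta>. sin \<theta> * logsin \<theta> \<partial>ang)"
    by (simp add: logsin_reflect sin_diff)
  finally show ?thesis by simp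
qed

text \<open>Used to make the primitive in \<open>integral_cos_logsin\<close> continuous up to the
  endpoints, where the logarithm itself is singular.\<close>

lemma continuous_mult_ln_abs: "continuous_on UNIV (\<lambda>s :: real. s * ln \<bar>s\<bar>)"
proof -
  have "isCont (\<lambda>s :: real. s * ln \<bar>s\<bar>) s" for s
  proof (cases "s = 0")
    case False
    then show ?thesis by (auto intro!: continuous_intros)
  next
    case True
    have "((\<lambda>s :: real. s * ln \<bar>s\<bar>) \<longlongrightarrow> 0) (at 0)"
    proof (rule Lim_null_comparison)
      have "\<forall>\<^sub>F s in at (0::real). s \<noteq> 0 \<and> \<bar>s\<bar> < 1"
        by (auto simp: eventually_at intro!: exI[of _ 1])
      then show "\<forall>\<^sub>F s in at (0::real). norm (s * ln \<bar>s\<bar>) \<le> \<bar>s\<bar> + 2 * sqrt \<bar>s\<bar>"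
      proof eventually_elim
        case (elim s)
        then have "\<bar>ln \<bar>s\<bar>\<bar> \<le> 1 + 2 / sqrt \<bar>s\<bar>" by (intro abs_ln_le) auto
        then have "\<bar>s\<bar> * \<bar>ln \<bar>s\<bar>\<bar> \<le> \<bar>s\<bar> * (1 + 2 / sqrt \<bar>s\<bar>)" by (intro mult_left_mono) auto
        also have "\<dots> = \<bar>s\<bar> + 2 * (\<bar>s\<bar> / sqrt \<bar>s\<bar>)" by (simp add: algebra_simps)
        also have "\<bar>s\<bar> / sqrt \<bar>s\<bar> = sqrt \<bar>s\<bar>" using elim by (simp add: real_div_sqrt)
        finally show ?case by (simp add: abs_mult)
      qed
      show "((\<lambda>s :: real. \<bar>s\<bar> + 2 * sqrt \<bar>s\<bar>) \<longlongrightarrow> 0) (at 0)"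
        by (auto intro!: tendsto_eq_intros)
    qed
    then show ?thesis using True by (simp add: isCont_def)
  qed
  then show ?thesis by (simp add: continuous_on_eq_continuous_at)
qed

lemma integral_cos_logsin: "(\<integral>\<theta>. cos \<theta> * logsin \<theta> \<partial>ang) = - pi"
proof -
  \<comment> \<open>Integration by parts suggests sin \<theta> ln (2 sin (\<theta>/2)) - (\<theta> +
    sin \<theta>) / 2. Writing sin \<theta> as cos (\<theta>/2) times 2 sin (\<theta>/2) exhibits
    the form s ln |s|, continuous at 0 and 2 pi. The value - pi comes from the term - \<theta> / 2
    alone.\<close>
  define G :: "real \<Rightarrow> real" where "G = (\<lambda>\<theta>. cos (\<theta> / 2) * ((2 * sin (\<theta> / 2)) * ln \<bar>2 * sin (\<theta> / 2)\<bar>) - (\<theta> + sin \<theta>) / 2)"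
  have "((\<lambda>\<theta>. cos \<theta> * logsin \<theta>) has_integral (G (2*pi) - G 0)) {0..2*pi}"
  proof (rule fundamental_theorem_of_calculus_interior)
    show "continuous_on {0..2*pi} G"
      unfolding G_def
      by (intro continuous_intros continuous_on_compose2[OF continuous_mult_ln_abs]) auto
    fix \<theta> :: real assume t: "\<theta> \<in> {0<..<2*pi}"
    then have s: "sin (\<theta> / 2) > 0" by (intro sin_gt_zero) auto
    have "((\<lambda>\<theta>. sin \<theta> * ln (2 * sin (\<theta> / 2)) - (\<theta> + sin \<theta>) / 2) has_real_derivative
       (cos \<theta> * ln (2 * sin (\<theta> / 2)) + sin \<theta> * (cos (\<theta> / 2) / (2 * sin (\<theta> / 2))) - (1 + cos \<theta>) / 2)) (at \<theta>)"
      using s by (auto intro!: derivative_eq_intros simp: field_simps)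
    moreover have "sin \<theta> = 2 * sin (\<theta> / 2) * cos (\<theta> / 2)" "cos \<theta> = 2 * (cos (\<theta> / 2))\<^sup>2 - 1"
      using sin_double[of "\<theta> / 2"] cos_double_cos[of "\<theta> / 2"] by simp_all
    then have "sin \<theta> * (cos (\<theta> / 2) / (2 * sin (\<theta> / 2))) - (1 + cos \<theta>) / 2 = 0"
      using s by (simp add: power2_eq_square)
    then have "cos \<theta> * ln (2 * sin (\<theta> / 2)) + sin \<theta> * (cos (\<theta> / 2) / (2 * sin (\<theta> / 2))) - (1 + cos \<theta>) / 2
       = cos \<theta> * logsin \<theta>"
      unfolding logsin_def using s by simp
    ultimately have "((\<lambda>\<theta>. sin \<theta> * ln (2 * sin (\<theta> / 2)) - (\<theta> + sin \<theta>) / 2) has_real_derivative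
       cos \<theta> * logsin \<theta>) (at \<theta>)"
      by (rule DERIV_cong)
    then have "(G has_real_derivative cos \<theta> * logsin \<theta>) (at \<theta>)"
    proof (rule DERIV_cong_ev[OF refl _ refl, THEN iffD1, rotated])
      have "eventually (\<lambda>\<theta>. \<theta> \<in> {0<..<2*pi}) (nhds \<theta>)" using t by (intro eventually_nhds_in_open) auto
      then show "\<forall>\<^sub>F \<theta> in nhds \<theta>. sin \<theta> * ln (2 * sin (\<theta> / 2)) - (\<theta> + sin \<theta>) / 2 = G \<theta>"
      proof eventually_elim
        case (elim \<theta>)
        then have "sin (\<theta> / 2) > 0" by (intro sin_gt_zero) auto
        then show ?case using sin_double[of "\<theta> / 2"] by (simp add: G_def)
      qed
    qed
    then show "(G has_vector_derivative cos \<theta> * logsin \<theta>) (at \<theta>)"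
      by (simp add: has_real_derivative_iff_has_vector_derivative)
  qed simp
  then have "integral {0..2*pi} (\<lambda>\<theta>. cos \<theta> * logsin \<theta>) = - pi"
    by (simp add: integral_unique G_def)
  moreover have "set_integrable lborel {0..2*pi} (\<lambda>\<theta>. cos \<theta> * logsin \<theta>)"
    using integrable_mult_bounded_trig[OF integrable_logsin, of cos] by (simp add: integral_icc(2))
  ultimately show ?thesis by (subst integral_icc_eq_integral) auto
qed

section \<open>Logarithmic integrals of cos (\<theta> - \<beta>) - c\<close>

lemma AE_sin_half_nonzero: "AE \<theta> in ang. sin ((\<theta> - \<gamma>) / 2) \<noteq> 0"
proof -
  have "AE \<theta> in lborel. \<forall>k::int. \<theta> \<noteq> \<gamma> + 2 * pi * of_int k"
    unfolding AE_all_countable by (auto intro: AE_lborel_singleton)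
  then have "AE \<theta> in lborel. sin ((\<theta> - \<gamma>) / 2) \<noteq> 0"
    by eventually_elim (auto simp: sin_zero_iff_int2 field_simps)
  then show ?thesis unfolding AE_icc by eventually_elim simp
qed

text \<open>The zeros of the left side are \<beta> - arccos c and \<beta> + arccos c modulo 2 pi.
  This factorisation splits the logarithm into two shifted copies of \<open>logsin\<close>.\<close>

lemma cos_diff_eq_sin_mult:
  fixes c :: real
  assumes "\<bar>c\<bar> \<le> 1"
  shows "cos (\<theta> - \<beta>) - c = 2 * sin ((\<theta> - (\<beta> - arccos c)) / 2) * - sin ((\<theta> - (\<beta> + arccos c)) / 2)"
proof -
  have "cos (\<theta> - \<beta>) - cos (arccos c)
     = 2 * sin ((\<theta> - (\<beta> - arccos c)) / 2) * - sin ((\<theta> - (\<beta> + arccos c)) / 2)"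
    unfolding cos_diff_cos sin_minus[symmetric] by (simp add: algebra_simps minus_divide_left)
  then show ?thesis using assms by (simp add: cos_arccos_abs)
qed

lemma ln_abs_cos_diff:
  assumes c: "\<bar>c\<bar> \<le> 1"
    and nz: "sin ((\<theta> - (\<beta> - arccos c)) / 2) \<noteq> 0" "sin ((\<theta> - (\<beta> + arccos c)) / 2) \<noteq> 0"
  shows "ln \<bar>cos (\<theta> - \<beta>) - c\<bar> = logsin (\<theta> - (\<beta> - arccos c)) + logsin (\<theta> - (\<beta> + arccos c)) - ln 2"
proof -
  have eq: "\<bar>cos (\<theta> - \<beta>) - c\<bar>
     = \<bar>2 * sin ((\<theta> - (\<beta> - arccos c)) / 2)\<bar> * \<bar>2 * sin ((\<theta> - (\<beta> + arccos c)) / 2)\<bar> / 2"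
    unfolding cos_diff_eq_sin_mult[OF c] by (simp add: abs_mult)
  have "\<bar>2 * sin ((\<theta> - (\<beta> - arccos c)) / 2)\<bar> > 0" "\<bar>2 * sin ((\<theta> - (\<beta> + arccos c)) / 2)\<bar> > 0"
    using nz by auto
  then show ?thesis
    unfolding eq logsin_def by (subst ln_div, simp, simp, subst ln_mult_pos) auto
qed

lemma measure_ang [simp]: "measure ang UNIV = 2 * pi"
proof -
  have "emeasure ang UNIV = (\<integral>\<^sup>+x. 1 \<partial>ang)" by simp
  also have "\<dots> = (\<integral>\<^sup>+x. indicator {0..2*pi} x \<partial>lborel)" by (subst nn_integral_icc) auto
  also have "\<dots> = ennreal (2 * pi)" by simp
  finally show ?thesis by (simp add: measure_def)
qed

lemma integrable_logsin_shift: "integrable ang (\<lambda>\<theta>. logsin (\<theta> - \<gamma>))"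
  by (rule integral_ang_shift) (auto simp: logsin_periodic integrable_logsin)

lemma log_cos_small:
  assumes c: "\<bar>c\<bar> \<le> 1"
  shows "integrable ang (\<lambda>\<theta>. ln \<bar>cos (\<theta> - \<beta>) - c\<bar>)"
    and "\<psi> \<in> borel_measurable borel \<Longrightarrow> (\<And>x. \<bar>\<psi> x\<bar> \<le> 1) \<Longrightarrow> (\<integral>\<theta>. \<psi> \<theta> * ln \<bar>cos (\<theta> - \<beta>) - c\<bar> \<partial>ang)
      = (\<integral>\<theta>. \<psi> \<theta> * logsin (\<theta> - (\<beta> - arccos c)) \<partial>ang) + (\<integral>\<theta>. \<psi> \<theta> * logsin (\<theta> - (\<beta> + arccos c)) \<partial>ang)
        - (\<integral>\<theta>. \<psi> \<theta> * ln 2 \<partial>ang)"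
proof -
  have ae: "AE \<theta> in ang. ln \<bar>cos (\<theta> - \<beta>) - c\<bar> = logsin (\<theta> - (\<beta> - arccos c)) + logsin (\<theta> - (\<beta> + arccos c)) - ln 2"
    using AE_sin_half_nonzero[of "\<beta> - arccos c"] AE_sin_half_nonzero[of "\<beta> + arccos c"]
    by eventually_elim (rule ln_abs_cos_diff[OF c])
  show "integrable ang (\<lambda>\<theta>. ln \<bar>cos (\<theta> - \<beta>) - c\<bar>)"
    by (subst integrable_cong_AE[OF _ _ ae])
      (auto intro!: Bochner_Integration.integrable_diff Bochner_Integration.integrable_add integrable_logsin_shift)
  assume [measurable]: "\<psi> \<in> borel_measurable borel" and b: "\<And>x. \<bar>\<psi> x\<bar> \<le> 1"
  have i: "integrable ang (\<lambda>\<theta>. \<psi> \<theta> * logsin (\<theta> - \<gamma>))" for \<gamma>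
    by (rule integrable_mult_bounded_trig[OF integrable_logsin_shift]) (auto simp: b)
  have i2: "integrable ang (\<lambda>\<theta>. \<psi> \<theta> * ln 2)"
    by (rule integrable_mult_bounded_trig) (auto simp: b)
  have "(\<integral>\<theta>. \<psi> \<theta> * ln \<bar>cos (\<theta> - \<beta>) - c\<bar> \<partial>ang)
     = (\<integral>\<theta>. \<psi> \<theta> * logsin (\<theta> - (\<beta> - arccos c)) + \<psi> \<theta> * logsin (\<theta> - (\<beta> + arccos c)) - \<psi> \<theta> * ln 2 \<partial>ang)"
    proof (rule integral_cong_AE)
    show "AE \<theta> in ang. \<psi> \<theta> * ln \<bar>cos (\<theta> - \<beta>) - c\<bar>
       = \<psi> \<theta> * logsin (\<theta> - (\<beta> - arccos c)) + \<psi> \<theta> * logsin (\<theta> - (\<beta> + arccos c)) - \<psi> \<theta> * ln 2"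
      using ae by eventually_elim (simp only: distrib_left right_diff_distrib)
  qed auto
  then show "(\<integral>\<theta>. \<psi> \<theta> * ln \<bar>cos (\<theta> - \<beta>) - c\<bar> \<partial>ang)
      = (\<integral>\<theta>. \<psi> \<theta> * logsin (\<theta> - (\<beta> - arccos c)) \<partial>ang) + (\<integral>\<theta>. \<psi> \<theta> * logsin (\<theta> - (\<beta> + arccos c)) \<partial>ang)
        - (\<integral>\<theta>. \<psi> \<theta> * ln 2 \<partial>ang)"
    using i i2 by (simp add: Bochner_Integration.integral_add Bochner_Integration.integral_diff)
qed

lemma integral_shift_logsin:
  assumes [measurable]: "\<psi> \<in> borel_measurable borel" and per: "\<And>x. \<psi> (x + 2 * pi) = \<psi> x" and b: "\<And>x. \<bar>\<psi> x\<bar> \<le> 1"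
  shows "(\<integral>\<theta>. \<psi> \<theta> * logsin (\<theta> - \<gamma>) \<partial>ang) = (\<integral>\<theta>. \<psi> (\<theta> + \<gamma>) * logsin \<theta> \<partial>ang)"
  using integral_ang_shift(2)[of "\<lambda>\<theta>. \<psi> (\<theta> + \<gamma>) * logsin \<theta>" \<gamma>] per[of "_ + \<gamma>"]
    integrable_mult_bounded_trig[OF integrable_logsin, of "\<lambda>\<theta>. \<psi> (\<theta> + \<gamma>)"]
  by (simp add: logsin_periodic b add.assoc add.commute[of \<gamma>])

lemma integral_cos_logsin_shift: "(\<integral>\<theta>. cos \<theta> * logsin (\<theta> - \<gamma>) \<partial>ang) = - pi * cos \<gamma>"
proof -
  have "(\<integral>\<theta>. cos \<theta> * logsin (\<theta> - \<gamma>) \<partial>ang) = (\<integral>\<theta>. cos (\<theta> + \<gamma>) * logsin \<theta> \<partial>ang)"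
    by (rule integral_shift_logsin) auto
  also have "\<dots> = (\<integral>\<theta>. cos \<gamma> * (cos \<theta> * logsin \<theta>) - sin \<gamma> * (sin \<theta> * logsin \<theta>) \<partial>ang)"
    by (simp add: cos_add algebra_simps)
  also have "\<dots> = cos \<gamma> * - pi - sin \<gamma> * 0"
    using integrable_mult_bounded_trig[OF integrable_logsin, of cos] integrable_mult_bounded_trig[OF integrable_logsin, of sin]
    by (subst Bochner_Integration.integral_diff) (simp_all add: integral_cos_logsin integral_sin_logsin)
  finally show ?thesis by simp
qed

lemma integral_sin_logsin_shift: "(\<integral>\<theta>. sin \<theta> * logsin (\<theta> - \<gamma>) \<partial>ang) = - pi * sin \<gamma>"
proof -
  have "(\<integral>\<theta>. sin \<theta> * logsin (\<theta> - \<gamma>) \<partial>ang) = (\<integral>\<theta>. sin (\<theta> + \<gamma>) * logsin \<theta> \<partial>ang)"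
    by (rule integral_shift_logsin) auto
  also have "\<dots> = (\<integral>\<theta>. cos \<gamma> * (sin \<theta> * logsin \<theta>) + sin \<gamma> * (cos \<theta> * logsin \<theta>) \<partial>ang)"
    by (simp add: sin_add algebra_simps)
  also have "\<dots> = cos \<gamma> * 0 + sin \<gamma> * - pi"
    using integrable_mult_bounded_trig[OF integrable_logsin, of cos] integrable_mult_bounded_trig[OF integrable_logsin, of sin]
    by (subst Bochner_Integration.integral_add) (simp_all add: integral_cos_logsin integral_sin_logsin)
  finally show ?thesis by simp
qed

lemma integral_ang_trig: "(\<integral>\<theta>. cos \<theta> * k \<partial>ang) = 0" "(\<integral>\<theta>. sin \<theta> * k \<partial>ang) = 0"
proof -
  have c: "(cos has_integral (sin (2*pi) - sin 0)) {0..2*pi}" "(sin has_integral (- cos (2*pi) - - cos 0)) {0..2*pi}"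
    by (rule fundamental_theorem_of_calculus; auto simp flip: has_real_derivative_iff_has_vector_derivative intro!: derivative_eq_intros)+
  have "set_integrable lborel {0..2*pi} cos" "set_integrable lborel {0..2*pi} sin"
    by (auto intro!: borel_integrable_atLeastAtMost' continuous_intros)
  then show "(\<integral>\<theta>. cos \<theta> * k \<partial>ang) = 0" "(\<integral>\<theta>. sin \<theta> * k \<partial>ang) = 0"
    using c by (simp_all add: integral_icc_eq_integral integral_unique)
qed

text \<open>With \<gamma> = arccos c, the two shifted copies of \<open>logsin\<close> contribute -
  pi cos (\<beta> - \<gamma>) and - pi cos (\<beta> + \<gamma>) for the weight cos. Their sum is - 2
  pi cos \<beta> cos \<gamma>, and cos \<gamma> = c is what makes it linear in c. The weight sin
  works alike; for the weight 1 a shift has no effect at all.\<close>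

lemma log_cos_values:
  assumes c: "\<bar>c\<bar> \<le> 1"
  shows "(\<integral>\<theta>. ln \<bar>cos (\<theta> - \<beta>) - c\<bar> \<partial>ang) = 2 * (\<integral>\<theta>. logsin \<theta> \<partial>ang) - 2 * pi * ln 2"
    and "(\<integral>\<theta>. cos \<theta> * ln \<bar>cos (\<theta> - \<beta>) - c\<bar> \<partial>ang) = - 2 * pi * cos \<beta> * c"
    and "(\<integral>\<theta>. sin \<theta> * ln \<bar>cos (\<theta> - \<beta>) - c\<bar> \<partial>ang) = - 2 * pi * sin \<beta> * c"
proof -
  have "(\<integral>\<theta>. logsin (\<theta> - \<gamma>) \<partial>ang) = (\<integral>\<theta>. logsin \<theta> \<partial>ang)" for \<gamma>
    using integral_shift_logsin[of "\<lambda>_. 1" \<gamma>] by simp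
  then show "(\<integral>\<theta>. ln \<bar>cos (\<theta> - \<beta>) - c\<bar> \<partial>ang) = 2 * (\<integral>\<theta>. logsin \<theta> \<partial>ang) - 2 * pi * ln 2"
    using log_cos_small(2)[OF c, of "\<lambda>_. 1" \<beta>] by simp
  show "(\<integral>\<theta>. cos \<theta> * ln \<bar>cos (\<theta> - \<beta>) - c\<bar> \<partial>ang) = - 2 * pi * cos \<beta> * c"
    using c unfolding log_cos_small(2)[OF c, of cos \<beta>, OF _ abs_cos_le_one, simplified] integral_cos_logsin_shift integral_ang_trig
    by (simp add: cos_add cos_diff cos_arccos_abs distrib_left right_diff_distrib integral_ang_trig[of 1, simplified])
  show "(\<integral>\<theta>. sin \<theta> * ln \<bar>cos (\<theta> - \<beta>) - c\<bar> \<partial>ang) = - 2 * pi * sin \<beta> * c"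
    using c unfolding log_cos_small(2)[OF c, of sin \<beta>, OF _ abs_sin_le_one, simplified] integral_sin_logsin_shift integral_ang_trig
    by (simp add: sin_add sin_diff cos_arccos_abs distrib_left right_diff_distrib integral_ang_trig[of 1, simplified])
qed

text \<open>Beyond the range of the cosine a bound replaces the exact formula. The number c is then
  separated from cos (\<theta> - \<beta>) by 1 or by - 1, so |cos (\<theta> - \<beta>) - c| is at
  least 1 - cos (\<theta> - \<beta>) or 1 + cos (\<theta> - \<beta>). Each of these is half of a
  square (2 sin (x / 2))^2, with x shifted by pi in the second case; hence the factors 2 before
  \<open>logsin\<close>.\<close>

lemma abs_ln_cos_large:
  assumes c: "1 \<le> \<bar>c\<bar>" and nz: "sin ((\<theta> - \<beta>) / 2) \<noteq> 0" "sin ((\<theta> - (\<beta> + pi)) / 2) \<noteq> 0"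
  shows "\<bar>ln \<bar>cos (\<theta> - \<beta>) - c\<bar>\<bar> \<le> 2 * \<bar>logsin (\<theta> - \<beta>)\<bar> + 2 * \<bar>logsin (\<theta> - (\<beta> + pi))\<bar> + (ln 2 + \<bar>c\<bar>)"
proof -
  have *: "1 - cos x = (2 * sin (x / 2))\<^sup>2 / 2" for x :: real
    using cos_double_sin[of "x / 2"] by (simp add: power2_eq_square)
  have m: "\<bar>ln (1 - cos x)\<bar> \<le> 2 * \<bar>logsin x\<bar> + ln 2" if "sin (x / 2) \<noteq> 0" for x
  proof -
    have "ln (1 - cos x) = 2 * logsin x - ln 2"
    proof -
      have P: "ln (P * P / 2) = 2 * ln P - ln 2" if "P > 0" for P :: real
        using that by (simp add: ln_div ln_mult_pos)
      have "(2 * sin (x / 2))\<^sup>2 = \<bar>2 * sin (x / 2)\<bar> * \<bar>2 * sin (x / 2)\<bar>"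
        by (simp only: power2_eq_square flip: abs_mult) simp
      moreover have "\<bar>2 * sin (x / 2)\<bar> > 0" using that by simp
      ultimately show ?thesis
        unfolding * logsin_def using P by metis
    qed
    moreover have "ln 2 \<ge> (0::real)" by simp
    ultimately show ?thesis by linarith
  qed
  have p: "1 + cos (\<theta> - \<beta>) = 1 - cos (\<theta> - (\<beta> + pi))"
    by (simp add: cos_diff cos_add sin_add)
  have up: "ln (1 + \<bar>c\<bar>) \<le> \<bar>c\<bar>" using ln_add_one_self_le_self[of "\<bar>c\<bar>"] by simp
  have pos: "1 - cos (\<theta> - \<beta>) > 0" "1 - cos (\<theta> - (\<beta> + pi)) > 0" unfolding * using nz by auto
  define D where "D = \<bar>cos (\<theta> - \<beta>) - c\<bar>"
  have D: "D \<le> 1 + \<bar>c\<bar>" unfolding D_def using abs_cos_le_one[of "\<theta> - \<beta>"] by linarith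
  have cases: "1 - cos (\<theta> - \<beta>) \<le> D \<or> 1 - cos (\<theta> - (\<beta> + pi)) \<le> D"
    unfolding D_def p[symmetric] using c by linarith
  have Dpos: "D > 0" using cases pos by linarith
  have 1: "ln D \<le> \<bar>c\<bar>" using D Dpos up ln_le_cancel_iff[of D "1 + \<bar>c\<bar>"] by linarith
  have "ln (1 - cos (\<theta> - \<beta>)) \<le> ln D \<or> ln (1 - cos (\<theta> - (\<beta> + pi))) \<le> ln D"
    using cases pos Dpos by auto
  then have 2: "- ln D \<le> 2 * \<bar>logsin (\<theta> - \<beta>)\<bar> + 2 * \<bar>logsin (\<theta> - (\<beta> + pi))\<bar> + ln 2"
    using m[OF nz(1)] m[OF nz(2)] by linarith
  have "ln 2 \<ge> (0::real)" by simp
  with 1 2 show ?thesis unfolding D_def[symmetric] by linarith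
qed

lemma log_cos_large:
  assumes c: "1 \<le> \<bar>c\<bar>"
  shows "integrable ang (\<lambda>\<theta>. ln \<bar>cos (\<theta> - \<beta>) - c\<bar>)"
    and "(\<integral>\<theta>. \<bar>ln \<bar>cos (\<theta> - \<beta>) - c\<bar>\<bar> \<partial>ang) \<le> 4 * (\<integral>\<theta>. \<bar>logsin \<theta>\<bar> \<partial>ang) + 2 * pi * (ln 2 + \<bar>c\<bar>)"
proof -
  let ?B = "\<lambda>\<theta>. 2 * \<bar>logsin (\<theta> - \<beta>)\<bar> + 2 * \<bar>logsin (\<theta> - (\<beta> + pi))\<bar> + (ln 2 + \<bar>c\<bar>)"
  have ae: "AE \<theta> in ang. \<bar>ln \<bar>cos (\<theta> - \<beta>) - c\<bar>\<bar> \<le> ?B \<theta>"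
    using AE_sin_half_nonzero[of "\<beta>"] AE_sin_half_nonzero[of "\<beta> + pi"]
    by eventually_elim (rule abs_ln_cos_large[OF c])
  have il: "integrable ang (\<lambda>\<theta>. \<bar>logsin (\<theta> - \<gamma>)\<bar>)" for \<gamma>
    using integrable_logsin_shift by (intro integrable_abs)
  have iB: "integrable ang ?B"
    using il by (intro Bochner_Integration.integrable_add integrable_mult_right) auto
  have ln2: "0 \<le> ln (2::real)" by simp
  have L: "(\<integral>\<theta>. \<bar>logsin (\<theta> - \<gamma>)\<bar> \<partial>ang) = (\<integral>\<theta>. \<bar>logsin \<theta>\<bar> \<partial>ang)" for \<gamma>
    by (rule integral_ang_shift(2)) (auto simp: logsin_periodic integrable_logsin)
  show i: "integrable ang (\<lambda>\<theta>. ln \<bar>cos (\<theta> - \<beta>) - c\<bar>)"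
  proof (rule Bochner_Integration.integrable_bound[OF iB])
    show "AE \<theta> in ang. norm (ln \<bar>cos (\<theta> - \<beta>) - c\<bar>) \<le> norm (?B \<theta>)"
      using ae by eventually_elim (use ln2 in auto)
  qed simp
  have "(\<integral>\<theta>. \<bar>ln \<bar>cos (\<theta> - \<beta>) - c\<bar>\<bar> \<partial>ang) \<le> (\<integral>\<theta>. ?B \<theta> \<partial>ang)"
    using i by (intro integral_mono_AE iB ae integrable_abs)
  also have "\<dots> = 2 * (\<integral>\<theta>. \<bar>logsin (\<theta> - \<beta>)\<bar> \<partial>ang) + 2 * (\<integral>\<theta>. \<bar>logsin (\<theta> - (\<beta> + pi))\<bar> \<partial>ang) + 2 * pi * (ln 2 + \<bar>c\<bar>)"
    using il by (simp add: Bochner_Integration.integral_add)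
  finally show "(\<integral>\<theta>. \<bar>ln \<bar>cos (\<theta> - \<beta>) - c\<bar>\<bar> \<partial>ang) \<le> 4 * (\<integral>\<theta>. \<bar>logsin \<theta>\<bar> \<partial>ang) + 2 * pi * (ln 2 + \<bar>c\<bar>)"
    unfolding L by simp
qed

lemma integrable_log_cos: "integrable ang (\<lambda>\<theta>. ln \<bar>cos (\<theta> - \<beta>) - c\<bar>)"
  using log_cos_small(1)[of c \<beta>] log_cos_large(1)[of c \<beta>] by (cases "\<bar>c\<bar> \<le> 1") auto

section \<open>The primitive of the Abel kernel\<close>

text \<open>The source of the logarithmic potential. The kernel is positive beyond the threshold
  \<open>d\<close>, which is 0 for c > 0 and sqrt (- c) for c < 0. In both cases the primitive ln (v
  + sqrt (v^2 + c)) takes the value ln |c| / 2 at \<open>d\<close>. The hypothesis on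
  \<open>V\<close> puts the cutoff beyond the threshold.\<close>

lemma integral_abel_kernel:
  assumes c: "c \<noteq> 0" and V: "V > 0" "V\<^sup>2 + c > 0"
  shows "(\<integral>v. abel_kernel (v\<^sup>2 + c) \<partial>icc 0 V) = ln (V + sqrt (V\<^sup>2 + c)) - ln \<bar>c\<bar> / 2"
proof -
  define d where "d = sqrt (max 0 (- c))"
  define F where "F = (\<lambda>v. ln (v + sqrt (v\<^sup>2 + c)))"
  have d: "d \<ge> 0" "d\<^sup>2 = max 0 (- c)" by (auto simp: d_def)
  have dV: "d < V"
  proof (rule power2_less_imp_less)
    show "d\<^sup>2 < V\<^sup>2" using V c unfolding d(2) by (auto simp: max_def)
  qed (use V in auto)
  have dc: "d\<^sup>2 + c \<ge> 0" "d + sqrt (d\<^sup>2 + c) > 0"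
  proof -
    show "d\<^sup>2 + c \<ge> 0" unfolding d(2) by auto
    show "d + sqrt (d\<^sup>2 + c) > 0"
    proof (cases "c > 0")
      case True
      then show ?thesis using d by (intro add_nonneg_pos) (auto intro: add_nonneg_pos)
    next
      case False
      then have "d > 0" using c by (simp add: d_def)
      then show ?thesis using \<open>d\<^sup>2 + c \<ge> 0\<close> by (simp add: add_pos_nonneg)
    qed
  qed
  have pos: "v\<^sup>2 + c > 0" if "d < v" for v
  proof -
    have "d\<^sup>2 < v\<^sup>2" using that d(1) by (intro power_strict_mono) auto
    then show ?thesis using dc(1) by linarith
  qed
  have D: "(F has_real_derivative 1 / sqrt (v\<^sup>2 + c)) (at v)" if "d < v" for v
  proof -
    have p: "v\<^sup>2 + c > 0" by (rule pos[OF that])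
    have p2: "v + sqrt (v\<^sup>2 + c) > 0" using p that d(1) by (intro add_pos_pos) auto
    have "(F has_real_derivative (1 + 2 * v / (2 * sqrt (v\<^sup>2 + c))) / (v + sqrt (v\<^sup>2 + c))) (at v)"
    proof -
      have S: "((\<lambda>v. v + sqrt (v\<^sup>2 + c)) has_real_derivative 1 + 2 * v / (2 * sqrt (v\<^sup>2 + c))) (at v)"
        using p by (auto intro!: derivative_eq_intros simp: field_simps)
      show ?thesis unfolding F_def using DERIV_chain2[OF DERIV_ln_divide[OF p2] S] by simp
    qed
    also have "(1 + 2 * v / (2 * sqrt (v\<^sup>2 + c))) / (v + sqrt (v\<^sup>2 + c)) = 1 / sqrt (v\<^sup>2 + c)"
    proof -
      have "1 + 2 * v / (2 * sqrt (v\<^sup>2 + c)) = (v + sqrt (v\<^sup>2 + c)) / sqrt (v\<^sup>2 + c)"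
        using p by (simp add: field_simps)
      then show ?thesis using p2 by simp
    qed
    finally show ?thesis .
  qed
  have contF: "isCont F d" "isCont F V"
    unfolding F_def using dc V by (auto intro!: continuous_intros simp: add_pos_pos less_imp_neq[symmetric] intro: add_pos_pos)
  note FTC = interval_integral_FTC_nonneg[of "ereal d" "ereal V" F "\<lambda>v. 1 / sqrt (v\<^sup>2 + c)" "F d" "F V"]
  have "(LBINT v=ereal d..ereal V. 1 / sqrt (v\<^sup>2 + c)) = F V - F d"
  proof (rule FTC(2))
    show "isCont (\<lambda>v. 1 / sqrt (v\<^sup>2 + c)) v" if "ereal d < ereal v" for v
      using pos[of v] that by (auto intro!: continuous_intros)
    show "AE v in lborel. ereal d < ereal v \<longrightarrow> ereal v < ereal V \<longrightarrow> 0 \<le> 1 / sqrt (v\<^sup>2 + c)"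
      using pos by (auto intro!: AE_I2 simp: less_imp_le)
    show "((F \<circ> real_of_ereal) \<longlongrightarrow> F d) (at_right (ereal d))"
      unfolding ereal_tendsto_simps using contF(1) by (auto simp: isCont_def intro: tendsto_within_subset)
    show "((F \<circ> real_of_ereal) \<longlongrightarrow> F V) (at_left (ereal V))"
      unfolding ereal_tendsto_simps using contF(2) by (auto simp: isCont_def intro: tendsto_within_subset)
  qed (use dV D in auto)
  also have "(LBINT v=ereal d..ereal V. 1 / sqrt (v\<^sup>2 + c)) = (\<integral>v. abel_kernel (v\<^sup>2 + c) \<partial>icc 0 V)"
  proof -
    have "(\<integral>v. abel_kernel (v\<^sup>2 + c) \<partial>icc 0 V) = (LINT v:{0..V}|lborel. abel_kernel (v\<^sup>2 + c))"
      by (rule integral_icc) simp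
    also have "\<dots> = (LINT v:{d<..<V}|lborel. 1 / sqrt (v\<^sup>2 + c))"
      unfolding set_lebesgue_integral_def
    proof (rule integral_cong_AE)
      have "AE x in lborel. x \<noteq> d" "AE x in lborel. x \<noteq> V"
        by (rule AE_lborel_singleton)+
      then show "AE v in lborel. indicat_real {0..V} v *\<^sub>R abel_kernel (v\<^sup>2 + c) = indicat_real {d<..<V} v *\<^sub>R (1 / sqrt (v\<^sup>2 + c))"
      proof eventually_elim
        case (elim v)
        show ?case
        proof (cases "v \<in> {d<..<V}")
          case True
          then show ?thesis using pos[of v] d(1) by (auto simp: abel_kernel_def)
        next
          case False
          have "abel_kernel (v\<^sup>2 + c) = 0" if "0 \<le> v" "v \<le> V"
          proof -
            have "v < d" using False elim that by auto
            then have "v\<^sup>2 < d\<^sup>2" using that by (intro power_strict_mono) auto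
            then show ?thesis unfolding d(2) abel_kernel_def by (auto simp: max_def split: if_splits)
          qed
          then show ?thesis using False by (auto simp: indicator_def)
        qed
      qed
    qed auto
    finally show ?thesis using dV by (simp add: interval_integral_Ioo)
  qed
  also have "F d = ln \<bar>c\<bar> / 2"
  proof (cases "c > 0")
    case True
    then have "d = 0" by (simp add: d_def)
    then show ?thesis using True by (simp add: F_def ln_sqrt)
  next
    case False
    then have "d\<^sup>2 + c = 0" "d = sqrt \<bar>c\<bar>" using c by (auto simp: d_def)
    then show ?thesis using c by (simp add: F_def ln_sqrt)
  qed
  finally show ?thesis by (simp add: F_def)
qed

lemma AE_cos_ne: "AE \<theta> in ang. cos (\<theta> - \<beta>) \<noteq> c"
proof (cases "\<bar>c\<bar> \<le> 1")
  case True
  have ne: "cos (\<theta> - \<beta>) \<noteq> c"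
    if "sin ((\<theta> - (\<beta> - arccos c)) / 2) \<noteq> 0" "sin ((\<theta> - (\<beta> + arccos c)) / 2) \<noteq> 0" for \<theta>
    using cos_diff_eq_sin_mult[OF True, of \<theta> \<beta>] that by auto
  show ?thesis
    using AE_sin_half_nonzero[of "\<beta> - arccos c"] AE_sin_half_nonzero[of "\<beta> + arccos c"]
    by eventually_elim (rule ne)
next
  case False
  then have "cos (\<theta> - \<beta>) \<noteq> c" for \<theta> using abs_cos_le_one[of "\<theta> - \<beta>"] by auto
  then show ?thesis by simp
qed

section \<open>Polar coordinates about a point, for signed integrands\<close>

interpretation icc_lborel: pair_sigma_finite "icc a b" lborel ..

lemma pair_icc_density:
  "icc a b \<Otimes>\<^sub>M icc c d = density (icc a b \<Otimes>\<^sub>M lborel) (\<lambda>q. ennreal (indicator {c..d} (snd q)))"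
proof -
  have "icc a b \<Otimes>\<^sub>M icc c d = density (icc a b) (\<lambda>_. 1) \<Otimes>\<^sub>M density lborel (indicator {c..d})"
    by (simp add: density_1 icc_def)
  also have "\<dots> = density (icc a b \<Otimes>\<^sub>M lborel) (\<lambda>(x, y). 1 * indicator {c..d} y)"
    by (rule pair_measure_density) (auto simp flip: icc_def intro: sigma_finite_lborel icc.sigma_finite_measure_axioms)
  also have "(\<lambda>(x :: real, y). 1 * indicator {c..d} y) = (\<lambda>q. ennreal (indicator {c..d} (snd q)))"
    by (auto simp: fun_eq_iff indicator_def)
  finally show ?thesis .
qed

lemma integral_pair_icc:
  fixes F :: "real \<times> real \<Rightarrow> real"
  assumes [measurable]: "F \<in> borel_measurable (borel \<Otimes>\<^sub>M borel)"
  shows "(\<integral>q. F q \<partial>(icc a b \<Otimes>\<^sub>M icc c d)) = (\<integral>q. indicator {c..d} (snd q) * F q \<partial>(icc a b \<Otimes>\<^sub>M lborel))"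
proof -
  have "sets (icc a b \<Otimes>\<^sub>M lborel) = sets (borel \<Otimes>\<^sub>M borel)" by (intro sets_pair_measure_cong) auto
  note [measurable_cong] = this
  show ?thesis unfolding pair_icc_density by (subst integral_density) auto
qed

text \<open>The radius runs over the whole line and \<open>max 0\<close> in the density discards its
  negative values, so the radial factor of the product measure is plain
  \<open>lborel\<close>.\<close>

lemma lborel_polar:
  fixes x :: "real^2"
  shows "lborel = distr (density (ang \<Otimes>\<^sub>M lborel) (\<lambda>q. ennreal (max 0 (snd q)))) borel (\<lambda>q. x + snd q *\<^sub>R dir (fst q))"
    (is "_ = distr (density ?M ?k) borel ?T")
proof (rule measure_eqI)
  have s: "sets ?M = sets (borel \<Otimes>\<^sub>M borel)" by (intro sets_pair_measure_cong) auto
  note [measurable_cong] = s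
  fix A :: "(real^2) set" assume "A \<in> sets lborel"
  then have [measurable]: "A \<in> sets borel" by simp
  have T[measurable]: "?T \<in> borel_measurable ?M" by measurable
  have TA: "?T -` A \<inter> space ?M \<in> sets ?M"
    by (rule measurable_sets[OF T]) auto
  have "emeasure lborel A = (\<integral>\<^sup>+w. indicator A w \<partial>lborel)" by simp
  also have "\<dots> = (\<integral>\<^sup>+w. indicator A (x + w) \<partial>lborel)"
    by (subst lborel_distr_plus[of x, symmetric], subst nn_integral_distr) auto
  also have "\<dots> = (\<integral>\<^sup>+\<theta>. \<integral>\<^sup>+r. ennreal r * indicator A (x + r *\<^sub>R dir \<theta>) * indicator {0..2*pi} \<theta> \<partial>lborel \<partial>lborel)"
    by (rule nn_integral_polar) simp
  also have "\<dots> = (\<integral>\<^sup>+\<theta>. (\<integral>\<^sup>+r. ?k (\<theta>, r) * indicator A (?T (\<theta>, r)) \<partial>lborel) * indicator {0..2*pi} \<theta> \<partial>lborel)"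
    by (auto simp: nn_integral_multc[symmetric] max_def ennreal_neg intro!: nn_integral_cong)
  also have "\<dots> = (\<integral>\<^sup>+\<theta>. \<integral>\<^sup>+r. ?k (\<theta>, r) * indicator A (?T (\<theta>, r)) \<partial>lborel \<partial>ang)"
    by (subst nn_integral_icc) auto
  also have "\<dots> = (\<integral>\<^sup>+q. ?k q * indicator A (?T q) \<partial>?M)"
    by (rule lborel.nn_integral_fst) measurable
  also have "\<dots> = emeasure (distr (density ?M ?k) borel ?T) A"
    using TA by (subst emeasure_distr) (auto simp: emeasure_density space_pair_measure indicator_def intro!: nn_integral_cong)
  finally show "emeasure lborel A = emeasure (distr (density ?M ?k) borel ?T) A" .
qed simp

lemma integral_polar:
  fixes F :: "real^2 \<Rightarrow> real"
  assumes [measurable]: "F \<in> borel_measurable borel"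
  shows "(\<integral>w. F w \<partial>lborel) = (\<integral>q. max 0 (snd q) * F (x + snd q *\<^sub>R dir (fst q)) \<partial>(ang \<Otimes>\<^sub>M lborel))"
proof -
  have s: "sets (ang \<Otimes>\<^sub>M lborel) = sets (borel \<Otimes>\<^sub>M borel)" by (intro sets_pair_measure_cong) auto
  note [measurable_cong] = s
  show ?thesis
    by (subst lborel_polar[of x], subst integral_distr, simp, simp, subst integral_density) auto
qed

section \<open>Averages over the circle\<close>

lemma dir_inner: "dir \<alpha> \<bullet> dir \<beta> = cos (\<alpha> - \<beta>)"
  by (simp add: inner_vec2 cos_diff)

lemma polar_repr:
  assumes "(w :: real^2) \<noteq> 0"
  obtains \<kappa> \<beta> where "\<kappa> > 0" "w = \<kappa> *\<^sub>R dir \<beta>"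
proof -
  have n: "norm w > 0" using assms by simp
  have eq: "(norm w)\<^sup>2 = (w $ 1)\<^sup>2 + (w $ 2)\<^sup>2" by (simp add: norm_vec2)
  have "(w $ 1 / norm w)\<^sup>2 + (w $ 2 / norm w)\<^sup>2 = ((w $ 1)\<^sup>2 + (w $ 2)\<^sup>2) / (norm w)\<^sup>2"
    by (simp only: power_divide add_divide_distrib)
  also have "\<dots> = 1" unfolding eq[symmetric] using n by simp
  finally obtain \<beta> where b: "w $ 1 / norm w = cos \<beta>" "w $ 2 / norm w = sin \<beta>"
    by (rule sincos_total_2pi)
  have "w = norm w *\<^sub>R dir \<beta>"
    unfolding vec_eq_iff forall_2 vector_scaleR_component dir_nth b[symmetric] using n by simp
  with n that show thesis by blast
qed

locale ball_data =
  fixes z x :: "real^2" and \<rho> :: real and g g1 g2 :: "real^2 \<Rightarrow> real"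
  assumes rho: "\<rho> > 0" and x: "norm (x - z) < \<rho>"
    and grad: "grad2 g g1 g2" and cont_g1: "continuous_on UNIV g1" and cont_g2: "continuous_on UNIV g2"
    and vanish: "\<And>w. w \<notin> ball z \<rho> \<Longrightarrow> g w = 0" "\<And>w. w \<notin> ball z \<rho> \<Longrightarrow> g1 w = 0" "\<And>w. w \<notin> ball z \<rho> \<Longrightarrow> g2 w = 0"
begin

lemma cont_g: "continuous_on UNIV g"
  using grad by (rule grad2_continuous)

lemma borel_g [measurable]: "g \<in> borel_measurable borel"
  using cont_g by (rule borel_measurable_continuous_onI)

definition y :: "real \<Rightarrow> real^2" where "y \<alpha> = z + \<rho> *\<^sub>R dir \<alpha>"

definition p :: "real \<Rightarrow> real" where "p \<alpha> = (norm (x - y \<alpha>))\<^sup>2"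

text \<open>At time t = sqrt (p + h + v^2) the argument t^2 - |w - y|^2 of the kernel equals v^2 +
  c, so this is the number that \<open>integral_abel_kernel\<close> puts under the
  logarithm.\<close>

definition c :: "real \<Rightarrow> real^2 \<Rightarrow> real \<Rightarrow> real" where
  "c \<alpha> w h = p \<alpha> + h - (norm (w - y \<alpha>))\<^sup>2"

text \<open>The squared distance from x to the circle.\<close>

definition p0 :: real where "p0 = (\<rho> - norm (x - z))\<^sup>2"

text \<open>
  For \<open>w = x + \<kappa> dir \<beta>\<close>, the points of the circle at which \<open>c \<alpha> w 0\<close> vanishes are given by
  \<open>cos (\<alpha> - \<beta>) = C0 \<beta> \<kappa>\<close>.
\<close>
definition C0 :: "real \<Rightarrow> real \<Rightarrow> real" where
  "C0 \<beta> \<kappa> = (\<kappa> + 2 * (dir \<beta> \<bullet> (x - z))) / (2 * \<rho>)"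

text \<open>The margin left by \<open>C0_bound\<close>, since (\<rho> + |x - z|) / (2 \<rho>) = 1 -
  \<delta>: a level \<open>C0\<close> can be lowered by up to \<delta> without leaving
  [- 1, 1].\<close>

definition \<delta> :: real where "\<delta> = (\<rho> - norm (x - z)) / (2 * \<rho>)"

lemma delta_pos: "\<delta> > 0"
  using x rho by (simp add: \<delta>_def)

lemma continuous_y [continuous_intros]: "continuous_on S h \<Longrightarrow> continuous_on S (\<lambda>s. y (h s))"
  unfolding y_def by (intro continuous_intros)

lemma continuous_p [continuous_intros]: "continuous_on S h \<Longrightarrow> continuous_on S (\<lambda>s. p (h s))"
  unfolding p_def by (intro continuous_intros)

lemma borel_y [measurable]: "y \<in> borel_measurable borel"
  by (intro borel_measurable_continuous_onI continuous_intros)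

lemma borel_p [measurable]: "p \<in> borel_measurable borel"
  by (intro borel_measurable_continuous_onI continuous_intros)

lemma borel_c [measurable]:
  assumes [measurable]: "f \<in> borel_measurable M" "k \<in> borel_measurable M"
  shows "(\<lambda>s. c (f s) (k s) h) \<in> borel_measurable M"
  unfolding c_def by measurable

lemma norm_y: "norm (y \<alpha> - z) = \<rho>"
  using rho by (simp add: y_def)

lemma p0_pos: "p0 > 0"
  using x by (simp add: p0_def)

lemma p_ge: "p \<alpha> \<ge> p0"
proof -
  have "\<rho> - norm (x - z) \<le> norm (x - y \<alpha>)"
    using norm_triangle_ineq2[of "y \<alpha> - z" "x - z"] norm_y[of \<alpha>] by (simp add: norm_minus_commute)
  then show ?thesis using x by (auto simp: p_def p0_def intro: power_mono)
qed

lemma c_polar: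
  assumes k: "\<kappa> > 0"
  shows "c \<alpha> (x + \<kappa> *\<^sub>R dir \<beta>) h = 2 * \<kappa> * \<rho> * (cos (\<alpha> - \<beta>) - (C0 \<beta> \<kappa> - h / (2 * \<kappa> * \<rho>)))"
proof -
  have "x + \<kappa> *\<^sub>R dir \<beta> - y \<alpha> = (x - y \<alpha>) + \<kappa> *\<^sub>R dir \<beta>" by simp
  then have A: "(norm (x + \<kappa> *\<^sub>R dir \<beta> - y \<alpha>))\<^sup>2 = p \<alpha> + 2 * \<kappa> * (dir \<beta> \<bullet> (x - y \<alpha>)) + \<kappa>\<^sup>2"
    by (simp only: power2_norm_eq_inner p_def inner_add_left inner_add_right inner_scaleR_left inner_scaleR_right
        inner_commute[of "x - y \<alpha>" "dir \<beta>"]) (simp add: dir_inner power2_eq_square algebra_simps)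
  have B: "dir \<beta> \<bullet> (x - y \<alpha>) = dir \<beta> \<bullet> (x - z) - \<rho> * cos (\<alpha> - \<beta>)"
    by (simp add: y_def inner_diff_right inner_add_right dir_inner cos_diff mult.commute)
  have D: "2 * \<kappa> * \<rho> * C0 \<beta> \<kappa> = \<kappa> * (\<kappa> + 2 * (dir \<beta> \<bullet> (x - z)))"
    using rho by (simp add: C0_def)
  have E: "2 * \<kappa> * \<rho> * (h / (2 * \<kappa> * \<rho>)) = h" using k rho by simp
  show ?thesis
    unfolding c_def right_diff_distrib D E A B by (simp add: algebra_simps power2_eq_square)
qed

text \<open>If m is the midpoint of x and w, then \<open>C0\<close> is the inner product of dir
  \<beta> with (m - z) / \<rho>. Its modulus is at most |m - z| / \<rho>, and m is strictly inside
  the circle, by a margin that does not depend on w because x is fixed.\<close>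

lemma C0_bound:
  assumes k: "\<kappa> > 0" and w: "x + \<kappa> *\<^sub>R dir \<beta> \<in> ball z \<rho>"
  shows "\<bar>C0 \<beta> \<kappa>\<bar> \<le> 1 - \<delta>"
proof -
  have "\<kappa> + 2 * (dir \<beta> \<bullet> (x - z)) = dir \<beta> \<bullet> ((x + \<kappa> *\<^sub>R dir \<beta> - z) + (x - z))"
  proof -
    have "(x + \<kappa> *\<^sub>R dir \<beta> - z) + (x - z) = \<kappa> *\<^sub>R dir \<beta> + 2 *\<^sub>R (x - z)"
      by (simp add: scaleR_2)
    then show ?thesis by (simp only: inner_add_right inner_scaleR_right) (simp add: dir_inner)
  qed
  then have "\<bar>\<kappa> + 2 * (dir \<beta> \<bullet> (x - z))\<bar> \<le> norm ((x + \<kappa> *\<^sub>R dir \<beta> - z) + (x - z))"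
    using Cauchy_Schwarz_ineq2[of "dir \<beta>" "(x + \<kappa> *\<^sub>R dir \<beta> - z) + (x - z)"] by simp
  also have "\<dots> \<le> norm (x + \<kappa> *\<^sub>R dir \<beta> - z) + norm (x - z)"
    by (rule norm_triangle_ineq)
  also have "\<dots> \<le> \<rho> + norm (x - z)"
    using w by (simp add: dist_norm norm_minus_commute)
  finally show ?thesis
    using rho by (simp add: C0_def \<delta>_def field_simps abs_divide)
qed

lemma kappa_bound:
  assumes k: "\<kappa> > 0" and w: "x + \<kappa> *\<^sub>R dir \<beta> \<in> ball z \<rho>"
  shows "\<kappa> \<le> 2 * \<rho>"
proof -
  have "\<kappa> = norm ((x + \<kappa> *\<^sub>R dir \<beta> - z) - (x - z))" using k by simp
  also have "\<dots> \<le> norm (x + \<kappa> *\<^sub>R dir \<beta> - z) + norm (x - z)" by (rule norm_triangle_ineq4)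
  also have "\<dots> \<le> 2 * \<rho>" using w x by (simp add: dist_norm norm_minus_commute)
  finally show ?thesis .
qed

lemma c_lower:
  assumes w: "w \<in> ball z \<rho>" and h: "h \<ge> 0"
  shows "c \<alpha> w h \<ge> - 4 * \<rho>\<^sup>2"
proof -
  have "norm (w - y \<alpha>) \<le> norm (w - z) + norm (y \<alpha> - z)"
    using norm_triangle_ineq4[of "w - z" "y \<alpha> - z"] by simp
  also have "\<dots> \<le> 2 * \<rho>" using w norm_y by (simp add: dist_norm norm_minus_commute)
  finally have "(norm (w - y \<alpha>))\<^sup>2 \<le> (2 * \<rho>)\<^sup>2" by (intro power_mono) auto
  then show ?thesis using h p_ge[of \<alpha>] p0_pos by (simp add: c_def power_mult_distrib)
qed

lemma AE_c_nonzero: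
  assumes "w \<noteq> x"
  shows "AE \<alpha> in ang. c \<alpha> w h \<noteq> 0"
proof -
  obtain \<kappa> \<beta> where k: "\<kappa> > 0" "w - x = \<kappa> *\<^sub>R dir \<beta>"
    using polar_repr[of "w - x"] assms by auto
  then have w: "w = x + \<kappa> *\<^sub>R dir \<beta>" by (simp add: algebra_simps)
  show ?thesis using AE_cos_ne[of \<beta> "C0 \<beta> \<kappa> - h / (2 * \<kappa> * \<rho>)"]
    by eventually_elim (use k(1) rho in \<open>simp add: w c_polar\<close>)
qed

text \<open>The bracket is the integral of the kernel over v in [0, V], from
  \<open>integral_abel_kernel\<close>; \<open>Lam\<close> is its weighted integral over the
  circle.\<close>

definition Lam :: "(real \<Rightarrow> real) \<Rightarrow> real \<Rightarrow> real \<Rightarrow> real^2 \<Rightarrow> real" where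
  "Lam \<psi> V h w = (\<integral>\<alpha>. \<psi> \<alpha> * (ln (V + sqrt (V\<^sup>2 + c \<alpha> w h)) - ln \<bar>c \<alpha> w h\<bar> / 2) \<partial>ang)"

text \<open>Fubini brings the integrals over the circle and over v inside the one over the plane,
  where the v-integral is explicit. Absolute integrability follows from the same potential formed
  with |g|. As c is at least - 4 \<rho>^2 on the ball, the condition on V^2 places the cutoff beyond
  all thresholds.\<close>

lemma potential_average:
  assumes psi: "continuous_on UNIV \<psi>" and h: "h \<ge> 0" and V: "V > 0" "V\<^sup>2 > 4 * \<rho>\<^sup>2"
  shows "integrable lborel (\<lambda>w. g w * Lam \<psi> V h w)"
    and "(\<integral>q. \<psi> (fst q) * poisson_pot g (y (fst q)) (sqrt (p (fst q) + h + (snd q)\<^sup>2)) \<partial>(ang \<Otimes>\<^sub>M icc 0 V))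
      = 1 / (2 * pi) * (\<integral>w. g w * Lam \<psi> V h w \<partial>lborel)"
proof -
  have [measurable]: "\<psi> \<in> borel_measurable borel" using psi by (rule borel_measurable_continuous_onI)
  interpret P: pair_sigma_finite "ang \<Otimes>\<^sub>M icc 0 V" "lborel :: (real^2) measure" ..
  have s: "sets (ang \<Otimes>\<^sub>M icc 0 V) = sets (borel \<Otimes>\<^sub>M borel)" by (intro sets_pair_measure_cong) auto
  note [measurable_cong] = s
  define S where "S = (\<lambda>q. p (fst q) + h + (snd q)\<^sup>2)"
  have [measurable]: "S \<in> borel_measurable (borel \<Otimes>\<^sub>M borel)" unfolding S_def by measurable
  have Spos: "S q > 0" for q using p_ge[of "fst q"] p0_pos h by (simp add: S_def add_pos_nonneg)
  define F where "F = (\<lambda>q w. \<psi> (fst q) * (g w * abel_kernel (S q - (norm (w - y (fst q)))\<^sup>2)))"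
  have [measurable]: "(\<lambda>(q, w). F q w) \<in> borel_measurable ((ang \<Otimes>\<^sub>M icc 0 V) \<Otimes>\<^sub>M lborel)"
    unfolding F_def by measurable
  have cont_abs: "continuous_on UNIV (\<lambda>w. \<bar>g w\<bar>)" by (intro continuous_intros cont_g)
  have pe: "integrable lborel (\<lambda>w. k w * abel_kernel (S q - (norm (w - y'))\<^sup>2))"
    "(\<integral>w. k w * abel_kernel (S q - (norm (w - y'))\<^sup>2) \<partial>lborel) = 2 * pi * poisson_pot k y' (sqrt (S q))"
    if "continuous_on UNIV k" for k q and y' :: "real^2"
    using poisson_pot_eq_lborel[OF that, of "sqrt (S q)" y'] Spos[of q] by (simp_all add: less_imp_le)
  have contS: "continuous_on UNIV S" unfolding S_def by (intro continuous_intros)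
  have cont_pot: "continuous_on UNIV (\<lambda>q. poisson_pot k (y (fst q)) (sqrt (S q)))" if "continuous_on UNIV k" for k
    by (rule continuous_on_compose2[OF continuous_on_poisson_pot[OF that], of UNIV "\<lambda>q. (y (fst q), sqrt (S q))", simplified])
      (intro continuous_intros contS)
  have int: "integrable ((ang \<Otimes>\<^sub>M icc 0 V) \<Otimes>\<^sub>M lborel) (\<lambda>(q, w). F q w)"
  proof (rule P.Fubini_integrable)
    have "(\<integral>w. norm (F q w) \<partial>lborel) = \<bar>\<psi> (fst q)\<bar> * (2 * pi * poisson_pot (\<lambda>w. \<bar>g w\<bar>) (y (fst q)) (sqrt (S q)))" for q
      unfolding pe(2)[OF cont_abs, symmetric] F_def by (simp add: abs_mult)
    moreover have "integrable (ang \<Otimes>\<^sub>M icc 0 V) (\<lambda>q. \<bar>\<psi> (fst q)\<bar> * (2 * pi * poisson_pot (\<lambda>w. \<bar>g w\<bar>) (y (fst q)) (sqrt (S q))))"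
      by (rule integral_icc_pair_continuous)
        (intro continuous_intros cont_pot cont_abs continuous_on_compose2[OF psi], auto)
    ultimately show "integrable (ang \<Otimes>\<^sub>M icc 0 V) (\<lambda>q. \<integral>w. norm (case (q, w) of (q, w) \<Rightarrow> F q w) \<partial>lborel)"
      by simp
    show "AE q in ang \<Otimes>\<^sub>M icc 0 V. integrable lborel (\<lambda>w. case (q, w) of (q, w) \<Rightarrow> F q w)"
      unfolding F_def by (auto intro!: AE_I2 integrable_mult_right pe(1) cont_g)
  qed simp
  have inner: "AE w in lborel. (\<integral>q. F q w \<partial>(ang \<Otimes>\<^sub>M icc 0 V)) = g w * Lam \<psi> V h w"
  proof -
    \<comment> \<open>For h = 0 the function c vanishes identically on the circle when w = x, so
      this one point has to be removed.\<close>
    have "AE w in lborel. w \<noteq> x" by (rule AE_lborel_singleton)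
    with P.AE_integrable_snd[OF int] show ?thesis
    proof eventually_elim
      case (elim w)
      show ?case
      proof (cases "w \<in> ball z \<rho>")
        case False
        then show ?thesis by (simp add: F_def vanish)
      next
        case True
        have "(\<integral>q. F q w \<partial>(ang \<Otimes>\<^sub>M icc 0 V)) = (\<integral>\<alpha>. \<integral>v. F (\<alpha>, v) w \<partial>icc 0 V \<partial>ang)"
          by (rule icc_pair.integral_fst'[symmetric]) (rule elim(1))
        also have "\<dots> = (\<integral>\<alpha>. g w * (\<psi> \<alpha> * (ln (V + sqrt (V\<^sup>2 + c \<alpha> w h)) - ln \<bar>c \<alpha> w h\<bar> / 2)) \<partial>ang)"
        proof (rule integral_cong_AE)
          show "AE \<alpha> in ang. (\<integral>v. F (\<alpha>, v) w \<partial>icc 0 V) = g w * (\<psi> \<alpha> * (ln (V + sqrt (V\<^sup>2 + c \<alpha> w h)) - ln \<bar>c \<alpha> w h\<bar> / 2))"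
            using AE_c_nonzero[OF elim(2), of h]
          proof eventually_elim
            case (elim \<alpha>)
            have "V\<^sup>2 + c \<alpha> w h > 0" using c_lower[OF True h, of \<alpha>] V by simp
            from integral_abel_kernel[OF elim V(1) this]
            have "(\<integral>v. abel_kernel (v\<^sup>2 + c \<alpha> w h) \<partial>icc 0 V) = ln (V + sqrt (V\<^sup>2 + c \<alpha> w h)) - ln \<bar>c \<alpha> w h\<bar> / 2" .
            moreover have "F (\<alpha>, v) w = (g w * \<psi> \<alpha>) * abel_kernel (v\<^sup>2 + c \<alpha> w h)" for v
              by (simp add: F_def S_def c_def algebra_simps)
            ultimately show ?case by simp
          qed
        qed (unfold F_def, measurable)
        finally show ?thesis by (simp add: Lam_def)
      qed
    qed
  qed
  have Lm: "(\<lambda>w. g w * Lam \<psi> V h w) \<in> borel_measurable lborel"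
    unfolding Lam_def by measurable
  show "integrable lborel (\<lambda>w. g w * Lam \<psi> V h w)"
    using P.integrable_snd[OF int]
    by (rule Bochner_Integration.integrable_cong_AE_imp[OF _ Lm]) (use inner in \<open>auto elim: eventually_mono\<close>)
  have "(\<integral>q. \<psi> (fst q) * poisson_pot g (y (fst q)) (sqrt (p (fst q) + h + (snd q)\<^sup>2)) \<partial>(ang \<Otimes>\<^sub>M icc 0 V))
     = (\<integral>q. 1 / (2 * pi) * (\<integral>w. F q w \<partial>lborel) \<partial>(ang \<Otimes>\<^sub>M icc 0 V))"
  proof -
    have "(\<integral>w. F q w \<partial>lborel) = \<psi> (fst q) * (2 * pi * poisson_pot g (y (fst q)) (sqrt (S q)))" for q
      unfolding F_def integral_mult_right_zero pe(2)[OF cont_g] ..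
    then have "1 / (2 * pi) * (\<integral>w. F q w \<partial>lborel) = \<psi> (fst q) * poisson_pot g (y (fst q)) (sqrt (p (fst q) + h + (snd q)\<^sup>2))" for q
      by (simp add: S_def)
    then show ?thesis by simp
  qed
  also have "\<dots> = 1 / (2 * pi) * (\<integral>q. \<integral>w. F q w \<partial>lborel \<partial>(ang \<Otimes>\<^sub>M icc 0 V))"
    by (rule integral_mult_right_zero)
  also have "(\<integral>q. \<integral>w. F q w \<partial>lborel \<partial>(ang \<Otimes>\<^sub>M icc 0 V)) = (\<integral>w. \<integral>q. F q w \<partial>(ang \<Otimes>\<^sub>M icc 0 V) \<partial>lborel)"
    using P.integral_fst[OF int] P.integral_snd[OF int] by simp
  also have "\<dots> = (\<integral>w. g w * Lam \<psi> V h w \<partial>lborel)"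
    by (rule integral_cong_AE) (use inner Lm P.integrable_snd[OF int] in auto)
  finally show "(\<integral>q. \<psi> (fst q) * poisson_pot g (y (fst q)) (sqrt (p (fst q) + h + (snd q)\<^sup>2)) \<partial>(ang \<Otimes>\<^sub>M icc 0 V))
      = 1 / (2 * pi) * (\<integral>w. g w * Lam \<psi> V h w \<partial>lborel)" .
qed

end

section \<open>Estimates for the shift and the cutoff\<close>

lemma integrable_pair_snd:
  assumes [measurable]: "integrable lborel (k :: real \<Rightarrow> real)"
  shows "integrable (icc a b \<Otimes>\<^sub>M lborel) (\<lambda>q. k (snd q))"
  by (rule icc_lborel.Fubini_integrable) (use assms in auto)

lemma integrable_inverse_square:
  assumes "r > 0"
  shows "integrable lborel (\<lambda>v. indicator {0..} v * (1 / (r + v\<^sup>2)) :: real)"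
proof -
  have lim: "((\<lambda>v. arctan (v / sqrt r) / sqrt r) \<longlongrightarrow> (pi / 2) / sqrt r) at_top"
    using assms
    by (intro tendsto_intros filterlim_compose[OF tendsto_arctan_at_top]
        filterlim_tendsto_pos_mult_at_top[OF _ _ filterlim_ident, of "\<lambda>_. 1 / sqrt r" "1 / sqrt r", simplified]) auto
  have "(\<integral>\<^sup>+v. ennreal (1 / (r + v\<^sup>2)) * indicator {0..} v \<partial>lborel) = ennreal ((pi / 2) / sqrt r - arctan (0 / sqrt r) / sqrt r)"
  proof (rule nn_integral_FTC_atLeast[OF _ _ _ lim])
    show "((\<lambda>v. arctan (v / sqrt r) / sqrt r) has_real_derivative 1 / (r + v\<^sup>2)) (at v)" for v
    proof -
      have "((\<lambda>v. arctan (v / sqrt r) / sqrt r) has_real_derivative inverse (1 + (v / sqrt r)\<^sup>2) * (1 / sqrt r) / sqrt r) (at v)"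
      proof -
        have "((\<lambda>v. v / sqrt r) has_real_derivative 1 / sqrt r) (at v)"
          using DERIV_cdivide[OF DERIV_ident, of "sqrt r"] .
        from DERIV_cdivide[OF DERIV_chain2[OF DERIV_arctan this], of "sqrt r"] show ?thesis by simp
      qed
      also have "inverse (1 + (v / sqrt r)\<^sup>2) * (1 / sqrt r) / sqrt r = 1 / (r + v\<^sup>2)"
      proof -
        have "1 + (v / sqrt r)\<^sup>2 = (r + v\<^sup>2) / r" using assms by (simp add: power_divide field_simps)
        moreover have "r + v\<^sup>2 > 0" using assms by (simp add: add_pos_nonneg)
        moreover have "sqrt r * sqrt r = r" using assms by simp
        ultimately show ?thesis using assms by (simp add: mult.assoc)
      qed
      finally show ?thesis .
    qed
    show "0 \<le> 1 / (r + v\<^sup>2)" for v using assms by (simp add: add_nonneg_nonneg)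
  qed simp
  note int = this
  have "(\<integral>\<^sup>+v. ennreal (indicator {0..} v * (1 / (r + v\<^sup>2))) \<partial>lborel) < \<infinity>"
  proof -
    have "ennreal (indicator {0..} v * (1 / (r + v\<^sup>2))) = ennreal (1 / (r + v\<^sup>2)) * indicator {0..} v" for v
      by (simp add: indicator_def)
    with int show ?thesis by (simp only: ennreal_less_top infinity_ennreal_def)
  qed
  then show ?thesis
    by (rule integrableI_nonneg[rotated 2]) (use assms in \<open>auto simp: add_nonneg_nonneg\<close>)
qed

text \<open>Bounds the effect of the shift \<open>h\<close> on the term that comes from the cutoff.
  Even after division by \<open>h\<close> it is at most 1 / V, so it disappears in the
  limit.\<close>

lemma ln_add_sqrt_diff:
  assumes V: "V \<ge> 1" and c: "V\<^sup>2 + c \<ge> 1" and h: "h \<ge> (0 :: real)"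
  shows "\<bar>ln (V + sqrt (V\<^sup>2 + (c + h))) - ln (V + sqrt (V\<^sup>2 + c))\<bar> \<le> h / V"
proof -
  define a b where "a = sqrt (V\<^sup>2 + (c + h))" and "b = sqrt (V\<^sup>2 + c)"
  have b: "b \<ge> 1" using c by (simp add: b_def)
  have ab: "a \<ge> b" using h by (simp add: a_def b_def)
  have "a\<^sup>2 - b\<^sup>2 = h" using c h by (simp add: a_def b_def)
  then have "(a - b) * (a + b) = h" by (simp add: power2_eq_square algebra_simps)
  moreover have "(a - b) * 1 \<le> (a - b) * (a + b)" using ab b by (intro mult_left_mono) auto
  ultimately have d: "a - b \<le> h" by simp
  have "ln (V + a) - ln (V + b) = ln ((V + a) / (V + b))" using V ab b by (simp add: ln_div)
  also have "\<dots> \<le> (V + a) / (V + b) - 1" using V ab b by (intro ln_le_minus_one) auto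
  also have "\<dots> = (a - b) / (V + b)" using V b by (simp add: field_simps)
  also have "\<dots> \<le> h / V" using V b ab d by (intro frac_le) auto
  finally have "ln (V + a) - ln (V + b) \<le> h / V" .
  moreover have "ln (V + a) - ln (V + b) \<ge> 0" using V ab b by simp
  ultimately show ?thesis unfolding a_def b_def by simp
qed

text \<open>The assumption \<open>val\<close> abstracts \<open>log_cos_values\<close>: as long as
  the level C stays in the range of the cosine, the logarithmic integral is affine in C with slope B
  \<beta>. The instances have the weights 1, cos and sin.\<close>

locale weighted_ball_data = ball_data +
  fixes \<psi> B :: "real \<Rightarrow> real" and A :: real
  assumes psi: "continuous_on UNIV \<psi>" "\<And>\<alpha>. \<bar>\<psi> \<alpha>\<bar> \<le> 1"
    and B: "continuous_on UNIV B" "\<And>\<beta>. \<bar>B \<beta>\<bar> \<le> 2 * pi"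
    and val: "\<And>\<beta> C. \<bar>C\<bar> \<le> 1 \<Longrightarrow> (\<integral>\<alpha>. \<psi> \<alpha> * ln \<bar>cos (\<alpha> - \<beta>) - C\<bar> \<partial>ang) = A + B \<beta> * C"
begin

lemma borel_psi [measurable]: "\<psi> \<in> borel_measurable borel"
  using psi(1) by (rule borel_measurable_continuous_onI)

lemma borel_B [measurable]: "B \<in> borel_measurable borel"
  using B(1) by (rule borel_measurable_continuous_onI)

definition \<Lambda> :: "real \<Rightarrow> real \<Rightarrow> real" where
  "\<Lambda> \<beta> C = (\<integral>\<alpha>. \<psi> \<alpha> * ln \<bar>cos (\<alpha> - \<beta>) - C\<bar> \<partial>ang)"

definition K where "K = 4 * (\<integral>\<theta>. \<bar>logsin \<theta>\<bar> \<partial>ang) + 2 * pi * ln 2"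

lemma K_nonneg: "K \<ge> 0"
  by (auto simp: K_def intro!: add_nonneg_nonneg Bochner_Integration.integral_nonneg)

lemma Lambda_large:
  assumes "1 \<le> \<bar>C\<bar>"
  shows "\<bar>\<Lambda> \<beta> C\<bar> \<le> K + 2 * pi * \<bar>C\<bar>"
proof -
  have "\<bar>\<Lambda> \<beta> C\<bar> \<le> (\<integral>\<alpha>. \<bar>\<psi> \<alpha> * ln \<bar>cos (\<alpha> - \<beta>) - C\<bar>\<bar> \<partial>ang)"
    unfolding \<Lambda>_def by (rule integral_abs_bound)
  also have "\<dots> \<le> (\<integral>\<alpha>. \<bar>ln \<bar>cos (\<alpha> - \<beta>) - C\<bar>\<bar> \<partial>ang)"
    using psi(2) by (intro integral_mono integrable_abs integrable_mult_bounded_trig integrable_log_cos)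
      (auto simp: abs_mult intro: mult_left_le_one_le)
  also have "\<dots> \<le> 4 * (\<integral>\<theta>. \<bar>logsin \<theta>\<bar> \<partial>ang) + 2 * pi * (ln 2 + \<bar>C\<bar>)"
    by (rule log_cos_large(2)[OF assms])
  finally show ?thesis by (simp add: K_def algebra_simps)
qed

text \<open>The summand 2 pi bounds the slope \<open>B\<close>. The quotient serves levels that have
  left [- 1, 1]: there \<eta> / \<delta> \<ge> 1, so the constant part of the bounds for the two
  values of \<Lambda> can be multiplied by it to become linear in \<eta>.\<close>

definition K2 where "K2 = (K + 4 * pi + \<bar>A\<bar>) / \<delta> + 2 * pi"

lemma K2_nonneg: "K2 \<ge> 0"
  using K_nonneg delta_pos by (simp add: K2_def)

text \<open>
  A point \<open>w\<close> close to \<open>x\<close> can have a shifted zero line that misses the circle. The bound \<open>K2 * \<eta>\<close> still holds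
  there, because then \<open>\<eta> \<ge> \<delta>\<close>.
\<close>
lemma Lambda_diff:
  assumes C: "\<bar>C\<bar> \<le> 1 - \<delta>" and \<eta>: "\<eta> \<ge> 0"
  shows "\<bar>\<Lambda> \<beta> (C - \<eta>) - \<Lambda> \<beta> C\<bar> \<le> K2 * \<eta>"
    and "\<eta> \<le> \<delta> \<Longrightarrow> \<Lambda> \<beta> (C - \<eta>) - \<Lambda> \<beta> C = - B \<beta> * \<eta>"
proof -
  have C1: "\<bar>C\<bar> \<le> 1" using C delta_pos by linarith
  have eq: "\<Lambda> \<beta> (C - \<eta>) - \<Lambda> \<beta> C = - B \<beta> * \<eta>" if "\<bar>C - \<eta>\<bar> \<le> 1"
    using val[OF C1, of \<beta>] val[OF that, of \<beta>] by (simp add: \<Lambda>_def algebra_simps)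
  show "\<Lambda> \<beta> (C - \<eta>) - \<Lambda> \<beta> C = - B \<beta> * \<eta>" if "\<eta> \<le> \<delta>"
    by (rule eq) (use that C \<eta> in linarith)
  have nn: "0 \<le> (K + 4 * pi + \<bar>A\<bar>) / \<delta>" using K_nonneg delta_pos by simp
  show "\<bar>\<Lambda> \<beta> (C - \<eta>) - \<Lambda> \<beta> C\<bar> \<le> K2 * \<eta>"
  proof (cases "\<bar>C - \<eta>\<bar> \<le> 1")
    case True
    have "\<bar>- B \<beta> * \<eta>\<bar> \<le> 2 * pi * \<eta>" using B(2)[of \<beta>] \<eta> by (simp add: abs_mult mult_right_mono)
    also have "\<dots> \<le> K2 * \<eta>" using nn \<eta> by (intro mult_right_mono) (auto simp: K2_def)
    finally show ?thesis using eq[OF True] by simp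
  next
    case False
    then have \<eta>\<delta>: "\<eta> \<ge> \<delta>" and C\<eta>: "\<bar>C - \<eta>\<bar> \<le> 1 + \<eta>" using C \<eta> C1 by linarith+
    have "\<bar>\<Lambda> \<beta> (C - \<eta>)\<bar> \<le> K + 2 * pi * \<bar>C - \<eta>\<bar>" using False by (intro Lambda_large) auto
    also have "\<dots> \<le> K + 2 * pi * (1 + \<eta>)" using C\<eta> by simp
    finally have 1: "\<bar>\<Lambda> \<beta> (C - \<eta>)\<bar> \<le> K + 2 * pi + 2 * pi * \<eta>" by (simp add: algebra_simps)
    have "\<bar>B \<beta> * C\<bar> \<le> 2 * pi * 1" unfolding abs_mult using B(2)[of \<beta>] C1 by (intro mult_mono) auto
    then have 2: "\<bar>\<Lambda> \<beta> C\<bar> \<le> \<bar>A\<bar> + 2 * pi" using val[OF C1, of \<beta>] by (simp add: \<Lambda>_def)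
    have "(K + 4 * pi + \<bar>A\<bar>) * 1 \<le> (K + 4 * pi + \<bar>A\<bar>) * (\<eta> / \<delta>)"
      using \<eta>\<delta> delta_pos K_nonneg by (intro mult_left_mono) auto
    then have "K + 4 * pi + \<bar>A\<bar> + 2 * pi * \<eta> \<le> K2 * \<eta>"
      by (simp add: K2_def algebra_simps add_divide_distrib)
    then show ?thesis using 1 2 by linarith
  qed
qed

text \<open>By \<open>c_polar\<close>, ln |c| is ln (2 \<kappa> \<rho>) plus the logarithm in
  \<Lambda>. The first part does not depend on \<open>h\<close> and cancels in the difference, the
  second yields the difference of \<Lambda>. Only the cutoff term is left, estimated by
  \<open>ln_add_sqrt_diff\<close> on a circle of total angle 2 pi.\<close>

lemma Lam_diff:
  assumes k: "\<kappa> > 0" and w: "x + \<kappa> *\<^sub>R dir \<beta> \<in> ball z \<rho>" and h: "h \<ge> 0" and V: "V \<ge> 1" "V\<^sup>2 \<ge> 4 * \<rho>\<^sup>2 + 1"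
  shows "\<bar>Lam \<psi> V h (x + \<kappa> *\<^sub>R dir \<beta>) - Lam \<psi> V 0 (x + \<kappa> *\<^sub>R dir \<beta>)
     + (\<Lambda> \<beta> (C0 \<beta> \<kappa> - h / (2 * \<kappa> * \<rho>)) - \<Lambda> \<beta> (C0 \<beta> \<kappa>)) / 2\<bar> \<le> 2 * pi * h / V"
proof -
  define W where "W = x + \<kappa> *\<^sub>R dir \<beta>"
  define L where "L = (\<lambda>h \<alpha>. ln (V + sqrt (V\<^sup>2 + c \<alpha> W h)))"
  have cl: "V\<^sup>2 + c \<alpha> W h \<ge> 1" if "h \<ge> 0" for h \<alpha>
    using c_lower[OF w that, of \<alpha>] V(2) unfolding W_def by linarith
  have pos: "V + sqrt (V\<^sup>2 + c \<alpha> W h) \<ge> 1" if "h \<ge> 0" for h \<alpha>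
    using cl[OF that, of \<alpha>] V(1) real_sqrt_ge_zero[of "V\<^sup>2 + c \<alpha> W h"] by linarith
  have contL: "continuous_on UNIV (L h)" if "h \<ge> 0" for h
    unfolding L_def c_def using pos[OF that, unfolded c_def]
    by (intro continuous_intros) (metis not_one_le_zero UNIV_I)
  have iL: "integrable ang (\<lambda>\<alpha>. \<psi> \<alpha> * L h \<alpha>)" if "h \<ge> 0" for h
    by (rule integrable_icc_continuous) (intro continuous_intros psi contL that)
  have ic: "integrable ang (\<lambda>\<alpha>. \<psi> \<alpha> * ln \<bar>cos (\<alpha> - \<beta>) - C\<bar>)" for C
    by (rule integrable_mult_bounded_trig[OF integrable_log_cos]) (auto simp: psi)
  have i1: "integrable ang \<psi>" by (rule integrable_icc_continuous[OF psi(1)])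
  have Lam_eq: "Lam \<psi> V h W = (\<integral>\<alpha>. \<psi> \<alpha> * L h \<alpha> \<partial>ang) - (\<integral>\<alpha>. \<psi> \<alpha> \<partial>ang) * (ln (2 * \<kappa> * \<rho>) / 2)
     - \<Lambda> \<beta> (C0 \<beta> \<kappa> - h / (2 * \<kappa> * \<rho>)) / 2" if "h \<ge> 0" for h
  proof -
    have "Lam \<psi> V h W = (\<integral>\<alpha>. \<psi> \<alpha> * L h \<alpha> - \<psi> \<alpha> * (ln (2 * \<kappa> * \<rho>) / 2)
       - \<psi> \<alpha> * ln \<bar>cos (\<alpha> - \<beta>) - (C0 \<beta> \<kappa> - h / (2 * \<kappa> * \<rho>))\<bar> / 2 \<partial>ang)"
      unfolding Lam_def
    proof (rule integral_cong_AE)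
      show "AE \<alpha> in ang. \<psi> \<alpha> * (ln (V + sqrt (V\<^sup>2 + c \<alpha> W h)) - ln \<bar>c \<alpha> W h\<bar> / 2)
        = \<psi> \<alpha> * L h \<alpha> - \<psi> \<alpha> * (ln (2 * \<kappa> * \<rho>) / 2)
       - \<psi> \<alpha> * ln \<bar>cos (\<alpha> - \<beta>) - (C0 \<beta> \<kappa> - h / (2 * \<kappa> * \<rho>))\<bar> / 2"
        using AE_cos_ne[of \<beta> "C0 \<beta> \<kappa> - h / (2 * \<kappa> * \<rho>)"]
      proof eventually_elim
        case (elim \<alpha>)
        have "\<bar>c \<alpha> W h\<bar> = 2 * \<kappa> * \<rho> * \<bar>cos (\<alpha> - \<beta>) - (C0 \<beta> \<kappa> - h / (2 * \<kappa> * \<rho>))\<bar>"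
          unfolding W_def c_polar[OF k] abs_mult using k rho by simp
        moreover have "2 * \<kappa> * \<rho> > 0" "\<bar>cos (\<alpha> - \<beta>) - (C0 \<beta> \<kappa> - h / (2 * \<kappa> * \<rho>))\<bar> > 0"
          using k rho elim by auto
        ultimately have "ln \<bar>c \<alpha> W h\<bar> = ln (2 * \<kappa> * \<rho>) + ln \<bar>cos (\<alpha> - \<beta>) - (C0 \<beta> \<kappa> - h / (2 * \<kappa> * \<rho>))\<bar>"
          by (simp only: ln_mult_pos)
        then show ?case
          by (simp only: L_def right_diff_distrib distrib_left add_divide_distrib times_divide_eq_right diff_diff_eq)
      qed
    qed (unfold L_def, measurable)
    also have "\<dots> = (\<integral>\<alpha>. \<psi> \<alpha> * L h \<alpha> \<partial>ang) - (\<integral>\<alpha>. \<psi> \<alpha> \<partial>ang) * (ln (2 * \<kappa> * \<rho>) / 2)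
     - \<Lambda> \<beta> (C0 \<beta> \<kappa> - h / (2 * \<kappa> * \<rho>)) / 2"
      unfolding \<Lambda>_def using iL[OF that] ic i1
      by (simp add: Bochner_Integration.integral_diff Bochner_Integration.integrable_diff)
    finally show ?thesis .
  qed
  have "Lam \<psi> V h W - Lam \<psi> V 0 W + (\<Lambda> \<beta> (C0 \<beta> \<kappa> - h / (2 * \<kappa> * \<rho>)) - \<Lambda> \<beta> (C0 \<beta> \<kappa>)) / 2
     = (\<integral>\<alpha>. \<psi> \<alpha> * L h \<alpha> - \<psi> \<alpha> * L 0 \<alpha> \<partial>ang)"
    using Lam_eq[OF h] Lam_eq[of 0] iL[OF h] iL[of 0] by (simp add: diff_divide_distrib)
  also have "\<bar>\<dots>\<bar> \<le> (\<integral>\<alpha>. \<bar>\<psi> \<alpha> * L h \<alpha> - \<psi> \<alpha> * L 0 \<alpha>\<bar> \<partial>ang)"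
    by (rule integral_abs_bound)
  also have "\<dots> \<le> (\<integral>\<alpha>. h / V \<partial>ang)"
  proof (rule integral_mono)
    fix \<alpha>
    have "\<bar>L h \<alpha> - L 0 \<alpha>\<bar> \<le> h / V"
      unfolding L_def using ln_add_sqrt_diff[OF V(1) cl[of 0 \<alpha>] h] by (simp add: c_def add.commute add.left_commute algebra_simps)
    moreover have "\<bar>\<psi> \<alpha> * (L h \<alpha> - L 0 \<alpha>)\<bar> \<le> 1 * \<bar>L h \<alpha> - L 0 \<alpha>\<bar>"
      unfolding abs_mult using psi(2) by (intro mult_right_mono) auto
    ultimately show "\<bar>\<psi> \<alpha> * L h \<alpha> - \<psi> \<alpha> * L 0 \<alpha>\<bar> \<le> h / V"
      by (simp add: right_diff_distrib)
  qed (use iL[OF h] iL[of 0] in auto)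
  also have "\<dots> = 2 * pi * h / V" by simp
  finally show ?thesis unfolding W_def .
qed

end

section \<open>Passage to the limit\<close>

lemma scaled_sum_divide: "(2 * P * h + K * (h / (2 * k * r)) / 2) / h = 2 * P + K / (4 * k * r)" if "h > 0" "k > 0" "r > (0::real)"
proof -
  have "(2 * P * h + K * (h / (2 * k * r)) / 2) = h * (2 * P + K / (4 * k * r))" by (simp add: algebra_simps)
  then show ?thesis using that by simp
qed
lemma mult_scaled_sum: "k * (2 * P + K / (4 * k * r)) = 2 * P * k + K / (4 * r)" if "k > 0" "r > (0::real)"
  using that by (simp add: distrib_left)
lemma half_add_divide: "(d + s / 2) / h + B / (4 * k * r) = d / h" if "h > 0" "k > 0" "r > (0::real)" "s = - B * (h / (2 * k * r))"
proof -
  have "s / 2 / h = - (B / (4 * k * r))" using that by simp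
  then show ?thesis by (simp add: add_divide_distrib)
qed

context weighted_ball_data
begin

lemma sets_ang_lborel: "sets (ang \<Otimes>\<^sub>M lborel) = sets (borel \<Otimes>\<^sub>M borel)"
  by (intro sets_pair_measure_cong) auto

lemma borel_Lam [measurable]: "Lam \<psi> V h \<in> borel_measurable borel"
  unfolding Lam_def by measurable

text \<open>The shift \<open>hs n\<close> of \<open>p\<close> and the cutoff \<open>Vs n\<close> in \<open>v = sqrt (t\<^sup>2 - p)\<close> go to their limits together.\<close>
definition hs :: "nat \<Rightarrow> real" where "hs n = 1 / real (Suc n)"

definition Vs :: "nat \<Rightarrow> real" where "Vs n = real (Suc n) + 2 * \<rho>"

lemma hs_pos: "hs n > 0" by (simp add: hs_def)

lemma hs_lim: "hs \<longlonglongrightarrow> 0"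
  unfolding hs_def by (rule LIMSEQ_Suc[OF lim_1_over_n])

lemma Vs_ge: "Vs n \<ge> 1" "(Vs n)\<^sup>2 \<ge> 4 * \<rho>\<^sup>2 + 1" "Vs n \<ge> real (Suc n)"
proof -
  show "Vs n \<ge> 1" "Vs n \<ge> real (Suc n)" using rho by (auto simp: Vs_def)
  have "(1 + 2 * \<rho>)\<^sup>2 \<le> (Vs n)\<^sup>2" using rho by (intro power_mono) (auto simp: Vs_def)
  moreover have "(1 + 2 * \<rho>)\<^sup>2 = 1 + 4 * \<rho> + 4 * \<rho>\<^sup>2" by (simp add: power2_eq_square algebra_simps)
  ultimately show "(Vs n)\<^sup>2 \<ge> 4 * \<rho>\<^sup>2 + 1" using rho by simp
qed

lemma Vs_lim: "filterlim Vs at_top sequentially"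
proof (rule filterlim_at_top_mono)
  show "filterlim (\<lambda>n. real (Suc n)) at_top sequentially"
    by (rule filterlim_compose[OF filterlim_real_sequentially filterlim_Suc])
qed (use Vs_ge in auto)

text \<open>Dominated convergence in polar coordinates about x. The shift h lowers the level by h /
  (2 \<kappa> \<rho>), so the difference quotient of \<open>Lam\<close> behaves like B / (4 \<kappa>
  \<rho>), and the Jacobian \<kappa> cancels the singularity at x.\<close>

lemma right_limit:
  defines "G \<equiv> \<lambda>n q. max 0 (snd q) * (g (x + snd q *\<^sub>R dir (fst q)) *
      ((Lam \<psi> (Vs n) (hs n) (x + snd q *\<^sub>R dir (fst q)) - Lam \<psi> (Vs n) 0 (x + snd q *\<^sub>R dir (fst q))) / hs n))"
    and "GL \<equiv> \<lambda>q. indicator {0<..} (snd q) * (g (x + snd q *\<^sub>R dir (fst q)) * (B (fst q) / (4 * \<rho>)))"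
  shows "integrable (ang \<Otimes>\<^sub>M lborel) GL" "(\<lambda>n. \<integral>q. G n q \<partial>(ang \<Otimes>\<^sub>M lborel)) \<longlonglongrightarrow> (\<integral>q. GL q \<partial>(ang \<Otimes>\<^sub>M lborel))"
proof -
  note [measurable_cong] = sets_ang_lborel
  obtain M where M: "M > 0" "\<And>w. \<bar>g w\<bar> \<le> M" using vanishing_bounded[OF cont_g vanish(1)] by blast
  \<comment> \<open>Bounds |g| by M and \<kappa> (2 pi + K2 / (4 \<kappa> \<rho>)) by its value for
    the largest radius 2 \<rho> that the ball admits; 2 pi is the contribution of the cutoff, where
    \<open>Vs n\<close> is at least 1.\<close>
  define Cst where "Cst = M * (4 * pi * \<rho> + K2 / (4 * \<rho>))"
  have Cst: "Cst \<ge> 0" using M rho K2_nonneg by (simp add: Cst_def)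
  have D: "\<bar>Lam \<psi> (Vs n) (hs n) w - Lam \<psi> (Vs n) 0 w + (\<Lambda> \<beta> (C0 \<beta> \<kappa> - hs n / (2 * \<kappa> * \<rho>)) - \<Lambda> \<beta> (C0 \<beta> \<kappa>)) / 2\<bar> \<le> 2 * pi * hs n / Vs n"
    if "\<kappa> > 0" "w = x + \<kappa> *\<^sub>R dir \<beta>" "w \<in> ball z \<rho>" for \<kappa> \<beta> w n
    using Lam_diff[OF that(1), of \<beta> "hs n" "Vs n"] that Vs_ge(1,2) hs_pos[of n] by simp
  have bound: "norm (G n q) \<le> Cst * indicator {0..2*\<rho>} (snd q)" for n q
  proof -
    obtain \<beta> \<kappa> where q: "q = (\<beta>, \<kappa>)" by (cases q)
    define w where "w = x + \<kappa> *\<^sub>R dir \<beta>"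
    show ?thesis
    proof (cases "\<kappa> > 0 \<and> w \<in> ball z \<rho>")
      case False
      then have "G n q = 0" using vanish(1)[of w] by (auto simp: G_def q w_def)
      then show ?thesis using Cst by (simp add: indicator_def)
    next
      case True
      then have k: "\<kappa> > 0" "w \<in> ball z \<rho>" by auto
      have k2: "\<kappa> \<le> 2 * \<rho>" using kappa_bound k by (simp add: w_def)
      define d where "d = Lam \<psi> (Vs n) (hs n) w - Lam \<psi> (Vs n) 0 w"
      define r where "r = \<Lambda> \<beta> (C0 \<beta> \<kappa> - hs n / (2 * \<kappa> * \<rho>)) - \<Lambda> \<beta> (C0 \<beta> \<kappa>)"
      have "\<bar>d + r / 2\<bar> \<le> 2 * pi * hs n / Vs n" using D[OF k(1) w_def k(2), of n] by (simp add: d_def r_def)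
      also have "\<dots> \<le> 2 * pi * hs n / 1" using Vs_ge(1)[of n] hs_pos[of n] by (intro divide_left_mono) auto
      finally have 1: "\<bar>d + r / 2\<bar> \<le> 2 * pi * hs n" by simp
      have r_le: "\<bar>r\<bar> \<le> K2 * (hs n / (2 * \<kappa> * \<rho>))"
        unfolding r_def using k rho hs_pos[of n]
        by (intro Lambda_diff(1)[OF C0_bound[OF k(1)]]) (auto simp: w_def less_imp_le)
      have aux: "\<bar>d\<bar> \<le> Q + R / 2" if "\<bar>r\<bar> \<le> R" "\<bar>d + r / 2\<bar> \<le> Q" for Q R
        using that by linarith
      have "\<bar>d\<bar> \<le> 2 * pi * hs n + K2 * (hs n / (2 * \<kappa> * \<rho>)) / 2" by (rule aux[OF r_le 1])
      then have "\<bar>d\<bar> / hs n \<le> (2 * pi * hs n + K2 * (hs n / (2 * \<kappa> * \<rho>)) / 2) / hs n"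
        using hs_pos[of n] by (intro divide_right_mono) auto
      also have "\<dots> = 2 * pi + K2 / (4 * \<kappa> * \<rho>)" by (rule scaled_sum_divide) (use hs_pos[of n] k rho in auto)
      finally have 2: "\<bar>d / hs n\<bar> \<le> 2 * pi + K2 / (4 * \<kappa> * \<rho>)" using hs_pos[of n] by (simp add: abs_divide)
      have "norm (G n q) = \<bar>g w\<bar> * (\<kappa> * \<bar>d / hs n\<bar>)"
        using k by (simp add: G_def q w_def[symmetric] d_def[symmetric] abs_mult)
      also have "\<dots> \<le> M * (\<kappa> * (2 * pi + K2 / (4 * \<kappa> * \<rho>)))"
        using M(2)[of w] 2 k M(1) by (intro mult_mono) auto
      also have "\<kappa> * (2 * pi + K2 / (4 * \<kappa> * \<rho>)) = 2 * pi * \<kappa> + K2 / (4 * \<rho>)"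
        by (rule mult_scaled_sum) (use k rho in auto)
      also have "M * \<dots> \<le> M * (4 * pi * \<rho> + K2 / (4 * \<rho>))" using k2 M(1) by (intro mult_left_mono) auto
      finally show ?thesis using k k2 by (simp add: Cst_def q indicator_def)
    qed
  qed
  have lim: "(\<lambda>n. G n q) \<longlonglongrightarrow> GL q" for q
  proof -
    obtain \<beta> \<kappa> where q: "q = (\<beta>, \<kappa>)" by (cases q)
    define w where "w = x + \<kappa> *\<^sub>R dir \<beta>"
    show ?thesis
    proof (cases "\<kappa> > 0 \<and> w \<in> ball z \<rho>")
      case False
      then have "G n q = 0" "GL q = 0" for n using vanish(1)[of w] by (auto simp: G_def GL_def q w_def)
      then show ?thesis by simp
    next
      case True
      then have k: "\<kappa> > 0" "w \<in> ball z \<rho>" by auto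
      define d where "d = (\<lambda>n. Lam \<psi> (Vs n) (hs n) w - Lam \<psi> (Vs n) 0 w)"
      define r where "r = (\<lambda>n. \<Lambda> \<beta> (C0 \<beta> \<kappa> - hs n / (2 * \<kappa> * \<rho>)) - \<Lambda> \<beta> (C0 \<beta> \<kappa>))"
      have lim0: "(\<lambda>n. (d n + r n / 2) / hs n) \<longlonglongrightarrow> 0"
      proof (rule Lim_null_comparison)
        show "\<forall>\<^sub>F n in sequentially. norm ((d n + r n / 2) / hs n) \<le> 2 * pi * (1 / Vs n)"
        proof (intro always_eventually allI)
          fix n
          have "\<bar>d n + r n / 2\<bar> \<le> 2 * pi * hs n / Vs n" using D[OF k(1) w_def k(2), of n] by (simp add: d_def r_def)
          then have "\<bar>d n + r n / 2\<bar> / hs n \<le> 2 * pi * hs n / Vs n / hs n"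
            using hs_pos[of n] by (intro divide_right_mono) auto
          then show "norm ((d n + r n / 2) / hs n) \<le> 2 * pi * (1 / Vs n)" using hs_pos[of n] by (simp add: abs_divide)
        qed
        have "(\<lambda>n. 1 / Vs n) \<longlonglongrightarrow> 0"
          using tendsto_inverse_0_at_top[OF Vs_lim] by (simp add: inverse_eq_divide)
        then show "(\<lambda>n. 2 * pi * (1 / Vs n)) \<longlonglongrightarrow> 0" by (rule tendsto_mult_right_zero)
      qed
      \<comment> \<open>For a fixed radius \<kappa> the lowering of the level is eventually smaller
        than \<delta>, and from then on \<Lambda> changes by exactly its slope. How soon this
        happens depends on \<kappa>, so \<open>bound\<close> has to rely on \<open>K2\<close>
        instead.\<close>
      have ev: "\<forall>\<^sub>F n in sequentially. (d n + r n / 2) / hs n + B \<beta> / (4 * \<kappa> * \<rho>) = d n / hs n"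
      proof -
        have "(\<lambda>n. hs n / (2 * \<kappa> * \<rho>)) \<longlonglongrightarrow> 0 / (2 * \<kappa> * \<rho>)"
          using k rho by (intro tendsto_intros hs_lim) auto
        then have "\<forall>\<^sub>F n in sequentially. hs n / (2 * \<kappa> * \<rho>) < \<delta>"
          using delta_pos by (intro order_tendstoD(2)) auto
        then show ?thesis
        proof eventually_elim
          case (elim n)
          have "r n = - B \<beta> * (hs n / (2 * \<kappa> * \<rho>))"
            unfolding r_def using k rho hs_pos[of n] elim
            by (intro Lambda_diff(2)[OF C0_bound[OF k(1)]]) (auto simp: w_def less_imp_le)
          then show ?case by (rule half_add_divide[rotated 3]) (use hs_pos[of n] k rho in auto)
        qed
      qed
      have "(\<lambda>n. d n / hs n) \<longlonglongrightarrow> 0 + B \<beta> / (4 * \<kappa> * \<rho>)"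
        by (rule Lim_transform_eventually[OF tendsto_add[OF lim0 tendsto_const] ev])
      then have "(\<lambda>n. \<kappa> * (g w * (d n / hs n))) \<longlonglongrightarrow> \<kappa> * (g w * (0 + B \<beta> / (4 * \<kappa> * \<rho>)))"
        by (rule tendsto_mult_left[OF tendsto_mult_left])
      moreover have "\<kappa> * (g w * (0 + B \<beta> / (4 * \<kappa> * \<rho>))) = g w * (B \<beta> / (4 * \<rho>))" using k by simp
      ultimately show ?thesis using k by (simp add: G_def GL_def q w_def[symmetric] d_def)
    qed
  qed
  have Gm: "G n \<in> borel_measurable (ang \<Otimes>\<^sub>M lborel)" for n unfolding G_def by measurable
  have GLm: "GL \<in> borel_measurable (ang \<Otimes>\<^sub>M lborel)" unfolding GL_def by measurable
  have dom: "integrable (ang \<Otimes>\<^sub>M lborel) (\<lambda>q. Cst * indicator {0..2*\<rho>} (snd q))"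
    by (rule integrable_pair_snd) (intro integrable_mult_right integrable_real_indicator, auto simp: emeasure_lborel_Icc_eq)
  note dc = GLm Gm dom AE_I2[OF lim] AE_I2[OF bound]
  show "integrable (ang \<Otimes>\<^sub>M lborel) GL" by (rule integrable_dominated_convergence[OF dc])
  show "(\<lambda>n. \<integral>q. G n q \<partial>(ang \<Otimes>\<^sub>M lborel)) \<longlonglongrightarrow> (\<integral>q. GL q \<partial>(ang \<Otimes>\<^sub>M lborel))"
    by (rule integral_dominated_convergence[OF dc])
qed

text \<open>By the mean value theorem the difference quotient of the potential is its derivative in
  the shift at an intermediate point. The decay C / t of \<open>poisson_sol\<close> together with
  the factor 1 / (2 t) from the square root gives the majorant C / (p0 + v^2), independent of n and
  of the point on the circle.\<close>

lemma left_limit: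
  defines "H \<equiv> \<lambda>n q. indicator {0..Vs n} (snd q) * (\<psi> (fst q) *
      ((poisson_pot g (y (fst q)) (sqrt (p (fst q) + hs n + (snd q)\<^sup>2)) - poisson_pot g (y (fst q)) (sqrt (p (fst q) + 0 + (snd q)\<^sup>2))) / hs n))"
    and "HL \<equiv> \<lambda>q. indicator {0..} (snd q) * (\<psi> (fst q) *
      (poisson_sol g g1 g2 (y (fst q)) (sqrt (p (fst q) + (snd q)\<^sup>2)) / (2 * sqrt (p (fst q) + (snd q)\<^sup>2))))"
  shows "integrable (ang \<Otimes>\<^sub>M lborel) HL" "(\<lambda>n. \<integral>q. H n q \<partial>(ang \<Otimes>\<^sub>M lborel)) \<longlonglongrightarrow> (\<integral>q. HL q \<partial>(ang \<Otimes>\<^sub>M lborel))"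
proof -
  note [measurable_cong] = sets_ang_lborel
  obtain C where C: "C > 0" "\<And>y t. norm (y - z) \<le> \<rho> \<Longrightarrow> t > 0 \<Longrightarrow> \<bar>poisson_sol g g1 g2 y t\<bar> \<le> C / t"
    using poisson_sol_bound[OF cont_g cont_g1 cont_g2 vanish] by blast
  have der: "((\<lambda>\<eta>. poisson_pot g (y \<alpha>) (sqrt (p \<alpha> + \<eta> + v\<^sup>2))) has_real_derivative
      poisson_sol g g1 g2 (y \<alpha>) (sqrt (p \<alpha> + \<eta> + v\<^sup>2)) / (2 * sqrt (p \<alpha> + \<eta> + v\<^sup>2))) (at \<eta>)" if "\<eta> \<ge> 0" for \<alpha> v \<eta>
  proof -
    have S: "p \<alpha> + \<eta> + v\<^sup>2 > 0" using p_ge[of \<alpha>] p0_pos that by (simp add: add_pos_nonneg)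
    have "((\<lambda>\<eta>. sqrt (p \<alpha> + \<eta> + v\<^sup>2)) has_real_derivative 1 / (2 * sqrt (p \<alpha> + \<eta> + v\<^sup>2))) (at \<eta>)"
      using S by (auto intro!: derivative_eq_intros simp: field_simps)
    from DERIV_chain2[OF poisson_pot_has_derivative[OF grad cont_g1 cont_g2] this] show ?thesis by simp
  qed
  have dbound: "\<bar>poisson_sol g g1 g2 (y \<alpha>) (sqrt (p \<alpha> + \<eta> + v\<^sup>2)) / (2 * sqrt (p \<alpha> + \<eta> + v\<^sup>2))\<bar> \<le> C * (1 / (p0 + v\<^sup>2))"
    if "\<eta> \<ge> 0" for \<alpha> v \<eta>
  proof -
    define S where "S = p \<alpha> + \<eta> + v\<^sup>2"
    have S0: "p0 + v\<^sup>2 \<le> S" "p0 + v\<^sup>2 > 0" using p_ge[of \<alpha>] p0_pos that by (auto simp: S_def add_pos_nonneg)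
    have "\<bar>poisson_sol g g1 g2 (y \<alpha>) (sqrt S)\<bar> \<le> C / sqrt S" using S0 norm_y[of \<alpha>] by (intro C(2)) auto
    then have "\<bar>poisson_sol g g1 g2 (y \<alpha>) (sqrt S) / (2 * sqrt S)\<bar> \<le> C / sqrt S / (2 * sqrt S)"
      using S0 unfolding abs_divide by (intro frac_le) auto
    also have "\<dots> = C / (2 * S)" using S0 by simp
    also have "\<dots> \<le> C / (p0 + v\<^sup>2)" using S0 C(1) by (intro frac_le) auto
    finally show ?thesis by (simp add: S_def)
  qed
  have bound: "norm (H n q) \<le> C * (indicator {0..} (snd q) * (1 / (p0 + (snd q)\<^sup>2)))" for n q
  proof -
    obtain \<alpha> v where q: "q = (\<alpha>, v)" by (cases q)
    let ?f = "\<lambda>\<eta>. poisson_pot g (y \<alpha>) (sqrt (p \<alpha> + \<eta> + v\<^sup>2))"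
    have nn: "0 \<le> C * (1 / (p0 + v\<^sup>2))" using C(1) p0_pos by (simp add: add_nonneg_nonneg)
    have "\<exists>\<xi>. 0 < \<xi> \<and> \<xi> < hs n \<and> ?f (hs n) - ?f 0 = (hs n - 0) * (poisson_sol g g1 g2 (y \<alpha>) (sqrt (p \<alpha> + \<xi> + v\<^sup>2)) / (2 * sqrt (p \<alpha> + \<xi> + v\<^sup>2)))"
      using hs_pos[of n] by (intro MVT2 der) auto
    then obtain \<xi> where \<xi>: "0 < \<xi>" "(?f (hs n) - ?f 0) / hs n = poisson_sol g g1 g2 (y \<alpha>) (sqrt (p \<alpha> + \<xi> + v\<^sup>2)) / (2 * sqrt (p \<alpha> + \<xi> + v\<^sup>2))"
      using hs_pos[of n] by auto
    have "\<bar>\<psi> \<alpha> * ((?f (hs n) - ?f 0) / hs n)\<bar> \<le> 1 * (C * (1 / (p0 + v\<^sup>2)))"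
      unfolding \<xi>(2) abs_mult[of "\<psi> \<alpha>"] using psi(2)[of \<alpha>] dbound[of \<xi> \<alpha> v] \<xi>(1) by (intro mult_mono) auto
    then show ?thesis using nn by (auto simp: H_def q indicator_def abs_mult)
  qed
  have lim: "(\<lambda>n. H n q) \<longlonglongrightarrow> HL q" for q
  proof -
    obtain \<alpha> v where q: "q = (\<alpha>, v)" by (cases q)
    let ?f = "\<lambda>\<eta>. poisson_pot g (y \<alpha>) (sqrt (p \<alpha> + \<eta> + v\<^sup>2))"
    have "((\<lambda>\<eta>. (?f (0 + \<eta>) - ?f 0) / \<eta>) \<longlongrightarrow> poisson_sol g g1 g2 (y \<alpha>) (sqrt (p \<alpha> + 0 + v\<^sup>2)) / (2 * sqrt (p \<alpha> + 0 + v\<^sup>2))) (at 0)"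
      using der[of 0 \<alpha> v] unfolding DERIV_def by simp
    moreover have "filterlim hs (at 0) sequentially"
      unfolding filterlim_at using hs_lim hs_pos by (auto intro!: always_eventually simp: less_imp_neq[symmetric])
    ultimately have "(\<lambda>n. (?f (0 + hs n) - ?f 0) / hs n) \<longlonglongrightarrow> poisson_sol g g1 g2 (y \<alpha>) (sqrt (p \<alpha> + 0 + v\<^sup>2)) / (2 * sqrt (p \<alpha> + 0 + v\<^sup>2))"
      by (rule filterlim_compose)
    then have l1: "(\<lambda>n. \<psi> \<alpha> * ((?f (hs n) - ?f 0) / hs n)) \<longlonglongrightarrow> \<psi> \<alpha> * (poisson_sol g g1 g2 (y \<alpha>) (sqrt (p \<alpha> + v\<^sup>2)) / (2 * sqrt (p \<alpha> + v\<^sup>2)))"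
      by (intro tendsto_mult_left) simp
    have l2: "(\<lambda>n. indicator {0..Vs n} v :: real) \<longlonglongrightarrow> indicator {0..} v"
    proof (rule tendsto_eventually)
      have "\<forall>\<^sub>F n in sequentially. v \<le> Vs n" using Vs_lim by (simp add: filterlim_at_top)
      then show "\<forall>\<^sub>F n in sequentially. (indicator {0..Vs n} v :: real) = indicator {0..} v"
        by eventually_elim (simp add: indicator_def)
    qed
    show ?thesis using tendsto_mult[OF l2 l1] by (simp add: H_def HL_def q)
  qed
  have pm[measurable]: "(\<lambda>q. poisson_pot g (fst q) (snd q)) \<in> borel_measurable borel"
    "(\<lambda>q. poisson_sol g g1 g2 (fst q) (snd q)) \<in> borel_measurable borel"
    by (intro borel_measurable_continuous_onI continuous_on_poisson_pot continuous_on_poisson_sol cont_g cont_g1 cont_g2)+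
  have comp: "(\<lambda>q. poisson_pot g (u q) (k q)) \<in> borel_measurable (ang \<Otimes>\<^sub>M lborel)"
    "(\<lambda>q. poisson_sol g g1 g2 (u q) (k q)) \<in> borel_measurable (ang \<Otimes>\<^sub>M lborel)"
    if [measurable]: "u \<in> borel_measurable (ang \<Otimes>\<^sub>M lborel)" "k \<in> borel_measurable (ang \<Otimes>\<^sub>M lborel)" for u k
    using measurable_compose[OF borel_measurable_Pair[OF that] pm(1)] measurable_compose[OF borel_measurable_Pair[OF that] pm(2)] by simp_all
  have Hm: "H n \<in> borel_measurable (ang \<Otimes>\<^sub>M lborel)" for n
    unfolding H_def by (intro borel_measurable_times borel_measurable_divide borel_measurable_diff comp) measurable
  have HLm: "HL \<in> borel_measurable (ang \<Otimes>\<^sub>M lborel)"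
    unfolding HL_def by (intro borel_measurable_times borel_measurable_divide comp) measurable
  have dom: "integrable (ang \<Otimes>\<^sub>M lborel) (\<lambda>q. C * (indicator {0..} (snd q) * (1 / (p0 + (snd q)\<^sup>2))))"
    by (rule integrable_pair_snd) (intro integrable_mult_right integrable_inverse_square p0_pos)
  note dc = HLm Hm dom AE_I2[OF lim] AE_I2[OF bound]
  show "integrable (ang \<Otimes>\<^sub>M lborel) HL" by (rule integrable_dominated_convergence[OF dc])
  show "(\<lambda>n. \<integral>q. H n q \<partial>(ang \<Otimes>\<^sub>M lborel)) \<longlonglongrightarrow> (\<integral>q. HL q \<partial>(ang \<Otimes>\<^sub>M lborel))"
    by (rule integral_dominated_convergence[OF dc])
qed

text \<open>For every n the two difference quotients are equal up to the factor 1 / (2 pi): subtract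
  \<open>potential_average\<close> at shift 0 from the one at shift \<open>hs n\<close>, with the
  same cutoff, and pass to polar coordinates about x. Uniqueness of limits does the rest.\<close>

lemma limits_agree:
  "(\<integral>q. indicator {0..} (snd q) * (\<psi> (fst q) *
      (poisson_sol g g1 g2 (y (fst q)) (sqrt (p (fst q) + (snd q)\<^sup>2)) / (2 * sqrt (p (fst q) + (snd q)\<^sup>2)))) \<partial>(ang \<Otimes>\<^sub>M lborel))
   = 1 / (2 * pi) * (\<integral>q. indicator {0<..} (snd q) * (g (x + snd q *\<^sub>R dir (fst q)) * (B (fst q) / (4 * \<rho>))) \<partial>(ang \<Otimes>\<^sub>M lborel))"
proof -
  note [measurable_cong] = sets_ang_lborel
  have cp: "continuous_on UNIV (\<lambda>q. \<psi> (fst q) * poisson_pot g (y (fst q)) (sqrt (p (fst q) + h + (snd q)\<^sup>2)))" for h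
    by (intro continuous_intros continuous_on_compose2[OF psi(1)]
        continuous_on_compose2[OF continuous_on_poisson_pot[OF cont_g], of UNIV "\<lambda>q. (y (fst q), sqrt (p (fst q) + h + (snd q)\<^sup>2))", simplified]) auto
  have step: "(\<integral>q. indicator {0..Vs n} (snd q) * (\<psi> (fst q) *
      ((poisson_pot g (y (fst q)) (sqrt (p (fst q) + hs n + (snd q)\<^sup>2)) - poisson_pot g (y (fst q)) (sqrt (p (fst q) + 0 + (snd q)\<^sup>2))) / hs n)) \<partial>(ang \<Otimes>\<^sub>M lborel))
    = 1 / (2 * pi) * (\<integral>q. max 0 (snd q) * (g (x + snd q *\<^sub>R dir (fst q)) *
      ((Lam \<psi> (Vs n) (hs n) (x + snd q *\<^sub>R dir (fst q)) - Lam \<psi> (Vs n) 0 (x + snd q *\<^sub>R dir (fst q))) / hs n)) \<partial>(ang \<Otimes>\<^sub>M lborel))"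
    (is "?L = _ * ?R") for n
  proof -
    have V: "Vs n > 0" "(Vs n)\<^sup>2 > 4 * \<rho>\<^sup>2" using Vs_ge[of n] by auto
    have h: "hs n \<ge> 0" using hs_pos[of n] by simp
    define T where "T = (\<lambda>h q. \<psi> (fst q) * poisson_pot g (y (fst q)) (sqrt (p (fst q) + h + (snd q)\<^sup>2)))"
    have Tm: "T h \<in> borel_measurable (borel \<Otimes>\<^sub>M borel)" for h
      unfolding T_def borel_prod by (rule borel_measurable_continuous_onI[OF cp])
    have Ti: "integrable (ang \<Otimes>\<^sub>M icc 0 (Vs n)) (T h)" for h
      unfolding T_def by (rule integral_icc_pair_continuous[OF cp])
    have "?L = (\<integral>q. indicator {0..Vs n} (snd q) * ((T (hs n) q - T 0 q) / hs n) \<partial>(ang \<Otimes>\<^sub>M lborel))"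
      by (simp add: T_def right_diff_distrib)
    also have "\<dots> = (\<integral>q. (T (hs n) q - T 0 q) / hs n \<partial>(ang \<Otimes>\<^sub>M icc 0 (Vs n)))"
      by (rule integral_pair_icc[symmetric]) (intro borel_measurable_divide borel_measurable_diff Tm borel_measurable_const)
    also have "\<dots> = ((\<integral>q. T (hs n) q \<partial>(ang \<Otimes>\<^sub>M icc 0 (Vs n))) - (\<integral>q. T 0 q \<partial>(ang \<Otimes>\<^sub>M icc 0 (Vs n)))) / hs n"
      using Ti by (simp add: Bochner_Integration.integral_diff)
    also have "\<dots> = (1 / (2 * pi) * (\<integral>w. g w * Lam \<psi> (Vs n) (hs n) w \<partial>lborel) - 1 / (2 * pi) * (\<integral>w. g w * Lam \<psi> (Vs n) 0 w \<partial>lborel)) / hs n"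
      unfolding T_def potential_average(2)[OF psi(1) h V] potential_average(2)[OF psi(1) order_refl V] ..
    also have "\<dots> = 1 / (2 * pi) * (((\<integral>w. g w * Lam \<psi> (Vs n) (hs n) w \<partial>lborel) - (\<integral>w. g w * Lam \<psi> (Vs n) 0 w \<partial>lborel)) / hs n)"
      by (simp only: right_diff_distrib[symmetric] times_divide_eq_right)
    also have "((\<integral>w. g w * Lam \<psi> (Vs n) (hs n) w \<partial>lborel) - (\<integral>w. g w * Lam \<psi> (Vs n) 0 w \<partial>lborel)) / hs n
      = (\<integral>w. g w * ((Lam \<psi> (Vs n) (hs n) w - Lam \<psi> (Vs n) 0 w) / hs n) \<partial>lborel)"
      using potential_average(1)[OF psi(1) h V] potential_average(1)[OF psi(1) order_refl V]
      by (simp add: Bochner_Integration.integral_diff right_diff_distrib)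
    also have "\<dots> = ?R"
      by (rule integral_polar) measurable
    finally show ?thesis .
  qed
  have "(\<lambda>n. \<integral>q. indicator {0..Vs n} (snd q) * (\<psi> (fst q) *
      ((poisson_pot g (y (fst q)) (sqrt (p (fst q) + hs n + (snd q)\<^sup>2)) - poisson_pot g (y (fst q)) (sqrt (p (fst q) + 0 + (snd q)\<^sup>2))) / hs n)) \<partial>(ang \<Otimes>\<^sub>M lborel))
     \<longlonglongrightarrow> 1 / (2 * pi) * (\<integral>q. indicator {0<..} (snd q) * (g (x + snd q *\<^sub>R dir (fst q)) * (B (fst q) / (4 * \<rho>))) \<partial>(ang \<Otimes>\<^sub>M lborel))"
    unfolding step by (rule tendsto_mult_left[OF right_limit(2)])
  from LIMSEQ_unique[OF left_limit(2) this] show ?thesis .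
qed

text \<open>The inner time integral of the theorem, for the solution with data \<open>g\<close>,
  after the substitution t = sqrt (p + v^2) justified in
  \<open>half_line_substitution\<close>.\<close>

definition W :: "real \<Rightarrow> real" where
  "W \<alpha> = (\<integral>v. indicator {0..} v * (poisson_sol g g1 g2 (y \<alpha>) (sqrt (p \<alpha> + v\<^sup>2)) / sqrt (p \<alpha> + v\<^sup>2)) \<partial>lborel)"

lemma weighted_average:
  shows "integrable ang (\<lambda>\<alpha>. \<psi> \<alpha> * W \<alpha>)"
    and "(\<integral>\<alpha>. \<psi> \<alpha> * W \<alpha> \<partial>ang)
      = 1 / pi * (\<integral>q. indicator {0<..} (snd q) * (g (x + snd q *\<^sub>R dir (fst q)) * (B (fst q) / (4 * \<rho>))) \<partial>(ang \<Otimes>\<^sub>M lborel))"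
proof -
  let ?HL = "\<lambda>q. indicator {0..} (snd q) * (\<psi> (fst q) *
      (poisson_sol g g1 g2 (y (fst q)) (sqrt (p (fst q) + (snd q)\<^sup>2)) / (2 * sqrt (p (fst q) + (snd q)\<^sup>2))))"
  have inner: "(\<integral>v. ?HL (\<alpha>, v) \<partial>lborel) = \<psi> \<alpha> * W \<alpha> / 2" for \<alpha>
  proof -
    have "(\<integral>v. ?HL (\<alpha>, v) \<partial>lborel) = (\<integral>v. (\<psi> \<alpha> / 2) * (indicator {0..} v * (poisson_sol g g1 g2 (y \<alpha>) (sqrt (p \<alpha> + v\<^sup>2)) / sqrt (p \<alpha> + v\<^sup>2))) \<partial>lborel)"
      by (rule Bochner_Integration.integral_cong) auto
    then show ?thesis unfolding integral_mult_right_zero W_def by simp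
  qed
  \<comment> \<open>The factor 2 undoes the 1 / (2 t) from differentiating the square root; likewise
    1 / (2 pi) becomes 1 / pi below.\<close>
  have "integrable ang (\<lambda>\<alpha>. 2 * (\<integral>v. ?HL (\<alpha>, v) \<partial>lborel))"
    by (intro integrable_mult_right icc_lborel.integrable_fst' left_limit(1))
  then show "integrable ang (\<lambda>\<alpha>. \<psi> \<alpha> * W \<alpha>)" unfolding inner by simp
  have "(\<integral>\<alpha>. \<psi> \<alpha> * W \<alpha> / 2 \<partial>ang) = (\<integral>q. ?HL q \<partial>(ang \<Otimes>\<^sub>M lborel))"
    unfolding inner[symmetric] by (rule icc_lborel.integral_fst'[OF left_limit(1)])
  then show "(\<integral>\<alpha>. \<psi> \<alpha> * W \<alpha> \<partial>ang)
      = 1 / pi * (\<integral>q. indicator {0<..} (snd q) * (g (x + snd q *\<^sub>R dir (fst q)) * (B (fst q) / (4 * \<rho>))) \<partial>(ang \<Otimes>\<^sub>M lborel))"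
    unfolding limits_agree by simp
qed

end

text \<open>With t = sqrt (r^2 + v^2) one has dt / sqrt (t^2 - r^2) = dv / t. The substitution rule
  for signed integrands needs integrability on both sides, so the nonnegative majorant C / t is
  transformed first; it dominates \<open>Q\<close> on the t-side, and the bound C / (r^2 + v^2)
  settles the v-side. This is why \<open>contQ\<close> and \<open>pv\<close> are stated for a
  general \<open>P\<close>.\<close>

lemma half_line_substitution:
  fixes Q :: "real \<Rightarrow> real"
  assumes r: "r > 0" and Q: "continuous_on {0<..} Q" and bound: "\<And>t. t > 0 \<Longrightarrow> \<bar>Q t\<bar> \<le> C / t"
  shows "set_integrable lborel {r<..} (\<lambda>t. Q t / sqrt (t\<^sup>2 - r\<^sup>2))"
    and "(LINT t:{r<..}|lborel. Q t / sqrt (t\<^sup>2 - r\<^sup>2)) = (\<integral>v. indicator {0..} v * (Q (sqrt (r\<^sup>2 + v\<^sup>2)) / sqrt (r\<^sup>2 + v\<^sup>2)) \<partial>lborel)"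
proof -
  define G where "G = (\<lambda>v. sqrt (r\<^sup>2 + v\<^sup>2))"
  define G' where "G' = (\<lambda>v. v / sqrt (r\<^sup>2 + v\<^sup>2))"
  have C: "C \<ge> 0" using bound[of 1] by simp
  have pos: "r\<^sup>2 + v\<^sup>2 > 0" for v using r by (simp add: add_pos_nonneg)
  have Gr: "G v > r" if "v > 0" for v
    unfolding G_def using that r by (intro real_less_rsqrt) simp
  have G: "(G has_real_derivative G' v) (at v)" for v
    unfolding G_def G'_def using pos[of v] by (auto intro!: derivative_eq_intros simp: field_simps)
  have contG': "isCont G' v" for v
    unfolding G'_def using pos[of v] by (auto intro!: continuous_intros)
  have G'0: "G' v \<ge> 0" if "v \<ge> 0" for v using that by (simp add: G'_def)
  have Gd: "(G v)\<^sup>2 - r\<^sup>2 = v\<^sup>2" for v using pos[of v] by (simp add: G_def)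
  have contQ: "isCont (\<lambda>t. P t / sqrt (t\<^sup>2 - r\<^sup>2)) t" if "continuous_on {0<..} P" "t > r" for P t
  proof -
    have "isCont P t" using that r by (simp add: continuous_on_eq_continuous_at)
    moreover have "t\<^sup>2 - r\<^sup>2 > 0" using that r by (simp add: power_strict_mono)
    ultimately show ?thesis by (auto intro!: continuous_intros)
  qed
  have l0: "((ereal \<circ> G \<circ> real_of_ereal) \<longlongrightarrow> ereal r) (at_right (ereal 0))"
  proof -
    have "isCont G 0" using G[of 0] by (rule DERIV_isCont)
    then have "(G \<longlongrightarrow> G 0) (at_right 0)" by (auto simp: isCont_def intro: tendsto_within_subset)
    then show ?thesis using r by (simp add: ereal_tendsto_simps G_def)
  qed
  have l1: "((ereal \<circ> G \<circ> real_of_ereal) \<longlongrightarrow> \<infinity>) (at_left \<infinity>)"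
  proof -
    have "filterlim G at_top at_top"
    proof (rule filterlim_at_top_mono[OF filterlim_ident])
      show "\<forall>\<^sub>F v in at_top. v \<le> G v"
        using eventually_ge_at_top[of 0] by eventually_elim (auto simp: G_def intro!: real_le_rsqrt)
    qed
    then show ?thesis by (simp add: ereal_tendsto_simps)
  qed
  have e1: "einterval (ereal r) \<infinity> = {r<..}" "einterval (ereal 0) \<infinity> = {0<..}" by (auto simp: einterval_def)
  have fg: "G' v * (P (G v) / sqrt ((G v)\<^sup>2 - r\<^sup>2)) = P (G v) / G v" if "v > 0" for v P
    using that by (simp add: Gd G'_def) (simp add: G_def)
  have pv: "set_integrable lborel {0<..} (\<lambda>v. P (G v) / G v)"
    if P: "continuous_on {0<..} P" "\<And>t. t > 0 \<Longrightarrow> \<bar>P t\<bar> \<le> C / t" for P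
    unfolding set_integrable_def
  proof (rule Bochner_Integration.integrable_bound)
    show "integrable lborel (\<lambda>v. C * (indicator {0..} v * (1 / (r\<^sup>2 + v\<^sup>2))))"
      using r by (intro integrable_mult_right integrable_inverse_square) simp
    have "continuous_on {0<..} (\<lambda>v. P (G v) / G v)"
      unfolding G_def using pos by (intro continuous_intros continuous_on_compose2[OF P(1)]) (auto simp: less_imp_neq[symmetric])
    then show "(\<lambda>v. indicator {0<..} v *\<^sub>R (P (G v) / G v)) \<in> borel_measurable lborel"
      by (simp add: borel_measurable_continuous_on_indicator del: real_scaleR_def)
    have "\<bar>P (G v) / G v\<bar> \<le> C * (1 / (r\<^sup>2 + v\<^sup>2))" for v
    proof -
      have g: "G v > 0" using pos[of v] by (simp add: G_def)
      then have "\<bar>P (G v)\<bar> / G v \<le> C / G v / G v" using P(2)[of "G v"] by (intro divide_right_mono) auto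
      also have "\<dots> = C * (1 / (r\<^sup>2 + v\<^sup>2))" using pos[of v] by (simp add: G_def)
      finally show ?thesis using g by (simp add: abs_divide)
    qed
    then show "AE v in lborel. norm (indicator {0<..} v *\<^sub>R (P (G v) / G v)) \<le> norm (C * (indicator {0..} v * (1 / (r\<^sup>2 + v\<^sup>2))))"
      using C pos by (auto simp: indicator_def abs_mult less_imp_le)
  qed
  have cont0: "continuous_on {0<..} (\<lambda>t. C / t)" by (intro continuous_intros) auto
  have bd: "set_integrable lborel {r<..} (\<lambda>t. (C / t) / sqrt (t\<^sup>2 - r\<^sup>2))"
    unfolding e1(1)[symmetric]
  proof (rule interval_integral_substitution_nonneg(1)[OF _ _ _ _ _ _ l0 l1])
    show "isCont (\<lambda>t. C / t / sqrt (t\<^sup>2 - r\<^sup>2)) (G v)" if "ereal 0 < ereal v" for v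
      by (rule contQ[OF cont0]) (use Gr that in auto)
    show "0 \<le> C / G v / sqrt ((G v)\<^sup>2 - r\<^sup>2)" if "ereal 0 < ereal v" for v
      using that Gr[of v] r C by (simp add: Gd)
    have "set_integrable lborel {0<..} (\<lambda>v. C / G v / G v)"
      by (rule pv[OF cont0]) (use C in auto)
    then show "set_integrable lborel (einterval (ereal 0) \<infinity>) (\<lambda>v. C / G v / sqrt ((G v)\<^sup>2 - r\<^sup>2) * G' v)"
      unfolding e1 by (rule set_integrable_cong[THEN iffD1, rotated 3]) (use fg[of _ "\<lambda>t. C / t"] in \<open>auto simp: mult.commute\<close>)
  qed (use G contG' G'0 in auto)
  show int: "set_integrable lborel {r<..} (\<lambda>t. Q t / sqrt (t\<^sup>2 - r\<^sup>2))"
  proof (rule set_integrable_bound[OF bd])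
    have "continuous_on {r<..} (\<lambda>t. Q t / sqrt (t\<^sup>2 - r\<^sup>2))"
      using contQ[OF Q] by (auto intro!: continuous_at_imp_continuous_on)
    then show "set_borel_measurable lborel {r<..} (\<lambda>t. Q t / sqrt (t\<^sup>2 - r\<^sup>2))"
      unfolding set_borel_measurable_def
      by (simp add: borel_measurable_continuous_on_indicator del: real_scaleR_def)
    show "AE t in lborel. t \<in> {r<..} \<longrightarrow> norm (Q t / sqrt (t\<^sup>2 - r\<^sup>2)) \<le> norm (C / t / sqrt (t\<^sup>2 - r\<^sup>2))"
    proof (intro AE_I2 impI)
      fix t assume "t \<in> {r<..}"
      then have t: "t > 0" using r by auto
      then have "\<bar>Q t\<bar> \<le> \<bar>C / t\<bar>" using bound[of t] C by auto
      then show "norm (Q t / sqrt (t\<^sup>2 - r\<^sup>2)) \<le> norm (C / t / sqrt (t\<^sup>2 - r\<^sup>2))"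
        unfolding real_norm_def abs_divide[of _ "sqrt _"] by (intro divide_right_mono) auto
    qed
  qed
  have "(LINT t:{r<..}|lborel. Q t / sqrt (t\<^sup>2 - r\<^sup>2)) = (LBINT t=ereal r..\<infinity>. Q t / sqrt (t\<^sup>2 - r\<^sup>2))"
    by (simp add: interval_integral_to_infinity_eq)
  also have "\<dots> = (LBINT v=ereal 0..\<infinity>. G' v *\<^sub>R (Q (G v) / sqrt ((G v)\<^sup>2 - r\<^sup>2)))"
  proof (rule interval_integral_substitution_integrable[OF _ _ _ _ _ l0 l1])
    show "isCont (\<lambda>t. Q t / sqrt (t\<^sup>2 - r\<^sup>2)) (G v)" if "ereal 0 < ereal v" for v
      by (rule contQ[OF Q]) (use Gr that in auto)
    show "set_integrable lborel (einterval (ereal r) \<infinity>) (\<lambda>t. Q t / sqrt (t\<^sup>2 - r\<^sup>2))" using int by (simp add: e1)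
    have "set_integrable lborel {0<..} (\<lambda>v. Q (G v) / G v)" by (rule pv[OF Q bound])
    then show "set_integrable lborel (einterval (ereal 0) \<infinity>) (\<lambda>v. G' v *\<^sub>R (Q (G v) / sqrt ((G v)\<^sup>2 - r\<^sup>2)))"
      unfolding e1 by (rule set_integrable_cong[THEN iffD1, rotated 3]) (use fg[of _ Q] in auto)
  qed (use G contG' G'0 in auto)
  also have "\<dots> = (LINT v:{0<..}|lborel. Q (G v) / G v)"
    unfolding interval_integral_to_infinity_eq by (rule set_lebesgue_integral_cong) (use fg[of _ Q] in auto)
  also have "\<dots> = (\<integral>v. indicator {0..} v * (Q (sqrt (r\<^sup>2 + v\<^sup>2)) / sqrt (r\<^sup>2 + v\<^sup>2)) \<partial>lborel)"
    unfolding set_lebesgue_integral_def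
  proof (rule integral_discrete_difference[of "{0}"])
  qed (auto simp: indicator_def G_def)
  finally show "(LINT t:{r<..}|lborel. Q t / sqrt (t\<^sup>2 - r\<^sup>2)) = (\<integral>v. indicator {0..} v * (Q (sqrt (r\<^sup>2 + v\<^sup>2)) / sqrt (r\<^sup>2 + v\<^sup>2)) \<partial>lborel)" .
qed

section \<open>The inversion formula\<close>

lemma circle_measure_eq_ang:
  fixes I :: "real^2 \<Rightarrow> real"
  assumes rho: "\<rho> > 0" and I[measurable]: "I \<in> borel_measurable borel"
  shows "integrable (circle_measure z \<rho>) I \<longleftrightarrow> integrable ang (\<lambda>\<alpha>. I (z + \<rho> *\<^sub>R dir \<alpha>))"
    and "(\<integral>y. I y \<partial>circle_measure z \<rho>) = \<rho> * (\<integral>\<alpha>. I (z + \<rho> *\<^sub>R dir \<alpha>) \<partial>ang)"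
proof -
  let ?T = "\<lambda>s. z + \<rho> *\<^sub>R dir (s / \<rho>)"
  let ?F = "\<lambda>s. indicator {0..<2 * pi * \<rho>} s *\<^sub>R I (?T s)"
  have T: "?T \<in> restrict_space lborel {0..<2 * pi * \<rho>} \<rightarrow>\<^sub>M borel"
    by (rule measurable_restrict_space1) measurable
  have F: "?F (0 + \<rho> * \<alpha>) = indicator {0..<2 * pi} \<alpha> *\<^sub>R I (z + \<rho> *\<^sub>R dir \<alpha>)" for \<alpha>
    using rho by (simp add: indicator_def zero_le_mult_iff mult.commute)
  have ae: "AE \<alpha> in lborel. indicator {0..<2 * pi} \<alpha> *\<^sub>R I (z + \<rho> *\<^sub>R dir \<alpha>) = indicator {0..2 * pi} \<alpha> *\<^sub>R I (z + \<rho> *\<^sub>R dir \<alpha>)"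
    using AE_lborel_singleton[of "2 * pi"] by eventually_elim (auto simp: indicator_def)
  have "integrable (circle_measure z \<rho>) I \<longleftrightarrow> integrable lborel ?F"
    unfolding circle_measure_def dir_def[symmetric] integrable_distr_eq[OF T I]
    by (subst integrable_restrict_space) auto
  also have "\<dots> \<longleftrightarrow> integrable lborel (\<lambda>\<alpha>. ?F (0 + \<rho> * \<alpha>))"
    using rho by (subst lborel_integrable_real_affine_iff) auto
  also have "\<dots> \<longleftrightarrow> integrable lborel (\<lambda>\<alpha>. indicator {0..2 * pi} \<alpha> *\<^sub>R I (z + \<rho> *\<^sub>R dir \<alpha>))"
    unfolding F by (rule integrable_cong_AE[OF _ _ ae]) auto
  also have "\<dots> \<longleftrightarrow> integrable ang (\<lambda>\<alpha>. I (z + \<rho> *\<^sub>R dir \<alpha>))"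
    by (subst integral_icc(2)) (auto simp: set_integrable_def)
  finally show "integrable (circle_measure z \<rho>) I \<longleftrightarrow> integrable ang (\<lambda>\<alpha>. I (z + \<rho> *\<^sub>R dir \<alpha>))" .
  have "(\<integral>y. I y \<partial>circle_measure z \<rho>) = (\<integral>s. ?F s \<partial>lborel)"
    unfolding circle_measure_def dir_def[symmetric] integral_distr[OF T I]
    by (subst integral_restrict_space) auto
  also have "\<dots> = \<rho> * (\<integral>\<alpha>. ?F (0 + \<rho> * \<alpha>) \<partial>lborel)"
    using rho by (subst lborel_integral_real_affine[where c = \<rho> and t = 0]) auto
  also have "(\<integral>\<alpha>. ?F (0 + \<rho> * \<alpha>) \<partial>lborel) = (\<integral>\<alpha>. indicator {0..2 * pi} \<alpha> *\<^sub>R I (z + \<rho> *\<^sub>R dir \<alpha>) \<partial>lborel)"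
    unfolding F by (rule integral_cong_AE[OF _ _ ae]) auto
  also have "\<dots> = (\<integral>\<alpha>. I (z + \<rho> *\<^sub>R dir \<alpha>) \<partial>ang)"
    by (subst integral_icc(1)) (auto simp: set_lebesgue_integral_def)
  finally show "(\<integral>y. I y \<partial>circle_measure z \<rho>) = \<rho> * (\<integral>\<alpha>. I (z + \<rho> *\<^sub>R dir \<alpha>) \<partial>ang)" .
qed

lemma (in ball_data) radial_integral:
  "(\<integral>\<kappa>. indicator {0<..} \<kappa> * (cos \<beta> * g1 (x + \<kappa> *\<^sub>R dir \<beta>) + sin \<beta> * g2 (x + \<kappa> *\<^sub>R dir \<beta>)) \<partial>lborel) = - g x"
proof -
  define D where "D = (\<lambda>\<kappa>. cos \<beta> * g1 (x + \<kappa> *\<^sub>R dir \<beta>) + sin \<beta> * g2 (x + \<kappa> *\<^sub>R dir \<beta>))"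
  have out: "x + \<kappa> *\<^sub>R dir \<beta> \<notin> ball z \<rho>" if "\<kappa> > 2 * \<rho>" for \<kappa>
    using kappa_bound[of \<kappa> \<beta>] that rho by auto
  have contD: "continuous_on UNIV D"
    unfolding D_def by (intro continuous_intros continuous_on_compose2[OF cont_g1] continuous_on_compose2[OF cont_g2]) auto
  then have [measurable]: "D \<in> borel_measurable borel" by (rule borel_measurable_continuous_onI)
  have der: "((\<lambda>\<kappa>. g (x + \<kappa> *\<^sub>R dir \<beta>)) has_real_derivative D \<kappa>) (at \<kappa>)" for \<kappa>
  proof -
    have "((\<lambda>\<kappa>. x + \<kappa> *\<^sub>R dir \<beta>) has_vector_derivative dir \<beta>) (at \<kappa>)" by (auto intro!: derivative_eq_intros)
    from grad2_path[OF grad this] show ?thesis by (simp add: D_def)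
  qed
  \<comment> \<open>Beyond radius 2 \<rho> every ray from x is outside the ball, where
    \<open>g1\<close> and \<open>g2\<close> vanish; 2 \<rho> + 1 is a radius strictly beyond it, so
    \<open>g\<close> vanishes there as well.\<close>
  have "(\<integral>\<kappa>. indicator {0<..} \<kappa> * D \<kappa> \<partial>lborel) = (\<integral>\<kappa>. D \<kappa> * indicator {0..2 * \<rho> + 1} \<kappa> \<partial>lborel)"
  proof (rule integral_cong_AE)
    have "AE \<kappa> in lborel. \<kappa> \<noteq> (0 :: real)" by (rule AE_lborel_singleton)
    then show "AE \<kappa> in lborel. indicator {0<..} \<kappa> * D \<kappa> = D \<kappa> * indicator {0..2 * \<rho> + 1} \<kappa>"
    proof eventually_elim
      case (elim \<kappa>)
      have "D \<kappa> = 0" if "\<kappa> > 2 * \<rho>" using vanish out[OF that] by (simp add: D_def)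
      then show ?case using elim by (auto simp: indicator_def)
    qed
  qed auto
  also have "\<dots> = g (x + (2 * \<rho> + 1) *\<^sub>R dir \<beta>) - g (x + 0 *\<^sub>R dir \<beta>)"
    by (rule integral_FTC_Icc_real)
      (use rho der contD in \<open>auto simp: continuous_on_eq_continuous_at\<close>)
  also have "\<dots> = - g x" using out[of "2 * \<rho> + 1"] vanish(1) by simp
  finally show ?thesis by (simp add: D_def)
qed

theorem theorem3p4:
  fixes z :: "real^2" and \<rho> a b :: real
    and f :: "real^2 \<Rightarrow> real" and u :: "real^2 \<Rightarrow> real \<Rightarrow> real"
  assumes "\<rho> > 0"
    and "f \<in> smooth_compact_support (ball z \<rho>)"
    and "wave_solution f u"
    and "a \<ge> 0" and "b > 0"
  shows "\<forall>x\<in>ball z \<rho>.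
    (\<forall>y\<in>sphere z \<rho>. set_integrable lborel {norm (x - y)<..}
       (\<lambda>t. (a * u y t + b * normal_deriv z \<rho> u y t) / sqrt (t\<^sup>2 - (norm (x - y))\<^sup>2))) \<and>
    integrable (circle_measure z \<rho>)
       (\<lambda>y. LINT t:{norm (x - y)<..}|lborel.
          (a * u y t + b * normal_deriv z \<rho> u y t) / sqrt (t\<^sup>2 - (norm (x - y))\<^sup>2)) \<and>
    f x = 1 / (b * pi) *
      (LINT y|circle_measure z \<rho>. (LINT t:{norm (x - y)<..}|lborel.
         (a * u y t + b * normal_deriv z \<rho> u y t) / sqrt (t\<^sup>2 - (norm (x - y))\<^sup>2)))"
proof
  fix x assume x: "x \<in> ball z \<rho>"
  note rho = assms(1) and b = assms(5)
  have cl: "closure {x. f x \<noteq> 0} \<subseteq> ball z \<rho>"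
    using assms(2) by (simp add: smooth_compact_support_def)
  obtain f1 f2 f11 f12 f22 where
    grads: "grad2 f f1 f2" "grad2 f1 f11 f12" "grad2 f2 f12 f22"
    and cont2: "continuous_on UNIV f11" "continuous_on UNIV f12" "continuous_on UNIV f22"
    and zero: "\<And>g x. g \<in> {f, f1, f2, f11, f12, f22} \<Longrightarrow> x \<notin> ball z \<rho> \<Longrightarrow> g x = 0"
    and U: "\<And>y t. t > 0 \<Longrightarrow> u y t = poisson_sol f f1 f2 y t"
    and U1: "\<And>y t. t > 0 \<Longrightarrow> grad (\<lambda>x. u x t) y $ 1 = poisson_sol f1 f11 f12 y t"
    and U2: "\<And>y t. t > 0 \<Longrightarrow> grad (\<lambda>x. u x t) y $ 2 = poisson_sol f2 f12 f22 y t"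
    by (rule wave_solution_poisson[OF assms(3) cl]) (rule that)
  note cont = grads[THEN grad2_continuous] cont2
  have xz: "norm (x - z) < \<rho>" using x by (simp add: dist_norm norm_minus_commute)
  interpret D0: weighted_ball_data z x \<rho> f f1 f2 "\<lambda>_. 1" "\<lambda>_. 0" "2 * (\<integral>\<theta>. logsin \<theta> \<partial>ang) - 2 * pi * ln 2"
    by unfold_locales (use rho xz grads cont zero log_cos_values(1) in auto)
  interpret D1: weighted_ball_data z x \<rho> f1 f11 f12 cos "\<lambda>\<beta>. - 2 * pi * cos \<beta>" 0
    by unfold_locales
      (use rho xz grads cont zero log_cos_values(2) in \<open>auto simp: abs_mult intro!: continuous_intros\<close>)
  interpret D2: weighted_ball_data z x \<rho> f2 f12 f22 sin "\<lambda>\<beta>. - 2 * pi * sin \<beta>" 0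
    by unfold_locales
      (use rho xz grads cont zero log_cos_values(3) in \<open>auto simp: abs_mult intro!: continuous_intros\<close>)
  define q where "q = (\<lambda>y t. a * u y t + b * normal_deriv z \<rho> u y t)"
  \<comment> \<open>The integrand \<open>q\<close> rewritten by Poisson's formula. The two agree for
    t > 0, which covers the range of integration because it starts at a norm.\<close>
  define s where "s = (\<lambda>y t. a * poisson_sol f f1 f2 y t + b * ((y - z) $ 1 / \<rho> * poisson_sol f1 f11 f12 y t + (y - z) $ 2 / \<rho> * poisson_sol f2 f12 f22 y t))"
  have qs: "q y t = s y t" if "t > 0" for y t
    unfolding q_def s_def normal_deriv_def outward_normal_def inner_vec2 U1[OF that] U2[OF that]
    unfolding U[OF that] by (simp add: mult.commute)
  define I where "I = (\<lambda>y. LINT t:{norm (x - y)<..}|lborel. q y t / sqrt (t\<^sup>2 - (norm (x - y))\<^sup>2))"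
  have Iq: "I y = (LINT t:{norm (x - y)<..}|lborel. s y t / sqrt (t\<^sup>2 - (norm (x - y))\<^sup>2))" for y
    unfolding I_def by (rule set_lebesgue_integral_cong) (auto intro!: arg_cong2[of _ _ _ _ "(/)"] qs intro: le_less_trans[OF norm_ge_zero])
  note contsol = continuous_on_poisson_sol[OF cont(1-3)] continuous_on_poisson_sol[OF cont(2,4,5)] continuous_on_poisson_sol[OF cont(3,5,6)]
  \<comment> \<open>Joint measurability in y and t is drawn from the continuity of
    \<open>poisson_sol\<close> in both variables; the lower limit, which depends on y, is put into
    an indicator.\<close>
  have [measurable]: "I \<in> borel_measurable borel"
  proof -
    have solm: "(\<lambda>p. poisson_sol g g1 g2 (fst p) (snd p)) \<in> borel_measurable (borel \<Otimes>\<^sub>M borel)"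
      if "continuous_on UNIV (\<lambda>p. poisson_sol g g1 g2 (fst p) (snd p))" for g g1 g2
      unfolding borel_prod by (rule borel_measurable_continuous_onI[OF that])
    note [measurable] = contsol[THEN solm]
    have nth[measurable]: "(\<lambda>p. k p $ i) \<in> borel_measurable M" if "k \<in> borel_measurable M"
      for k :: "_ \<Rightarrow> real^2" and i and M :: "((real^2) \<times> real) measure"
      using measurable_compose[OF that borel_measurable_vec_nth2] .
    have ss: "sets (borel \<Otimes>\<^sub>M lborel) = sets ((borel :: (real^2) measure) \<Otimes>\<^sub>M (borel :: real measure))"
      by (intro sets_pair_measure_cong) auto
    have "(\<lambda>p. (if norm (x - fst p) < snd p then 1 else 0) * (s (fst p) (snd p) / sqrt ((snd p)\<^sup>2 - (norm (x - fst p))\<^sup>2)))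
        \<in> borel_measurable (borel \<Otimes>\<^sub>M borel)"
      unfolding s_def by measurable
    also have "(\<lambda>p. (if norm (x - fst p) < snd p then 1 else 0) * (s (fst p) (snd p) / sqrt ((snd p)\<^sup>2 - (norm (x - fst p))\<^sup>2)))
      = (\<lambda>(y, t). indicator {norm (x - y)<..} t *\<^sub>R (s y t / sqrt (t\<^sup>2 - (norm (x - y))\<^sup>2)))"
      by (auto simp: fun_eq_iff indicator_def)
    also have "borel_measurable (borel \<Otimes>\<^sub>M borel) = borel_measurable ((borel :: (real^2) measure) \<Otimes>\<^sub>M (lborel :: real measure))"
      by (rule measurable_cong_sets[OF ss[symmetric] refl])
    finally have "(\<lambda>y. \<integral>t. indicator {norm (x - y)<..} t *\<^sub>R (s y t / sqrt (t\<^sup>2 - (norm (x - y))\<^sup>2)) \<partial>lborel) \<in> borel_measurable borel"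
      by (rule lborel.borel_measurable_lebesgue_integral)
    then show ?thesis unfolding Iq set_lebesgue_integral_def[abs_def] by simp
  qed
  obtain C0 where C0: "\<And>y t. norm (y - z) \<le> \<rho> \<Longrightarrow> t > 0 \<Longrightarrow> \<bar>poisson_sol f f1 f2 y t\<bar> \<le> C0 / t"
    using poisson_sol_bound[OF cont(1-3) D0.vanish] by blast
  obtain C1 where C1: "\<And>y t. norm (y - z) \<le> \<rho> \<Longrightarrow> t > 0 \<Longrightarrow> \<bar>poisson_sol f1 f11 f12 y t\<bar> \<le> C1 / t"
    using poisson_sol_bound[OF cont(2,4,5) D1.vanish] by blast
  obtain C2 where C2: "\<And>y t. norm (y - z) \<le> \<rho> \<Longrightarrow> t > 0 \<Longrightarrow> \<bar>poisson_sol f2 f12 f22 y t\<bar> \<le> C2 / t"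
    using poisson_sol_bound[OF cont(3,5,6) D2.vanish] by blast
  have csol: "continuous_on {0<..} (poisson_sol g g1 g2 y)" if "continuous_on UNIV (\<lambda>p. poisson_sol g g1 g2 (fst p) (snd p))" for g g1 g2 y
  proof -
    have "continuous_on {0<..} (\<lambda>t :: real. (y, t))" by (intro continuous_intros)
    from continuous_on_compose2[OF that this] show ?thesis by simp
  qed
  have on_circle: "set_integrable lborel {norm (x - y)<..} (\<lambda>t. s y t / sqrt (t\<^sup>2 - (norm (x - y))\<^sup>2))"
    "I y = a * D0.W \<alpha> + b * (cos \<alpha> * D1.W \<alpha> + sin \<alpha> * D2.W \<alpha>)" if y: "y = z + \<rho> *\<^sub>R dir \<alpha>" for y \<alpha>
  proof -
    have yd: "y = D0.y \<alpha>" by (simp add: y D0.y_def)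
    have r: "norm (x - y) > 0" "(norm (x - y))\<^sup>2 = D0.p \<alpha>"
      using D0.p_ge[of \<alpha>] D0.p0_pos by (auto simp: yd D0.p_def)
    have ny: "norm (y - z) \<le> \<rho>" using rho by (simp add: y)
    note h0 = half_line_substitution[OF r(1) csol[OF contsol(1)] C0[OF ny]]
    note h1 = half_line_substitution[OF r(1) csol[OF contsol(2)] C1[OF ny]]
    note h2 = half_line_substitution[OF r(1) csol[OF contsol(3)] C2[OF ny]]
    have split: "s y t / sqrt (t\<^sup>2 - (norm (x - y))\<^sup>2) = a * (poisson_sol f f1 f2 y t / sqrt (t\<^sup>2 - (norm (x - y))\<^sup>2))
       + (b * cos \<alpha> * (poisson_sol f1 f11 f12 y t / sqrt (t\<^sup>2 - (norm (x - y))\<^sup>2))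
        + b * sin \<alpha> * (poisson_sol f2 f12 f22 y t / sqrt (t\<^sup>2 - (norm (x - y))\<^sup>2)))" for t
      using rho by (simp add: s_def y add_divide_distrib distrib_left)
    note i0 = set_integrable_mult_right[OF h0(1), of a]
    note i1 = set_integrable_mult_right[OF h1(1), of "b * cos \<alpha>"]
    note i2 = set_integrable_mult_right[OF h2(1), of "b * sin \<alpha>"]
    show "set_integrable lborel {norm (x - y)<..} (\<lambda>t. s y t / sqrt (t\<^sup>2 - (norm (x - y))\<^sup>2))"
      unfolding split by (intro set_integral_add(1) i0 i1 i2)
    have W: "(LINT t:{norm (x - y)<..}|lborel. poisson_sol f f1 f2 y t / sqrt (t\<^sup>2 - (norm (x - y))\<^sup>2)) = D0.W \<alpha>"
      "(LINT t:{norm (x - y)<..}|lborel. poisson_sol f1 f11 f12 y t / sqrt (t\<^sup>2 - (norm (x - y))\<^sup>2)) = D1.W \<alpha>"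
      "(LINT t:{norm (x - y)<..}|lborel. poisson_sol f2 f12 f22 y t / sqrt (t\<^sup>2 - (norm (x - y))\<^sup>2)) = D2.W \<alpha>"
      by (simp_all only: D0.W_def D1.W_def D2.W_def yd[symmetric] r(2)[symmetric] h0(2) h1(2) h2(2))
    show "I y = a * D0.W \<alpha> + b * (cos \<alpha> * D1.W \<alpha> + sin \<alpha> * D2.W \<alpha>)"
      unfolding Iq split
      by (simp only: set_integral_add(2)[OF i0 set_integral_add(1)[OF i1 i2]] set_integral_add(2)[OF i1 i2]
          set_integral_mult_right W)
        (simp add: algebra_simps)
  qed
  have part1: "set_integrable lborel {norm (x - y)<..} (\<lambda>t. q y t / sqrt (t\<^sup>2 - (norm (x - y))\<^sup>2))" if "y \<in> sphere z \<rho>" for y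
  proof -
    have "y - z \<noteq> 0" using that rho by auto
    then obtain \<kappa> \<alpha> where k: "\<kappa> > 0" "y - z = \<kappa> *\<^sub>R dir \<alpha>" by (rule polar_repr)
    then have "norm (y - z) = \<kappa>" by simp
    then have "\<kappa> = \<rho>" using that by (simp add: dist_norm norm_minus_commute)
    then have "y = z + \<rho> *\<^sub>R dir \<alpha>" using k by (simp add: algebra_simps)
    from on_circle(1)[OF this] show ?thesis
      by (rule set_integrable_cong[THEN iffD1, rotated 3])
        (auto intro!: arg_cong2[of _ _ _ _ "(/)"] qs[symmetric] intro: le_less_trans[OF norm_ge_zero])
  qed
  note A0 = D0.weighted_average and A1 = D1.weighted_average and A2 = D2.weighted_average
  have I_ang: "(\<lambda>\<alpha>. I (z + \<rho> *\<^sub>R dir \<alpha>)) = (\<lambda>\<alpha>. a * (1 * D0.W \<alpha>) + b * (cos \<alpha> * D1.W \<alpha> + sin \<alpha> * D2.W \<alpha>))"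
    using on_circle(2)[OF refl] by simp
  have part2: "integrable (circle_measure z \<rho>) I"
    unfolding circle_measure_eq_ang(1)[OF rho \<open>I \<in> borel_measurable borel\<close>] I_ang
    by (intro Bochner_Integration.integrable_add integrable_mult_right A0(1) A1(1) A2(1))
  have vals: "(\<integral>\<alpha>. 1 * D0.W \<alpha> \<partial>ang) = 0" by (simp only: A0(2)) simp
  \<comment> \<open>Here B \<beta> / (4 \<rho>) is - pi cos \<beta> / (2 \<rho>), or the same with
    sin, so the two integrands combine to the radial derivative of \<open>f\<close>. Each ray then
    gives pi f(x) / (2 \<rho>), the angle contributes 2 pi, and the prefactor is 1 / pi.\<close>
  have vals': "(\<integral>\<alpha>. cos \<alpha> * D1.W \<alpha> \<partial>ang) + (\<integral>\<alpha>. sin \<alpha> * D2.W \<alpha> \<partial>ang) = pi * f x / \<rho>"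
  proof -
    let ?M = "ang \<Otimes>\<^sub>M lborel"
    define G1 where "G1 = (\<lambda>q. indicator {0<..} (snd q) * (f1 (x + snd q *\<^sub>R dir (fst q)) * ((- 2 * pi * cos (fst q)) / (4 * \<rho>))))"
    define G2 where "G2 = (\<lambda>q. indicator {0<..} (snd q) * (f2 (x + snd q *\<^sub>R dir (fst q)) * ((- 2 * pi * sin (fst q)) / (4 * \<rho>))))"
    have i: "integrable ?M G1" "integrable ?M G2"
      unfolding G1_def G2_def by (rule D1.right_limit(1) D2.right_limit(1))+
    have "(\<integral>\<alpha>. cos \<alpha> * D1.W \<alpha> \<partial>ang) + (\<integral>\<alpha>. sin \<alpha> * D2.W \<alpha> \<partial>ang) = 1 / pi * (\<integral>q. G1 q + G2 q \<partial>?M)"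
      unfolding A1(2) A2(2) G1_def[symmetric] G2_def[symmetric]
      using i by (simp add: Bochner_Integration.integral_add add_divide_distrib)
    also have "(\<integral>q. G1 q + G2 q \<partial>?M) = (\<integral>\<beta>. \<integral>\<kappa>. G1 (\<beta>, \<kappa>) + G2 (\<beta>, \<kappa>) \<partial>lborel \<partial>ang)"
      using i by (intro icc_lborel.integral_fst'[symmetric] Bochner_Integration.integrable_add)
    also have "\<dots> = (\<integral>\<beta>. pi / (2 * \<rho>) * f x \<partial>ang)"
    proof (rule Bochner_Integration.integral_cong[OF refl])
      fix \<beta>
      have "(\<integral>\<kappa>. G1 (\<beta>, \<kappa>) + G2 (\<beta>, \<kappa>) \<partial>lborel)
        = (\<integral>\<kappa>. - (pi / (2 * \<rho>)) * (indicator {0<..} \<kappa> * (cos \<beta> * f1 (x + \<kappa> *\<^sub>R dir \<beta>) + sin \<beta> * f2 (x + \<kappa> *\<^sub>R dir \<beta>))) \<partial>lborel)"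
        using rho by (intro Bochner_Integration.integral_cong) (auto simp: G1_def G2_def field_simps)
      also have "\<dots> = pi / (2 * \<rho>) * f x"
        unfolding integral_mult_right_zero D0.radial_integral by simp
      finally show "(\<integral>\<kappa>. G1 (\<beta>, \<kappa>) + G2 (\<beta>, \<kappa>) \<partial>lborel) = pi / (2 * \<rho>) * f x" .
    qed
    also have "1 / pi * \<dots> = pi * f x / \<rho>" using rho by simp
    finally show ?thesis .
  qed
  \<comment> \<open>The \<rho> of arc length cancels the one in \<open>vals'\<close>, which leaves b
    pi f(x) and thus accounts for the constant 1 / (b pi).\<close>
  have "(\<integral>y. I y \<partial>circle_measure z \<rho>) = \<rho> * (a * (\<integral>\<alpha>. 1 * D0.W \<alpha> \<partial>ang) + b * ((\<integral>\<alpha>. cos \<alpha> * D1.W \<alpha> \<partial>ang) + (\<integral>\<alpha>. sin \<alpha> * D2.W \<alpha> \<partial>ang)))"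
    unfolding circle_measure_eq_ang(2)[OF rho \<open>I \<in> borel_measurable borel\<close>] I_ang
    using A0(1) A1(1) A2(1) by (simp add: Bochner_Integration.integral_add)
  also have "\<dots> = b * pi * f x" unfolding vals vals' using rho by simp
  finally have part3: "f x = 1 / (b * pi) * (\<integral>y. I y \<partial>circle_measure z \<rho>)" using b by simp
  show "(\<forall>y\<in>sphere z \<rho>. set_integrable lborel {norm (x - y)<..}
       (\<lambda>t. (a * u y t + b * normal_deriv z \<rho> u y t) / sqrt (t\<^sup>2 - (norm (x - y))\<^sup>2))) \<and>
    integrable (circle_measure z \<rho>)
       (\<lambda>y. LINT t:{norm (x - y)<..}|lborel.
          (a * u y t + b * normal_deriv z \<rho> u y t) / sqrt (t\<^sup>2 - (norm (x - y))\<^sup>2)) \<and>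
    f x = 1 / (b * pi) *
      (LINT y|circle_measure z \<rho>. (LINT t:{norm (x - y)<..}|lborel.
         (a * u y t + b * normal_deriv z \<rho> u y t) / sqrt (t\<^sup>2 - (norm (x - y))\<^sup>2)))"
    using part1 part2 part3 unfolding I_def q_def by blast
qed

end
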